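(* Let $\alpha p(p-1)\le1$. If $\theta$ is symmetric, i.e. $\theta(x)=\theta(-x)$ for all $x\in\{-1,1\}^p$, then $F(\beta)$ is differentiable at every $\beta\in\mathbb{R}$. Furthermore, if $$\theta(x_1,\dots,x_p)=\phi(g_1x_1,\dots,g_px_p),$$ where $\phi:\{-1,1\}^p\to\{-1,0\}$ is a deterministic, non-constant function with $\phi(x)=\phi(-x)$ for all $x$, and $g_1,\dots,g_p$ are i.i.d. samples from an arbitrary distribution supported on $\{-1,1\}$, then for any $0<t<1$, almost surely, $$\lim_{\epsilon\downarrow0}\limsup_{N\to\infty}\Bigl|\frac1N\log\mathcal{AN}_{N,\epsilon}(t)-\Bigl(\log2+\alpha(1-t)\log\frac{1-\varrho}{1-t}+\alpha t\log\frac{\varrho}{t}\Bigr)\Bigr|=0,$$ where $\varrho:=\nu^{\otimes p}\bigl(\phi(x_1,\dots,x_p)=0\bigr)\in(0,1)$ and $\nu$ is the uniform probability measure on $\{-1,1\}$.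
   Context: **Constraint satisfaction model.** Let $p\ge2$ be an integer, $\alpha>0$, $\theta:\{-1,1\}^p\to\{-1,0\}$ a random function, $(\theta_k)_{k\ge1}$ i.i.d. copies of $\theta$, $\pi(\alpha N)$ a Poisson random variable with mean $\alpha N$, and for each $k$ let $I(k,1),\dots,I(k,p)$ be distinct indices chosen uniformly from $[N]=\{1,\dots,N\}$; all independent. For $0<\epsilon<1$ and real $t$, $$\mathcal{AN}_{N,\epsilon}(t)=\#\Bigl\{\sigma\in\{-1,1\}^N:\frac1{\pi(\alpha N)}\sum_{k=1}^{\pi(\alpha N)}\bigl(1+\theta_k(\sigma_{I(k,1)},\dots,\sigma_{I(k,p)})\bigr)\in(t-\epsilon,t+\epsilon)\Bigr\}.$$ **The function $F$.** Let $\nu$ be the uniform probability measure on $\Sigma=\{-1,1\}$, $\mathcal{X}=C(\Sigma)$ with the sup norm, and $\Pr_1(\mathcal{X})$ the Borel probability measures $\lambda$ on $\mathcal{X}$ with $\int\|f\|_\infty\lambda(df)<\infty$. Let $\beta>0$. For $\lambda\in\Pr_1(\mathcal{X})$ let $X,X_1,X_2,\dots$ be i.i.d. with law $\lambda$, $\pi(\alpha p)$ Poisson with mean $\alpha p$, with $(X_k),\pi(\alpha p),(\theta_k),\theta$ independent; write $\langle f(\sigma)\rangle_{\beta,X}=\int f(\sigma)\prod_{k=1}^ne^{\beta X_k(\sigma_k)}\nu^{\otimes n}(d\sigma)$ for $f:\Sigma^n\to\mathbb{R}$ and, for $r\ge0$, $\mathcal{E}_{\beta,r}(\sigma,t)=\exp\bigl(\beta\sum_{k=1}^r\theta_k(\sigma_{(k-1)(p-1)+1},\dots,\sigma_{k(p-1)},t)\bigr)$.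 $\mathcal{T}_{\nu,\beta}(\lambda)$ is the law of $$t\mapsto\frac1\beta\log\frac{\langle\mathcal{E}_{\beta,\pi(\alpha p)}(\sigma,t)\rangle_{\beta,X}}{\langle\int\mathcal{E}_{\beta,\pi(\alpha p)}(\sigma,s)\nu(ds)\rangle_{\beta,X}},$$ $$\mathcal{P}_{\nu,\beta}(\lambda)=\mathbb{E}\log\Bigl\langle\int\mathcal{E}_{\beta,\pi(\alpha p)}(\sigma,\varepsilon)\nu(d\varepsilon)\Bigr\rangle_{\beta,X}-\alpha(p-1)\mathbb{E}\log\langle e^{\beta\theta(\sigma)}\rangle_{\beta,X}.$$ When $\alpha p(p-1)\le1$, $\mathcal{T}_{\nu,\beta}$ has a unique fixed point $\lambda_{\nu,\beta}\in\Pr_1(\mathcal{X})$, and $F(\beta):=\mathcal{P}_{\nu,\beta}(\lambda_{\nu,\beta})$. For $\beta<0$, $F(\beta)$ is defined as the value of this construction at $|\beta|$ with $\theta$ replaced by $-\theta$ (and $\theta_k$ by $-\theta_k$); $F(0)=0$. *)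

theory Defs
  imports "HOL-Probability.Probability"
begin

text \<open>
  The spin space \<open>\<Sigma> = {-1, 1}\<close>, with the discrete topology, so that the library type
  \<open>spin \<Rightarrow>\<^sub>C real\<close> of bounded continuous functions is \<open>C(\<Sigma>)\<close> with the sup norm.
\<close>

typedef spin = "{-1, 1 :: int}"
  by auto

setup_lifting type_definition_spin

instantiation spin :: "{one, uminus, times}"
begin

lift_definition one_spin :: spin is 1
  by simp

lift_definition uminus_spin :: "spin \<Rightarrow> spin" is uminus
  by auto

lift_definition times_spin :: "spin \<Rightarrow> spin \<Rightarrow> spin" is times
  by auto

instance ..

end

instantiation spin :: discrete_topology
begin

definition open_spin :: "spin set \<Rightarrow> bool"
  where "open_spin A \<longleftrightarrow> True"

instance
  by standard (simp_all add: open_spin_def)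

end

lemma UNIV_spin: "(UNIV :: spin set) = {1, - 1}"
proof -
  have "x = 1 \<or> x = - 1" for x :: spin
    by transfer auto
  then show ?thesis
    by auto
qed

lemma one_neq_minus_one_spin: "(1 :: spin) \<noteq> - 1"
  by transfer simp

instance spin :: finite
  by standard (simp add: UNIV_spin)

lemma apply_Bcontfun_spin [simp]: "apply_bcontfun (Bcontfun f) = f" for f :: "spin \<Rightarrow> real"
proof (rule Bcontfun_inverse)
  show "f \<in> bcontfun"
    by (auto simp: bcontfun_def intro!: finite_imp_bounded continuous_on_discrete)
qed

definition \<nu> :: "spin pmf"
  where "\<nu> = pmf_of_set UNIV"

text \<open>
  Points of \<open>{-1, 1}\<^sup>p\<close> are lists of length \<open>p\<close>. A (deterministic) function
  \<open>{-1, 1}\<^sup>p \<rightarrow> {-1, 0}\<close> is an extensional element of \<open>constraint_funs p\<close>, and a random function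
  is given by its law, a \<open>pmf\<close> whose support consists of such functions.
\<close>

definition cube :: "nat \<Rightarrow> spin list set"
  where "cube p = {x. length x = p}"

definition constraint_funs :: "nat \<Rightarrow> (spin list \<Rightarrow> real) set"
  where "constraint_funs p = cube p \<rightarrow>\<^sub>E {-1, 0}"

definition symmetric_fun :: "nat \<Rightarrow> (spin list \<Rightarrow> real) \<Rightarrow> bool"
  where "symmetric_fun p \<theta> \<longleftrightarrow> (\<forall>x\<in>cube p. \<theta> x = \<theta> (map uminus x))"

text \<open>The law of \<open>x \<mapsto> \<phi> (g\<^sub>1 x\<^sub>1, \<dots>, g\<^sub>p x\<^sub>p)\<close> for i.i.d. signs \<open>g\<^sub>i\<close> with law \<open>G\<close>.\<close>

definition signed_law :: "nat \<Rightarrow> (spin list \<Rightarrow> real) \<Rightarrow> spin pmf \<Rightarrow> (spin list \<Rightarrow> real) pmf"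
  where "signed_law p \<phi> G =
    map_pmf (\<lambda>g. \<lambda>x\<in>cube p. \<phi> (map2 (*) g x)) (replicate_pmf p G)"


subsection \<open>The function \<open>F\<close>\<close>

text \<open>\<open>\<langle>f(\<sigma>)\<rangle>\<^bsub>\<beta>,X\<^esub>\<close> for a function \<open>f\<close> of the \<open>n\<close> spins \<open>\<sigma> 1, \<dots>, \<sigma> n\<close>.\<close>

definition bracket ::
  "real \<Rightarrow> (nat \<Rightarrow> spin \<Rightarrow>\<^sub>C real) \<Rightarrow> nat \<Rightarrow> ((nat \<Rightarrow> spin) \<Rightarrow> real) \<Rightarrow> real"
  where "bracket \<beta> X n f =
    measure_pmf.expectation (Pi_pmf {1..n} undefined (\<lambda>_. \<nu>))
      (\<lambda>\<sigma>. f \<sigma> * (\<Prod>k=1..n. exp (\<beta> * apply_bcontfun (X k) (\<sigma> k))))"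

definition \<E> ::
  "nat \<Rightarrow> real \<Rightarrow> nat \<Rightarrow> (nat \<Rightarrow> spin list \<Rightarrow> real) \<Rightarrow> (nat \<Rightarrow> spin) \<Rightarrow> spin \<Rightarrow> real"
  where "\<E> p \<beta> r \<Theta> \<sigma> t =
    exp (\<beta> * (\<Sum>k=1..r. \<Theta> k (map \<sigma> [(k - 1) * (p - 1) + 1 ..< k * (p - 1) + 1] @ [t])))"

definition Pr1 :: "(spin \<Rightarrow>\<^sub>C real) measure set"
  where "Pr1 = {\<mu>. sets \<mu> = sets borel \<and> prob_space \<mu> \<and> integrable \<mu> norm}"

text \<open>
  Here and below \<open>T\<close> is the law of \<open>\<theta>\<close>. The following is the joint law of
  \<open>((X\<^sub>k)\<^bsub>k\<ge>1\<^esub>, \<pi>(\<alpha>p), (\<theta>\<^sub>k)\<^bsub>k\<ge>1\<^esub>)\<close>.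
\<close>

definition cavity_space ::
  "real \<Rightarrow> nat \<Rightarrow> (spin list \<Rightarrow> real) pmf \<Rightarrow> (spin \<Rightarrow>\<^sub>C real) measure \<Rightarrow>
    ((nat \<Rightarrow> spin \<Rightarrow>\<^sub>C real) \<times> nat \<times> (nat \<Rightarrow> spin list \<Rightarrow> real)) measure"
  where "cavity_space \<alpha> p T \<mu> =
    (\<Pi>\<^sub>M k\<in>{1..}. \<mu>) \<Otimes>\<^sub>M measure_pmf (poisson_pmf (\<alpha> * real p)) \<Otimes>\<^sub>M
      (\<Pi>\<^sub>M k\<in>{1..}. measure_pmf T)"

definition \<T> ::
  "real \<Rightarrow> nat \<Rightarrow> (spin list \<Rightarrow> real) pmf \<Rightarrow> real \<Rightarrow>
    (spin \<Rightarrow>\<^sub>C real) measure \<Rightarrow> (spin \<Rightarrow>\<^sub>C real) measure"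
  where "\<T> \<alpha> p T \<beta> \<mu> =
    distr (cavity_space \<alpha> p T \<mu>) borel
      (\<lambda>(X, r, \<Theta>). Bcontfun (\<lambda>t. 1 / \<beta> *
        ln (bracket \<beta> X (r * (p - 1)) (\<lambda>\<sigma>. \<E> p \<beta> r \<Theta> \<sigma> t) /
            bracket \<beta> X (r * (p - 1))
              (\<lambda>\<sigma>. measure_pmf.expectation \<nu> (\<lambda>s. \<E> p \<beta> r \<Theta> \<sigma> s)))))"

definition \<P> ::
  "real \<Rightarrow> nat \<Rightarrow> (spin list \<Rightarrow> real) pmf \<Rightarrow> real \<Rightarrow> (spin \<Rightarrow>\<^sub>C real) measure \<Rightarrow> real"
  where "\<P> \<alpha> p T \<beta> \<mu> =
    (\<integral>(X, r, \<Theta>).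
        ln (bracket \<beta> X (r * (p - 1))
          (\<lambda>\<sigma>. measure_pmf.expectation \<nu> (\<lambda>s. \<E> p \<beta> r \<Theta> \<sigma> s)))
      \<partial>cavity_space \<alpha> p T \<mu>) -
    \<alpha> * (real p - 1) *
    (\<integral>(X, \<theta>). ln (bracket \<beta> X p (\<lambda>\<sigma>. exp (\<beta> * \<theta> (map \<sigma> [1..<p+1]))))
      \<partial>((\<Pi>\<^sub>M k\<in>{1..}. \<mu>) \<Otimes>\<^sub>M measure_pmf T))"

definition F_pos :: "real \<Rightarrow> nat \<Rightarrow> (spin list \<Rightarrow> real) pmf \<Rightarrow> real \<Rightarrow> real"
  where "F_pos \<alpha> p T \<beta> = \<P> \<alpha> p T \<beta> (THE \<mu>. \<mu> \<in> Pr1 \<and> \<T> \<alpha> p T \<beta> \<mu> = \<mu>)"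

definition F :: "real \<Rightarrow> nat \<Rightarrow> (spin list \<Rightarrow> real) pmf \<Rightarrow> real \<Rightarrow> real"
  where "F \<alpha> p T \<beta> =
    (if \<beta> > 0 then F_pos \<alpha> p T \<beta>
     else if \<beta> < 0 then F_pos \<alpha> p (map_pmf (\<lambda>\<theta>. \<lambda>x\<in>cube p. - \<theta> x) T) \<bar>\<beta>\<bar>
     else 0)"


subsection \<open>The constraint satisfaction model\<close>

text \<open>The law of \<open>p\<close> distinct indices chosen uniformly from \<open>[N]\<close>; meaningful for \<open>N \<ge> p\<close>.\<close>

definition index_law :: "nat \<Rightarrow> nat \<Rightarrow> nat list pmf"
  where "index_law p N = pmf_of_set {I. length I = p \<and> distinct I \<and> set I \<subseteq> {1..N}}"

definition instance_law ::
  "real \<Rightarrow> nat \<Rightarrow> (spin list \<Rightarrow> real) pmf \<Rightarrow> nat \<Rightarrow>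
    (nat \<times> (nat \<Rightarrow> spin list \<Rightarrow> real) \<times> (nat \<Rightarrow> nat list)) measure"
  where "instance_law \<alpha> p T N =
    measure_pmf (poisson_pmf (\<alpha> * real N)) \<Otimes>\<^sub>M (\<Pi>\<^sub>M k\<in>{1..}. measure_pmf T) \<Otimes>\<^sub>M
      (\<Pi>\<^sub>M k\<in>{1..}. measure_pmf (index_law p N))"

text \<open>
  \<open>\<Theta> k\<close> is \<open>\<theta>\<^sub>k\<close>, \<open>K N\<close> is \<open>\<pi>(\<alpha>N)\<close> and \<open>I N k\<close> is \<open>[I(k,1), \<dots>, I(k,p)]\<close> in the system of size \<open>N\<close>.
  For each \<open>N\<close> they have the prescribed marginals and are independent, i.e. their joint law is
  the product law. No assumption is made on how systems of different sizes are coupled.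
\<close>

definition csp_model ::
  "real \<Rightarrow> nat \<Rightarrow> (spin list \<Rightarrow> real) pmf \<Rightarrow> 'w measure \<Rightarrow>
    (nat \<Rightarrow> 'w \<Rightarrow> spin list \<Rightarrow> real) \<Rightarrow> (nat \<Rightarrow> 'w \<Rightarrow> nat) \<Rightarrow> (nat \<Rightarrow> nat \<Rightarrow> 'w \<Rightarrow> nat list) \<Rightarrow> bool"
  where "csp_model \<alpha> p T M \<Theta> K I \<longleftrightarrow>
    prob_space M \<and>
    (\<forall>N\<ge>p.
      (\<lambda>\<omega>. (K N \<omega>, \<lambda>k\<in>{1..}. \<Theta> k \<omega>, \<lambda>k\<in>{1..}. I N k \<omega>)) \<in> M \<rightarrow>\<^sub>M instance_law \<alpha> p T N \<and>
      distr M (instance_law \<alpha> p T N)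
        (\<lambda>\<omega>. (K N \<omega>, \<lambda>k\<in>{1..}. \<Theta> k \<omega>, \<lambda>k\<in>{1..}. I N k \<omega>)) = instance_law \<alpha> p T N)"

text \<open>
  \<open>AN N K \<Theta> I \<epsilon> t\<close>, for a realisation \<open>K\<close>, \<open>\<Theta>\<close>, \<open>I\<close> of the randomness; configurations in
  \<open>{-1, 1}\<^sup>N\<close> are functions on \<open>{1..N}\<close>. For \<open>K = 0\<close> the average is read as \<open>0\<close>, which is
  immaterial for the limit \<open>N \<rightarrow> \<infinity>\<close>.
\<close>

definition AN ::
  "nat \<Rightarrow> nat \<Rightarrow> (nat \<Rightarrow> spin list \<Rightarrow> real) \<Rightarrow> (nat \<Rightarrow> nat list) \<Rightarrow> real \<Rightarrow> real \<Rightarrow> nat"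
  where "AN N K \<Theta> I \<epsilon> t =
    card {\<sigma> \<in> {1..N} \<rightarrow>\<^sub>E (UNIV :: spin set).
      1 / real K * (\<Sum>k=1..K. (1 + \<Theta> k (map \<sigma> (I k)))) \<in> {t - \<epsilon> <..< t + \<epsilon>}}"

text \<open>The logarithm of a count, with \<open>log 0 = -\<infinity>\<close> (whereas \<open>ln 0 = 0\<close> in the library).\<close>

definition log_count :: "nat \<Rightarrow> ereal"
  where "log_count n = (if n = 0 then -\<infinity> else ereal (ln (real n)))"

end

theory Submission
  imports Defs
begin

text \<open>
  Everything rests on one exact identity, \<open>avg_prod_hyperforest\<close>. Call a family of hyperedges a
  hyperforest if each edge meets every component formed by the earlier edges in at most one vertex.
  If each edge carries a function of its spins that is invariant under the global flip, then these
  functions are independent under the uniform measure on assignments, because the components that a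
  new edge joins can be flipped separately without changing the earlier functions.

  For the limit, the constraints of the model form a random hypergraph on \<open>N\<close> vertices with about
  \<open>\<alpha> N\<close> edges, and \<open>\<alpha> p (p - 1) \<le> 1\<close> says that it is not supercritical. After a small fraction of
  the edges is discarded it is subcritical, so that expected cluster sizes are bounded
  (\<open>avg_cluster_size_le\<close>). Therefore the expected number of further deletions needed to reach a
  hyperforest is bounded too. This number changes by at most one with each edge, so McDiarmid's
  inequality makes it smaller than any given multiple of \<open>N\<close> outside an event of exponentially small
  probability (\<open>avg_defect_tail\<close>), and by the Borel-Cantelli lemma almost surely only \<open>o(N)\<close> edges are
  deleted. This moves the fraction of satisfied constraints by \<open>o(1)\<close>. On the
  hyperforest, a uniform assignment satisfies the constraints independently with probability \<open>\<rho>\<close>,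
  and the proportion of assignments that satisfy a fraction \<open>t\<close> of them is found as in Cramer's
  theorem: the uniform measure is tilted so that \<open>t\<close> becomes typical, and Chebyshev's inequality
  shows that the window around \<open>t\<close> has most of the tilted mass. All of this holds for a given
  realisation and all window widths at once (\<open>AN_limit\<close>), so that the randomness enters only
  through the number of edges and the number of deletions.

  For the differentiability, symmetry of the constraints makes the zero field a fixed point of the
  distributional recursion. It is the only one: the oscillation of a new field is strictly
  smaller than the sum of the oscillations of the fields that enter it, unless these
  vanish (\<open>osc_cavity_field_less\<close>), while this sum has mean at most that of a single oscillation
  (\<open>fixed_point_imp_0\<close>). With zero fields the cavity graph is a star, in particular a hyperforest, and
  the identity above gives \<open>F \<beta> = \<alpha> E ln \<nu>\<^sup>\<otimes>\<^sup>p (exp (\<beta> \<theta>))\<close> for all real \<open>\<beta>\<close>. This is a finite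
  combination of logarithms of positive sums of exponentials.
\<close>

section \<open>Averages over finite sets\<close>

definition avg :: "'a set \<Rightarrow> ('a \<Rightarrow> real) \<Rightarrow> real"
  where "avg S f = (\<Sum>x\<in>S. f x) / real (card S)"

lemma avg_cong: "(\<And>x. x \<in> S \<Longrightarrow> f x = g x) \<Longrightarrow> avg S f = avg S g"
  by (simp add: avg_def)

lemma avg_mono: "(\<And>x. x \<in> S \<Longrightarrow> f x \<le> g x) \<Longrightarrow> avg S f \<le> avg S g"
  unfolding avg_def by (intro divide_right_mono sum_mono) auto

lemma avg_const: "finite S \<Longrightarrow> S \<noteq> {} \<Longrightarrow> avg S (\<lambda>_. c) = c"
  by (simp add: avg_def)

lemma avg_add: "avg S (\<lambda>x. f x + g x) = avg S f + avg S g"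
  by (simp add: avg_def sum.distrib add_divide_distrib)

lemma avg_diff: "avg S (\<lambda>x. f x - g x) = avg S f - avg S g"
  by (simp add: avg_def sum_subtractf diff_divide_distrib)

lemma avg_cmult: "avg S (\<lambda>x. c * f x) = c * avg S f"
  by (simp add: avg_def sum_distrib_left)

lemma avg_multc: "avg S (\<lambda>x. f x * c) = avg S f * c"
  by (simp add: avg_def sum_distrib_right)

lemma avg_sum: "avg S (\<lambda>x. \<Sum>i\<in>J. f i x) = (\<Sum>i\<in>J. avg S (f i))"
  unfolding avg_def by (subst sum.swap) (simp add: sum_divide_distrib)

lemma avg_swap: "avg S (\<lambda>x. avg T (f x)) = avg T (\<lambda>y. avg S (\<lambda>x. f x y))"
  unfolding avg_def sum_divide_distrib[symmetric]
  by (subst sum.swap) (simp add: mult.commute)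

lemma avg_bij:
  assumes "bij_betw g S T"
  shows "avg S (\<lambda>x. f (g x)) = avg T f"
  unfolding avg_def using sum.reindex_bij_betw[OF assms, of f] bij_betw_same_card[OF assms] by simp

lemma avg_pos:
  assumes "finite S" "S \<noteq> {}" "\<And>x. x \<in> S \<Longrightarrow> 0 < f x"
  shows "0 < avg S f"
  unfolding avg_def using assms by (intro divide_pos_pos sum_pos) (auto simp: card_gt_0_iff)

lemma avg_indicator:
  assumes "finite S"
  shows "avg S (\<lambda>x. of_bool (P x)) = real (card {x\<in>S. P x}) / real (card S)"
  using assms by (simp add: avg_def Int_def)

lemma expectation_pmf_of_set:
  assumes "finite S" "S \<noteq> {}"
  shows "measure_pmf.expectation (pmf_of_set S) f = avg S f"
  unfolding avg_def by (rule integral_pmf_of_set[OF assms(2,1)])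

text \<open>
  Fubini's theorem for one coordinate: averages over independent uniform coordinates are what all
  finite probability spaces below reduce to, and this is the step by which they are conditioned
  on all coordinates but one.
\<close>

lemma avg_PiE_insert:
  assumes "finite A" "finite S" "k \<notin> A"
  shows "avg (insert k A \<rightarrow>\<^sub>E S) f = avg S (\<lambda>s. avg (A \<rightarrow>\<^sub>E S) (\<lambda>E. f (E(k := s))))"
proof -
  have "(\<Sum>E\<in>insert k A \<rightarrow>\<^sub>E S. f E) = (\<Sum>(s, E)\<in>S \<times> (A \<rightarrow>\<^sub>E S). f (E(k := s)))"
    unfolding PiE_insert_eq
    by (subst sum.reindex[OF inj_combinator[OF assms(3)]]) (simp add: case_prod_beta)
  also have "\<dots> = (\<Sum>s\<in>S. \<Sum>E\<in>A \<rightarrow>\<^sub>E S. f (E(k := s)))"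
    by (rule sum.cartesian_product[symmetric])
  finally show ?thesis
    using assms unfolding avg_def sum_divide_distrib[symmetric]
    by (simp add: card_PiE mult.commute)
qed

section \<open>Spins\<close>

lemma spin_cases: "(s :: spin) = 1 \<or> s = -1"
  using UNIV_spin by auto

lemma spin_mult_1 [simp]: "1 * (s :: spin) = s"
  by transfer simp

lemma spin_mult_minus_1 [simp]: "- 1 * (s :: spin) = - s"
  by transfer simp

lemma spin_minus_minus [simp]: "- (- (s :: spin)) = s"
  by transfer simp

lemma spin_square [simp]: "s * (s :: spin) = 1"
  by transfer auto

lemma spin_assoc: "a * (b * c) = (a * b) * (c :: spin)"
  by transfer simp

lemma spin_commute: "a * b = b * (a :: spin)"
  by transfer simp

lemma spin_cancel [simp]: "s * (s * a) = (a :: spin)"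
  by (simp add: spin_assoc)

lemma card_UNIV_spin: "card (UNIV :: spin set) = 2"
  unfolding UNIV_spin using one_neq_minus_one_spin by simp

lemma cube_altdef: "cube p = {x. set x \<subseteq> UNIV \<and> length x = p}"
  by (simp add: cube_def)

lemma finite_cube: "finite (cube p)"
  unfolding cube_altdef by (rule finite_lists_length_eq) simp

lemma card_cube: "card (cube p) = 2 ^ p"
  unfolding cube_altdef using card_lists_length_eq[of "UNIV :: spin set" p] by (simp add: card_UNIV_spin)

lemma cube_nonempty: "cube p \<noteq> {}"
  using card_cube[of p] by auto

lemma map2_mult_cancel: "length s = length x \<Longrightarrow> map2 (*) s (map2 (*) s x) = (x :: spin list)"
  by (rule nth_equalityI) auto

lemma bij_betw_cube_mult_left:
  assumes "s \<in> cube p"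
  shows "bij_betw (map2 (*) s) (cube p) (cube p)"
  by (rule bij_betw_byWitness[where f' = "map2 (*) s"])
     (use assms in \<open>auto simp: cube_def map2_mult_cancel\<close>)

lemma map2_mult_commute: "map2 (*) s x = map2 (*) x (s :: spin list)"
proof (rule nth_equalityI)
  show "map2 (*) s x ! i = map2 (*) x s ! i" if "i < length (map2 (*) s x)" for i
    using that by (auto intro: spin_commute)
qed simp

lemma finite_configs: "finite V \<Longrightarrow> finite (V \<rightarrow>\<^sub>E (UNIV :: spin set))"
  by (intro finite_PiE) auto

lemma configs_nonempty: "V \<rightarrow>\<^sub>E (UNIV :: spin set) \<noteq> {}"
  by (simp add: PiE_eq_empty_iff)

section \<open>Hyperforests\<close>

definition adj :: "('k \<Rightarrow> 'v list) \<Rightarrow> 'k set \<Rightarrow> ('v \<times> 'v) set"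
  where "adj e A = {(a, b). \<exists>k\<in>A. a \<in> set (e k) \<and> b \<in> set (e k)}"

definition conn :: "('k \<Rightarrow> 'v list) \<Rightarrow> 'k set \<Rightarrow> ('v \<times> 'v) set"
  where "conn e A = (adj e A)\<^sup>*"

text \<open>
  Acyclicity is phrased along the order of the indices, so that a hyperforest is built edge by edge:
  each edge meets every component formed by the earlier edges in at most one vertex. In particular
  the property passes to subfamilies.
\<close>

definition hyperforest :: "('k :: linorder \<Rightarrow> 'v list) \<Rightarrow> 'k set \<Rightarrow> bool"
  where "hyperforest e A \<longleftrightarrow>
    (\<forall>k\<in>A. \<forall>a\<in>set (e k). \<forall>b\<in>set (e k). a \<noteq> b \<longrightarrow> (a, b) \<notin> conn e {j\<in>A. j < k})"

lemma adj_mono: "A \<subseteq> B \<Longrightarrow> adj e A \<subseteq> adj e B"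
  by (auto simp: adj_def)

lemma adj_cong: "(\<And>k. k \<in> A \<Longrightarrow> e k = e' k) \<Longrightarrow> adj e A = adj e' A"
  by (auto simp: adj_def)

lemma conn_mono: "A \<subseteq> B \<Longrightarrow> conn e A \<subseteq> conn e B"
  unfolding conn_def by (intro rtrancl_mono adj_mono)

lemma conn_cong: "(\<And>k. k \<in> A \<Longrightarrow> e k = e' k) \<Longrightarrow> conn e A = conn e' A"
  unfolding conn_def using adj_cong by metis

lemma conn_refl [simp]: "(a, a) \<in> conn e A"
  by (simp add: conn_def)

lemma conn_trans: "(a, b) \<in> conn e A \<Longrightarrow> (b, c) \<in> conn e A \<Longrightarrow> (a, c) \<in> conn e A"
  unfolding conn_def by (rule rtrancl_trans)

lemma conn_sym: "(a, b) \<in> conn e A \<Longrightarrow> (b, a) \<in> conn e A"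
proof -
  have "sym (adj e A)"
    by (auto simp: adj_def sym_def)
  then show "(a, b) \<in> conn e A \<Longrightarrow> (b, a) \<in> conn e A"
    unfolding conn_def by (meson sym_rtrancl symD)
qed

lemma conn_edge: "k \<in> A \<Longrightarrow> a \<in> set (e k) \<Longrightarrow> b \<in> set (e k) \<Longrightarrow> (a, b) \<in> conn e A"
  unfolding conn_def adj_def by auto

lemma hyperforest_subset:
  assumes "hyperforest e B" "A \<subseteq> B"
  shows "hyperforest e A"
  unfolding hyperforest_def
proof (intro ballI impI)
  fix k a b assume *: "k \<in> A" "a \<in> set (e k)" "b \<in> set (e k)" "a \<noteq> b"
  have "conn e {j \<in> A. j < k} \<subseteq> conn e {j \<in> B. j < k}"
    using assms(2) by (intro conn_mono) auto
  then show "(a, b) \<notin> conn e {j \<in> A. j < k}"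
    using assms * unfolding hyperforest_def by blast
qed

lemma hyperforest_cong:
  assumes "\<And>k. k \<in> A \<Longrightarrow> e k = e' k"
  shows "hyperforest e A \<longleftrightarrow> hyperforest e' A"
proof -
  have "conn e {j\<in>A. j < k} = conn e' {j\<in>A. j < k}" for k
    using assms by (intro conn_cong) auto
  then show ?thesis
    using assms unfolding hyperforest_def by (auto 4 4)
qed

text \<open>
  Symmetric weights on the edges of a hyperforest are independent under the uniform measure on
  assignments. The edges are added in order. The vertices of the last edge \<open>b\<close> lie in different
  components of the earlier edges, so each of these components can be flipped separately. Such flips
  preserve the uniform measure and, by symmetry, all the earlier weights, but they multiply the
  restriction of the assignment to \<open>b\<close> by an arbitrary point of the cube. Averaging over that point
  replaces the weight of \<open>b\<close> by its mean.
\<close>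

theorem avg_prod_hyperforest:
  fixes e :: "nat \<Rightarrow> 'v list"
  assumes "finite V" "finite A" "hyperforest e A"
    and "\<And>k. k \<in> A \<Longrightarrow> distinct (e k) \<and> length (e k) = p \<and> set (e k) \<subseteq> V"
    and "\<And>k. k \<in> A \<Longrightarrow> symmetric_fun p (w k)"
  shows "avg (V \<rightarrow>\<^sub>E UNIV) (\<lambda>\<sigma>. \<Prod>k\<in>A. w k (map \<sigma> (e k))) = (\<Prod>k\<in>A. avg (cube p) (w k))"
  using assms(2-5)
proof (induction A rule: finite_linorder_max_induct)
  case empty
  then show ?case
    by (simp add: avg_const finite_configs[OF assms(1)] configs_nonempty)
next
  case (insert b A)
  \<comment> \<open>the sign by which the component of \<open>v\<close> is multiplied if the spin of the \<open>i\<close>-th vertex of \<open>b\<close> is to be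
    multiplied by \<open>s ! i\<close>; components that avoid \<open>b\<close> are left alone\<close>
  define U where "U (s :: spin list) v = (if \<exists>i<p. s ! i = -1 \<and> (e b ! i, v) \<in> conn e A then -1 else 1 :: spin)" for s v
  define g where "g s \<sigma> = (\<lambda>v\<in>V. U s v * \<sigma> v)" for s \<sigma>
  have bA: "b \<notin> A"
    using insert.hyps by auto
  have eb: "distinct (e b)" "length (e b) = p" "set (e b) \<subseteq> V"
    using insert.prems by auto
  have sep: "i = j" if "i < p" "j < p" "(e b ! i, e b ! j) \<in> conn e A" for i j
  proof -
    have "{j \<in> insert b A. j < b} = A"
      using insert.hyps by auto
    then have "e b ! i = e b ! j"
      using insert.prems(1) that eb unfolding hyperforest_def by (metis insertI1 nth_mem)
    then show ?thesis
      using that eb by (simp add: nth_eq_iff_index_eq)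
  qed
  have U_eb: "U s (e b ! i) = s ! i" if "i < p" for s i
  proof -
    have "(\<exists>j<p. s ! j = -1 \<and> (e b ! j, e b ! i) \<in> conn e A) \<longleftrightarrow> s ! i = -1"
      using that sep by (metis conn_refl)
    then show ?thesis
      using spin_cases[of "s ! i"] unfolding U_def by auto
  qed
  have g_eb: "map (g s \<sigma>) (e b) = map2 (*) s (map \<sigma> (e b))" if "s \<in> cube p" for s \<sigma>
    using eb that by (intro nth_equalityI) (auto simp: g_def cube_def U_eb subset_iff)
  have U_const: "U s v = U s v'" if "k \<in> A" "v \<in> set (e k)" "v' \<in> set (e k)" for s k v v'
    unfolding U_def using that conn_edge[of k A v e v'] conn_edge[of k A v' e v] by (meson conn_trans)
  have w_inv: "w k (map (g s \<sigma>) (e k)) = w k (map \<sigma> (e k))" if k: "k \<in> A" for k s \<sigma>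
  proof -
    have ek: "length (e k) = p" "set (e k) \<subseteq> V" "symmetric_fun p (w k)"
      using insert.prems that by auto
    consider "\<forall>v\<in>set (e k). U s v = 1" | "\<forall>v\<in>set (e k). U s v = -1"
      using U_const[OF k] spin_cases by metis
    then show ?thesis
    proof cases
      case 1
      then have "map (g s \<sigma>) (e k) = map \<sigma> (e k)"
        using ek by (auto simp: g_def)
      then show ?thesis by (simp only:)
    next
      case 2
      then have "map (g s \<sigma>) (e k) = map uminus (map \<sigma> (e k))"
        using ek by (auto simp: g_def)
      moreover have "map \<sigma> (e k) \<in> cube p"
        using ek by (simp add: cube_def)
      ultimately show ?thesis
        using ek(3) unfolding symmetric_fun_def by metis
    qed
  qed
  have g_bij: "bij_betw (g s) (V \<rightarrow>\<^sub>E UNIV) (V \<rightarrow>\<^sub>E UNIV)" for s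
    by (rule bij_betw_byWitness[where f' = "g s"]) (auto simp: g_def fun_eq_iff PiE_def extensional_def)
  let ?P = "\<lambda>\<sigma>. \<Prod>k\<in>A. w k (map \<sigma> (e k))"
  have *: "avg (V \<rightarrow>\<^sub>E UNIV) (\<lambda>\<sigma>. ?P \<sigma> * w b (map \<sigma> (e b)))
      = avg (V \<rightarrow>\<^sub>E UNIV) (\<lambda>\<sigma>. ?P \<sigma> * w b (map2 (*) s (map \<sigma> (e b))))" if "s \<in> cube p" for s
    by (subst avg_bij[OF g_bij, symmetric, of _ s]) (simp add: w_inv g_eb[OF that])
  have "avg (V \<rightarrow>\<^sub>E UNIV) (\<lambda>\<sigma>. \<Prod>k\<in>insert b A. w k (map \<sigma> (e k)))
      = avg (V \<rightarrow>\<^sub>E UNIV) (\<lambda>\<sigma>. ?P \<sigma> * w b (map \<sigma> (e b)))"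
    using insert.hyps bA by (simp add: mult.commute)
  also have "\<dots> = avg (cube p) (\<lambda>s. avg (V \<rightarrow>\<^sub>E UNIV) (\<lambda>\<sigma>. ?P \<sigma> * w b (map \<sigma> (e b))))"
    by (simp add: avg_const finite_cube cube_nonempty)
  also have "\<dots> = avg (cube p) (\<lambda>s. avg (V \<rightarrow>\<^sub>E UNIV) (\<lambda>\<sigma>. ?P \<sigma> * w b (map2 (*) s (map \<sigma> (e b)))))"
    by (rule avg_cong) (rule *)
  also have "\<dots> = avg (V \<rightarrow>\<^sub>E UNIV) (\<lambda>\<sigma>. ?P \<sigma> * avg (cube p) (\<lambda>s. w b (map2 (*) s (map \<sigma> (e b)))))"
    by (subst avg_swap) (simp add: avg_cmult)
  also have "\<dots> = avg (V \<rightarrow>\<^sub>E UNIV) (\<lambda>\<sigma>. ?P \<sigma> * avg (cube p) (w b))"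
  proof (intro avg_cong)
    fix \<sigma>
    have "map \<sigma> (e b) \<in> cube p"
      using eb by (simp add: cube_def)
    from avg_bij[OF bij_betw_cube_mult_left[OF this], of "w b"]
    show "?P \<sigma> * avg (cube p) (\<lambda>s. w b (map2 (*) s (map \<sigma> (e b)))) = ?P \<sigma> * avg (cube p) (w b)"
      by (simp only: map2_mult_commute[of _ "map \<sigma> (e b)"])
  qed
  also have "\<dots> = (\<Prod>k\<in>A. avg (cube p) (w k)) * avg (cube p) (w b)"
    unfolding avg_multc
    by (subst insert.IH) (use insert.prems in \<open>auto intro: hyperforest_subset\<close>)
  also have "\<dots> = (\<Prod>k\<in>insert b A. avg (cube p) (w k))"
    using insert.hyps bA by (simp add: mult.commute)
  finally show ?case .
qed

section \<open>Bounded differences\<close>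

text \<open>
  Hoeffding's lemma, applied on the interval of length 2 around one value of \<open>g\<close>. The optimal
  interval has length 1; the constant is immaterial and this choice avoids extremal values.
\<close>

lemma avg_exp_Hoeffding:
  assumes S: "finite S" "S \<noteq> {}" and g: "\<And>s s'. s \<in> S \<Longrightarrow> s' \<in> S \<Longrightarrow> \<bar>g s - g s'\<bar> \<le> 1" and l: "l > 0"
  shows "avg S (\<lambda>s. exp (l * g s)) \<le> exp (l * avg S g + l\<^sup>2 / 2)"
proof -
  obtain s0 where s0: "s0 \<in> S"
    using S by auto
  let ?M = "measure_pmf (pmf_of_set S)"
  interpret prob_space ?M
    by (rule measure_pmf.prob_space_axioms)
  interpret interval_bounded_random_variable ?M g "g s0 - 1" "g s0 + 1"
  proof unfold_locales
    have "g x \<in> {g s0 - 1..g s0 + 1}" if "x \<in> S" for x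
      using g[OF that s0] by (auto simp: abs_le_iff)
    then show "AE x in ?M. g x \<in> {g s0 - 1..g s0 + 1}"
      using S by (simp add: AE_measure_pmf_iff)
  qed auto
  have int: "integrable ?M h" for h :: "'a \<Rightarrow> real"
    using S by (intro integrable_measure_pmf_finite) auto
  have "ennreal (avg S (\<lambda>s. exp (l * (g s - avg S g))))
      = (\<integral>\<^sup>+ s. ennreal (exp (l * (g s - avg S g))) \<partial>?M)"
    unfolding expectation_pmf_of_set[OF S, symmetric]
    by (rule nn_integral_eq_integral[symmetric]) (auto intro: int)
  also have "\<dots> \<le> ennreal (exp (l\<^sup>2 * (g s0 + 1 - (g s0 - 1))\<^sup>2 / 8))"
    using Hoeffdings_lemma_nn_integral[OF l] by (simp add: expectation_pmf_of_set[OF S])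
  finally have "avg S (\<lambda>s. exp (l * (g s - avg S g))) \<le> exp (l\<^sup>2 / 2)"
    by simp
  moreover have "avg S (\<lambda>s. exp (l * g s)) = exp (l * avg S g) * avg S (\<lambda>s. exp (l * (g s - avg S g)))"
    by (subst avg_cmult[symmetric], rule avg_cong) (simp add: algebra_simps flip: exp_add)
  ultimately show ?thesis
    by (simp add: exp_add)
qed

text \<open>
  McDiarmid's inequality for the exponential moment. Conditionally on the coordinate \<open>k\<close>, the
  induction hypothesis bounds the exponential moment by that of the conditional mean \<open>g\<close>, and \<open>g\<close>
  inherits bounded differences from \<open>f\<close>, so that Hoeffding's lemma applies to it.
\<close>

theorem avg_exp_bounded_differences:
  assumes "finite A" "finite S" "S \<noteq> {}" "l > 0"
    and "\<And>e k s. e \<in> A \<rightarrow>\<^sub>E S \<Longrightarrow> k \<in> A \<Longrightarrow> s \<in> S \<Longrightarrow> \<bar>f (e(k := s)) - f e\<bar> \<le> (1 :: real)"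
  shows "avg (A \<rightarrow>\<^sub>E S) (\<lambda>e. exp (l * f e)) \<le> exp (l * avg (A \<rightarrow>\<^sub>E S) f + real (card A) * (l\<^sup>2 / 2))"
  using assms(1,5)
proof (induction A arbitrary: f)
  case empty
  then show ?case by (simp add: avg_def)
next
  case (insert k A)
  note S = assms(2,3)
  define g where "g s = avg (A \<rightarrow>\<^sub>E S) (\<lambda>E. f (E(k := s)))" for s
  have fin: "finite (A \<rightarrow>\<^sub>E S)" "A \<rightarrow>\<^sub>E S \<noteq> {}"
    using insert.hyps S by (auto intro!: finite_PiE simp: PiE_eq_empty_iff)
  have ext: "E(k := s) \<in> insert k A \<rightarrow>\<^sub>E S" if "E \<in> A \<rightarrow>\<^sub>E S" "s \<in> S" for E s
    using that by (auto simp: PiE_def extensional_def)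
  have g_diff: "g s - g s' \<le> 1" if "s \<in> S" "s' \<in> S" for s s'
  proof -
    have "g s - g s' = avg (A \<rightarrow>\<^sub>E S) (\<lambda>E. f (E(k := s)) - f (E(k := s')))"
      by (simp add: g_def avg_diff)
    also have "\<dots> \<le> avg (A \<rightarrow>\<^sub>E S) (\<lambda>E. 1)"
    proof (rule avg_mono)
      fix E assume "E \<in> A \<rightarrow>\<^sub>E S"
      then have "\<bar>f (E(k := s', k := s)) - f (E(k := s'))\<bar> \<le> 1"
        using that by (intro insert.prems ext) auto
      then show "f (E(k := s)) - f (E(k := s')) \<le> 1"
        by (simp only: fun_upd_upd abs_le_iff)
    qed
    also have "\<dots> = 1"
      using fin by (simp add: avg_const)
    finally show ?thesis .
  qed
  have "avg (insert k A \<rightarrow>\<^sub>E S) (\<lambda>e. exp (l * f e))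
      = avg S (\<lambda>s. avg (A \<rightarrow>\<^sub>E S) (\<lambda>E. exp (l * f (E(k := s)))))"
    using insert.hyps S by (intro avg_PiE_insert) auto
  also have "\<dots> \<le> avg S (\<lambda>s. exp (l * g s + real (card A) * (l\<^sup>2 / 2)))"
  proof (rule avg_mono)
    fix s assume s: "s \<in> S"
    show "avg (A \<rightarrow>\<^sub>E S) (\<lambda>E. exp (l * f (E(k := s)))) \<le> exp (l * g s + real (card A) * (l\<^sup>2 / 2))"
      unfolding g_def
    proof (rule insert.IH[where f = "\<lambda>E. f (E(k := s))"])
      fix e j t assume *: "e \<in> A \<rightarrow>\<^sub>E S" "j \<in> A" "t \<in> S"
      then have "j \<noteq> k"
        using insert.hyps by auto
      then have eq: "(e(j := t))(k := s) = (e(k := s))(j := t)"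
        by (rule fun_upd_twist)
      show "\<bar>f ((e(j := t))(k := s)) - f (e(k := s))\<bar> \<le> 1"
        unfolding eq using * s by (intro insert.prems ext) auto
    qed
  qed
  also have "\<dots> = avg S (\<lambda>s. exp (l * g s)) * exp (real (card A) * (l\<^sup>2 / 2))"
    by (simp add: exp_add avg_multc)
  also have "\<dots> \<le> exp (l * avg S g + l\<^sup>2 / 2) * exp (real (card A) * (l\<^sup>2 / 2))"
    using g_diff S assms(4) by (intro mult_right_mono avg_exp_Hoeffding) (auto simp: abs_le_iff)
  also have "avg S g = avg (insert k A \<rightarrow>\<^sub>E S) f"
    unfolding g_def using insert.hyps S by (intro avg_PiE_insert[symmetric]) auto
  finally show ?case
    using insert.hyps by (simp add: exp_add[symmetric] algebra_simps add_divide_distrib)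
qed

section \<open>Few deletions turn a sparse random hypergraph into a hyperforest\<close>

definition edges :: "nat \<Rightarrow> nat \<Rightarrow> nat list set"
  where "edges p N = {I. length I = p \<and> distinct I \<and> set I \<subseteq> {1..N}}"

lemma finite_edges: "finite (edges p N)"
  by (rule finite_subset[OF _ finite_lists_length_eq[of "{1..N}" p]]) (auto simp: edges_def)

lemma edges_vertex: "I \<in> edges p N \<Longrightarrow> v \<in> set I \<Longrightarrow> v \<in> {1..N}"
  by (auto simp: edges_def)

lemma edges_nonempty:
  assumes "p \<le> N"
  shows "edges p N \<noteq> {}"
proof -
  have "[1..<p+1] \<in> edges p N"
    using assms by (auto simp: edges_def)
  then show ?thesis by auto
qed

text \<open>
  The probability cannot depend on the pair, since the symmetric group acts transitively on pairs
  of distinct vertices and preserves the set of edges. Counting the ordered pairs contained in an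
  edge then gives its value.
\<close>

lemma avg_edges_pair:
  assumes "2 \<le> N" "p \<le> N" "u \<in> {1..N}" "v \<in> {1..N}" "u \<noteq> v"
  shows "avg (edges p N) (\<lambda>I. of_bool (u \<in> set I \<and> v \<in> set I)) = real p * (real p - 1) / (real N * (real N - 1))"
proof -
  let ?V = "{1..N}"
  define q where "q u v = avg (edges p N) (\<lambda>I. of_bool (u \<in> set I \<and> v \<in> set I))" for u v
  define D where "D = {(a, b). a \<in> ?V \<and> b \<in> ?V \<and> a \<noteq> b}"
  have D: "finite D" "card D = N * (N - 1)"
  proof -
    have D': "D = Sigma ?V (\<lambda>a. ?V - {a})"
      by (auto simp: D_def)
    show "finite D" "card D = N * (N - 1)"
      unfolding D' by (auto simp: card_SigmaI)
  qed
  have inv: "q u' v' = q u v" if uv': "u' \<in> ?V" "v' \<in> ?V" "u' \<noteq> v'" for u' v'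
  proof -
    define \<tau> where "\<tau> = Transposition.transpose u u'"
    define \<pi> where "\<pi> = Transposition.transpose (\<tau> v) v' \<circ> \<tau>"
    have tp: "\<tau> permutes ?V"
      unfolding \<tau>_def using assms uv' by (intro permutes_swap_id) auto
    have "\<tau> v \<in> ?V"
      using permutes_in_image[OF tp] assms by blast
    then have pp: "\<pi> permutes ?V"
      unfolding \<pi>_def using tp uv' by (intro permutes_compose permutes_swap_id)
    have "\<tau> u = u'"
      by (simp add: \<tau>_def)
    have "\<tau> v \<noteq> u'"
      using \<open>\<tau> u = u'\<close> permutes_inj[OF tp] assms(5) by (metis injD)
    then have pu: "\<pi> u = u'" and pv: "\<pi> v = v'"
      using uv' \<open>\<tau> u = u'\<close> by (auto simp: \<pi>_def)
    have inj: "inj \<pi>"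
      by (rule permutes_inj[OF pp])
    have ed: "map r I \<in> edges p N" if "I \<in> edges p N" "r permutes ?V" for r I
    proof -
      have "set I \<subseteq> ?V"
        using that by (simp add: edges_def)
      then have "r ` set I \<subseteq> ?V"
        using permutes_image[OF that(2)] by (metis image_mono)
      moreover have "distinct (map r I)"
        using that(1) inj_on_subset[OF permutes_inj[OF that(2)] subset_UNIV] by (simp add: edges_def distinct_map)
      ultimately show ?thesis
        using that(1) by (simp add: edges_def)
    qed
    have bij: "bij_betw (map \<pi>) (edges p N) (edges p N)"
    proof (rule bij_betw_byWitness[where f' = "map (inv \<pi>)"])
      show "\<forall>a\<in>edges p N. map (inv \<pi>) (map \<pi> a) = a"
        using permutes_inverses[OF pp] by (simp add: map_idI)
      show "\<forall>a\<in>edges p N. map \<pi> (map (inv \<pi>) a) = a"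
        using permutes_inverses[OF pp] by (simp add: map_idI)
      show "map \<pi> ` edges p N \<subseteq> edges p N"
        using ed pp by blast
      show "map (inv \<pi>) ` edges p N \<subseteq> edges p N"
        using ed permutes_inv[OF pp] by blast
    qed
    have "q u' v' = avg (edges p N) (\<lambda>I. of_bool (u' \<in> set (map \<pi> I) \<and> v' \<in> set (map \<pi> I)))"
      unfolding q_def by (rule avg_bij[OF bij, symmetric])
    also have "\<dots> = q u v"
      unfolding q_def pu[symmetric] pv[symmetric] using inj by (simp add: inj_image_mem_iff)
    finally show ?thesis .
  qed
  have "real p * (real p - 1) = avg (edges p N) (\<lambda>I. real p * (real p - 1))"
    using finite_edges edges_nonempty assms by (simp add: avg_const)
  also have "\<dots> = avg (edges p N) (\<lambda>I. \<Sum>(a, b)\<in>D. of_bool (a \<in> set I \<and> b \<in> set I))"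
  proof (rule avg_cong)
    fix I assume I: "I \<in> edges p N"
    have "(\<Sum>(a, b)\<in>D. of_bool (a \<in> set I \<and> b \<in> set I)) = real (card {x\<in>D. fst x \<in> set I \<and> snd x \<in> set I})"
      using D by (simp add: case_prod_beta Int_def)
    also have "{x\<in>D. fst x \<in> set I \<and> snd x \<in> set I} = Sigma (set I) (\<lambda>a. set I - {a})"
      using I by (auto simp: D_def edges_def)
    also have "card \<dots> = p * (p - 1)"
      using I by (simp add: card_SigmaI edges_def distinct_card)
    finally show "real p * (real p - 1) = (\<Sum>(a, b)\<in>D. of_bool (a \<in> set I \<and> b \<in> set I))"
      by (cases p) (auto simp: algebra_simps)
  qed
  also have "\<dots> = (\<Sum>(a, b)\<in>D. q a b)"
    unfolding case_prod_beta avg_sum q_def ..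
  also have "\<dots> = (\<Sum>(a, b)\<in>D. q u v)"
    using inv by (intro sum.cong) (auto simp: D_def)
  also have "\<dots> = real N * (real N - 1) * q u v"
    using D assms by (simp add: of_nat_diff)
  finally show ?thesis
    using assms unfolding q_def[symmetric] by (simp add: field_simps)
qed

text \<open>
  The first step of a path from \<open>v\<close> to \<open>w\<close>, arranged so that the rest of the path avoids the edge
  used in that step: whenever the path returns to this edge, it can be entered there directly
  from \<open>v\<close>. The set of vertices \<open>w\<close> with this property is closed under adjacency, which is why no
  path has to be shortened explicitly.
\<close>

lemma conn_first_edge:
  assumes "(v, w) \<in> conn e A"
  shows "v = w \<or> (\<exists>k\<in>A. \<exists>u. u \<noteq> v \<and> v \<in> set (e k) \<and> u \<in> set (e k) \<and> (u, w) \<in> conn e (A - {k}))"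
  using assms unfolding conn_def
proof (induction rule: rtrancl_induct)
  case base
  then show ?case by simp
next
  case (step w w')
  from step.hyps(2) obtain j where j: "j \<in> A" "w \<in> set (e j)" "w' \<in> set (e j)"
    by (auto simp: adj_def)
  show ?case
  proof (cases "v = w'")
    case False
    from step.IH show ?thesis
    proof
      assume "v = w"
      then have "w' \<noteq> v \<and> v \<in> set (e j) \<and> w' \<in> set (e j) \<and> (w', w') \<in> (adj e (A - {j}))\<^sup>*"
        using j False by simp
      then show ?thesis
        using j(1) by blast
    next
      assume "\<exists>k\<in>A. \<exists>u. u \<noteq> v \<and> v \<in> set (e k) \<and> u \<in> set (e k) \<and> (u, w) \<in> (adj e (A - {k}))\<^sup>*"
      then obtain k u where k: "k \<in> A" "u \<noteq> v" "v \<in> set (e k)" "u \<in> set (e k)"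
        "(u, w) \<in> (adj e (A - {k}))\<^sup>*"
        by blast
      show ?thesis
      proof (cases "j = k")
        case True
        then have "w' \<noteq> v \<and> v \<in> set (e k) \<and> w' \<in> set (e k) \<and> (w', w') \<in> (adj e (A - {k}))\<^sup>*"
          using j k False by simp
        then show ?thesis
          using k(1) by blast
      next
        case jk: False
        then have "(w, w') \<in> adj e (A - {k})"
          using j by (auto simp: adj_def)
        then show ?thesis
          using k by (meson rtrancl.rtrancl_into_rtrancl)
      qed
    qed
  qed simp
qed

definition cluster_size :: "nat \<Rightarrow> (nat \<Rightarrow> nat list) \<Rightarrow> nat set \<Rightarrow> nat \<Rightarrow> real"
  where "cluster_size N e A v = (\<Sum>w\<in>{1..N}. of_bool ((v, w) \<in> conn e A))"

text \<open>
  A random hypergraph is dominated by a branching process of mean offspring \<open>\<tau>\<close>. By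
  \<open>conn_first_edge\<close>, the expected size \<open>c\<close> of a cluster satisfies \<open>c \<le> 1 + \<tau> c'\<close>, where
  \<open>c'\<close> bounds the expected cluster sizes after the removal of an edge, which is independent of
  the rest. So the fixed point \<open>1 / (1 - \<tau>)\<close> of \<open>c = 1 + \<tau> c\<close> is an upper bound.
\<close>

lemma avg_cluster_size_le:
  assumes "finite A" "2 \<le> N" "p \<le> N" "0 \<le> \<tau>" "\<tau> < 1"
    and "real (card A) * (real p * (real p - 1)) \<le> \<tau> * real N" "v \<in> {1..N}"
  shows "avg (A \<rightarrow>\<^sub>E edges p N) (\<lambda>e. cluster_size N e A v) \<le> 1 / (1 - \<tau>)"
  using assms(1,6,7)
proof (induction A arbitrary: v rule: finite_psubset_induct)
  case (psubset A)
  let ?V = "{1..N}" and ?S = "edges p N"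
  let ?C = "1 / (1 - \<tau>)" and ?q = "real p * (real p - 1) / (real N * (real N - 1))"
  have pp: "0 \<le> real p * (real p - 1)"
    by (cases p) auto
  then have q0: "0 \<le> ?q"
    by (rule divide_nonneg_nonneg) (use assms in simp)
  have finS: "finite (A \<rightarrow>\<^sub>E ?S)" "A \<rightarrow>\<^sub>E ?S \<noteq> {}"
    using psubset.hyps finite_edges edges_nonempty assms by (auto intro!: finite_PiE simp: PiE_eq_empty_iff)
  have step: "cluster_size N e A v
      \<le> 1 + (\<Sum>k\<in>A. \<Sum>u\<in>?V - {v}. of_bool (v \<in> set (e k) \<and> u \<in> set (e k)) * cluster_size N e (A - {k}) u)"
    if e: "e \<in> A \<rightarrow>\<^sub>E ?S" for e
  proof -
    have "cluster_size N e A v \<le> (\<Sum>w\<in>?V. of_bool (v = w) +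
        (\<Sum>k\<in>A. \<Sum>u\<in>?V - {v}. of_bool (v \<in> set (e k) \<and> u \<in> set (e k)) * of_bool ((u, w) \<in> conn e (A - {k}))))"
      (is "_ \<le> (\<Sum>w\<in>?V. of_bool (v = w) + ?g w)")
      unfolding cluster_size_def
    proof (rule sum_mono)
      fix w assume "w \<in> ?V"
      have g0: "0 \<le> ?g w"
        by (intro sum_nonneg) auto
      show "of_bool ((v, w) \<in> conn e A) \<le> of_bool (v = w) + ?g w"
      proof (cases "(v, w) \<in> conn e A \<and> v \<noteq> w")
        case True
        then obtain k u where k: "k \<in> A" "u \<noteq> v" "v \<in> set (e k)" "u \<in> set (e k)" "(u, w) \<in> conn e (A - {k})"
          using conn_first_edge by metis
        then have u: "u \<in> ?V - {v}"
          using edges_vertex[OF PiE_mem[OF e]] by auto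
        have "1 = of_bool (v \<in> set (e k) \<and> u \<in> set (e k)) * (of_bool ((u, w) \<in> conn e (A - {k})) :: real)"
          using k by simp
        also have "\<dots> \<le> (\<Sum>u\<in>?V - {v}. of_bool (v \<in> set (e k) \<and> u \<in> set (e k)) * of_bool ((u, w) \<in> conn e (A - {k})))"
          using u by (intro member_le_sum[where f = "\<lambda>u. of_bool (v \<in> set (e k) \<and> u \<in> set (e k)) * of_bool ((u, w) \<in> conn e (A - {k}))"]) auto
        also have "\<dots> \<le> ?g w"
          using k psubset.hyps
          by (intro member_le_sum[where f = "\<lambda>k. \<Sum>u\<in>?V - {v}. of_bool (v \<in> set (e k) \<and> u \<in> set (e k)) * of_bool ((u, w) \<in> conn e (A - {k}))"])
             (auto intro!: sum_nonneg)
        finally show ?thesis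
          using True by simp
      qed (use g0 in auto)
    qed
    also have "\<dots> = 1 + (\<Sum>w\<in>?V. ?g w)"
      using psubset.prems by (simp add: sum.distrib)
    also have "(\<Sum>w\<in>?V. ?g w) = (\<Sum>k\<in>A. \<Sum>u\<in>?V - {v}. of_bool (v \<in> set (e k) \<and> u \<in> set (e k)) * cluster_size N e (A - {k}) u)"
      unfolding cluster_size_def sum_distrib_left
      by (subst sum.swap, rule sum.cong[OF refl], subst sum.swap, rule refl)
    finally show ?thesis .
  qed
  have term_le: "avg (A \<rightarrow>\<^sub>E ?S) (\<lambda>e. of_bool (v \<in> set (e k) \<and> u \<in> set (e k)) * cluster_size N e (A - {k}) u) \<le> ?q * ?C"
    if k: "k \<in> A" and u: "u \<in> ?V - {v}" for k u
  proof -
    have Ak: "insert k (A - {k}) = A"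
      using k by auto
    have cs: "cluster_size N (E(k := s)) (A - {k}) u = cluster_size N E (A - {k}) u" for E s
    proof -
      have "conn (E(k := s)) (A - {k}) = conn E (A - {k})"
        by (rule conn_cong) auto
      then show ?thesis
        by (simp add: cluster_size_def)
    qed
    have "avg (insert k (A - {k}) \<rightarrow>\<^sub>E ?S) (\<lambda>e. of_bool (v \<in> set (e k) \<and> u \<in> set (e k)) * cluster_size N e (A - {k}) u)
       = avg ?S (\<lambda>s. of_bool (v \<in> set s \<and> u \<in> set s)) * avg (A - {k} \<rightarrow>\<^sub>E ?S) (\<lambda>E. cluster_size N E (A - {k}) u)"
      using psubset.hyps finite_edges by (subst avg_PiE_insert) (auto simp: cs avg_cmult avg_multc)
    also have "avg ?S (\<lambda>s. of_bool (v \<in> set s \<and> u \<in> set s)) = ?q"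
      using u psubset.prems assms by (intro avg_edges_pair) auto
    also have "?q * avg (A - {k} \<rightarrow>\<^sub>E ?S) (\<lambda>E. cluster_size N E (A - {k}) u) \<le> ?q * ?C"
    proof (intro mult_left_mono psubset.IH q0)
      show "A - {k} \<subset> A"
        using k by auto
      have "real (card (A - {k})) \<le> real (card A)"
        using psubset.hyps by (simp add: card_mono)
      then have "real (card (A - {k})) * (real p * (real p - 1)) \<le> real (card A) * (real p * (real p - 1))"
        using pp by (rule mult_right_mono)
      then show "real (card (A - {k})) * (real p * (real p - 1)) \<le> \<tau> * real N"
        using psubset.prems by linarith
      show "u \<in> ?V"
        using u by auto
    qed
    finally show ?thesis
      by (simp only: Ak)
  qed
  have "avg (A \<rightarrow>\<^sub>E ?S) (\<lambda>e. cluster_size N e A v)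
      \<le> avg (A \<rightarrow>\<^sub>E ?S) (\<lambda>e. 1 + (\<Sum>k\<in>A. \<Sum>u\<in>?V - {v}. of_bool (v \<in> set (e k) \<and> u \<in> set (e k)) * cluster_size N e (A - {k}) u))"
    by (rule avg_mono) (rule step)
  also have "\<dots> = 1 + (\<Sum>k\<in>A. \<Sum>u\<in>?V - {v}. avg (A \<rightarrow>\<^sub>E ?S) (\<lambda>e. of_bool (v \<in> set (e k) \<and> u \<in> set (e k)) * cluster_size N e (A - {k}) u))"
    by (simp only: avg_add avg_sum avg_const[OF finS])
  also have "\<dots> \<le> 1 + (\<Sum>k\<in>A. \<Sum>u\<in>?V - {v}. ?q * ?C)"
    by (intro add_left_mono sum_mono term_le) auto
  also have "\<dots> = 1 + (real (card A) * (real p * (real p - 1))) / real N * ?C"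
  proof -
    have "real (card (?V - {v})) = real N - 1"
      using psubset.prems assms by (simp add: of_nat_diff)
    moreover have "(real N - 1) * ?q = real p * (real p - 1) / real N"
      using assms by (simp add: divide_simps)
    ultimately have "real (card (?V - {v})) * (?q * ?C) = real p * (real p - 1) / real N * ?C"
      by (metis mult.assoc)
    then show ?thesis
      by simp
  qed
  also have "\<dots> \<le> 1 + \<tau> * ?C"
    using psubset.prems assms by (intro add_left_mono mult_right_mono) (auto simp: field_simps)
  also have "\<dots> = ?C"
    using assms by (simp add: field_simps)
  finally show ?case .
qed

text \<open>
  The minimal number of edges whose deletion leaves a hyperforest. Unlike the number of edges that
  close a cycle when they are added, it obviously changes by at most one when one edge is
  changed.
\<close>

definition defect :: "('k :: linorder \<Rightarrow> 'v list) \<Rightarrow> 'k set \<Rightarrow> nat"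
  where "defect e A = (LEAST d. \<exists>B\<subseteq>A. card B = d \<and> hyperforest e (A - B))"

lemma defect_le: "B \<subseteq> A \<Longrightarrow> hyperforest e (A - B) \<Longrightarrow> defect e A \<le> card B"
  unfolding defect_def by (rule Least_le) auto

lemma defect_witness: "\<exists>B\<subseteq>A. card B = defect e A \<and> hyperforest e (A - B)"
  unfolding defect_def
  by (rule LeastI[where k = "card A"]) (auto simp: hyperforest_def intro!: exI[of _ A])

lemma defect_cong:
  assumes "\<And>k. k \<in> A \<Longrightarrow> e k = e' k"
  shows "defect e A = defect e' A"
proof -
  have "hyperforest e (A - B) \<longleftrightarrow> hyperforest e' (A - B)" for B
    using assms by (intro hyperforest_cong) auto
  then show ?thesis
    by (simp add: defect_def)
qed

text \<open>
  An edge that has been changed can be deleted.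
\<close>

lemma defect_update_le:
  assumes "finite A" "k \<in> A"
  shows "defect e A \<le> defect (e(k := s)) A + 1"
proof -
  obtain B where B: "B \<subseteq> A" "card B = defect (e(k := s)) A" "hyperforest (e(k := s)) (A - B)"
    using defect_witness by metis
  have "hyperforest (e(k := s)) (A - insert k B)"
    using B(3) by (rule hyperforest_subset) auto
  then have "hyperforest e (A - insert k B)"
    by (subst hyperforest_cong[where e' = "e(k := s)"]) auto
  then have "defect e A \<le> card (insert k B)"
    using B assms by (intro defect_le) auto
  also have "\<dots> \<le> card B + 1"
    by (simp add: card_insert_le_m1 card_insert_if B(1) finite_subset[OF _ assms(1)])
  finally show ?thesis
    using B by simp
qed

text \<open>
  It suffices to delete every edge that contains two vertices connected by the other edges. For a
  given edge and a given pair, the edge is independent of the connection, so that the expected number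
  of such edges is controlled by the expected cluster size; it stays bounded as \<open>N\<close> grows.
\<close>

lemma avg_defect_le:
  fixes A :: "nat set"
  assumes "finite A" "2 \<le> N" "p \<le> N" "0 \<le> \<tau>" "\<tau> < 1"
    and card: "real (card A) * (real p * (real p - 1)) \<le> \<tau> * real N"
  shows "avg (A \<rightarrow>\<^sub>E edges p N) (\<lambda>e. real (defect e A)) \<le> 2 / (1 - \<tau>)"
proof -
  let ?V = "{1..N}" and ?S = "edges p N"
  let ?C = "1 / (1 - \<tau>)" and ?q = "real p * (real p - 1) / (real N * (real N - 1))"
  let ?t = "\<lambda>e k a b. of_bool (a \<in> set (e k) \<and> b \<in> set (e k)) * of_bool ((a, b) \<in> conn e (A - {k})) :: real"
  have pp: "0 \<le> real p * (real p - 1)"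
    by (cases p) auto
  then have q0: "0 \<le> ?q"
    by (rule divide_nonneg_nonneg) (use assms in simp)
  have le: "real (defect e A) \<le> (\<Sum>k\<in>A. \<Sum>a\<in>?V. \<Sum>b\<in>?V - {a}. ?t e k a b)" if e: "e \<in> A \<rightarrow>\<^sub>E ?S" for e
  proof -
    define bad where "bad k \<longleftrightarrow> (\<exists>a\<in>set (e k). \<exists>b\<in>set (e k). a \<noteq> b \<and> (a, b) \<in> conn e (A - {k}))" for k
    have hf: "hyperforest e (A - {k\<in>A. bad k})"
      unfolding hyperforest_def
    proof (intro ballI impI notI)
      fix k a b assume *: "k \<in> A - {k \<in> A. bad k}" "a \<in> set (e k)" "b \<in> set (e k)" "a \<noteq> b"
        "(a, b) \<in> conn e {j \<in> A - {k \<in> A. bad k}. j < k}"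
      have "conn e {j \<in> A - {k \<in> A. bad k}. j < k} \<subseteq> conn e (A - {k})"
        by (rule conn_mono) auto
      then show False
        using * unfolding bad_def by blast
    qed
    have "real (defect e A) \<le> real (card {k\<in>A. bad k})"
      using hf by (intro of_nat_mono defect_le) auto
    also have "\<dots> = (\<Sum>k\<in>A. of_bool (bad k))"
      using assms(1) by (simp add: Int_def)
    also have "\<dots> \<le> (\<Sum>k\<in>A. \<Sum>a\<in>?V. \<Sum>b\<in>?V - {a}. ?t e k a b)"
    proof (rule sum_mono)
      fix k assume k: "k \<in> A"
      have n0: "0 \<le> (\<Sum>a\<in>?V. \<Sum>b\<in>?V - {a}. ?t e k a b)"
        by (intro sum_nonneg) auto
      show "of_bool (bad k) \<le> (\<Sum>a\<in>?V. \<Sum>b\<in>?V - {a}. ?t e k a b)"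
      proof (cases "bad k")
        case True
        then obtain a b where ab: "a \<in> set (e k)" "b \<in> set (e k)" "a \<noteq> b" "(a, b) \<in> conn e (A - {k})"
          unfolding bad_def by blast
        then have V: "a \<in> ?V" "b \<in> ?V - {a}"
          using e k edges_vertex[OF PiE_mem[OF e]] by auto
        have "1 = ?t e k a b"
          using ab by simp
        also have "\<dots> \<le> (\<Sum>b\<in>?V - {a}. ?t e k a b)"
          using V by (intro member_le_sum[where f = "\<lambda>b. ?t e k a b"]) auto
        also have "\<dots> \<le> (\<Sum>a\<in>?V. \<Sum>b\<in>?V - {a}. ?t e k a b)"
          using V by (intro member_le_sum[where f = "\<lambda>a. \<Sum>b\<in>?V - {a}. ?t e k a b"]) (auto intro!: sum_nonneg)
        finally show ?thesis
          using True by simp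
      qed (use n0 in auto)
    qed
    finally show ?thesis .
  qed
  have term_eq: "avg (A \<rightarrow>\<^sub>E ?S) (\<lambda>e. ?t e k a b) = ?q * avg (A - {k} \<rightarrow>\<^sub>E ?S) (\<lambda>E. of_bool ((a, b) \<in> conn E (A - {k})))"
    if k: "k \<in> A" and ab: "a \<in> ?V" "b \<in> ?V - {a}" for k a b
  proof -
    have Ak: "insert k (A - {k}) = A"
      using k by auto
    have cs: "conn (E(k := s)) (A - {k}) = conn E (A - {k})" for E s
      by (rule conn_cong) auto
    have "avg (insert k (A - {k}) \<rightarrow>\<^sub>E ?S) (\<lambda>e. ?t e k a b)
       = avg ?S (\<lambda>s. of_bool (a \<in> set s \<and> b \<in> set s)) * avg (A - {k} \<rightarrow>\<^sub>E ?S) (\<lambda>E. of_bool ((a, b) \<in> conn E (A - {k})))"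
      using assms(1) finite_edges by (subst avg_PiE_insert) (auto simp: cs avg_cmult avg_multc)
    also have "avg ?S (\<lambda>s. of_bool (a \<in> set s \<and> b \<in> set s)) = ?q"
      using ab assms by (intro avg_edges_pair) auto
    finally show ?thesis
      by (simp only: Ak)
  qed
  have inner: "(\<Sum>b\<in>?V - {a}. avg (A \<rightarrow>\<^sub>E ?S) (\<lambda>e. ?t e k a b)) \<le> ?q * ?C" if k: "k \<in> A" and a: "a \<in> ?V" for k a
  proof -
    have "(\<Sum>b\<in>?V - {a}. avg (A \<rightarrow>\<^sub>E ?S) (\<lambda>e. ?t e k a b))
        = ?q * avg (A - {k} \<rightarrow>\<^sub>E ?S) (\<lambda>E. \<Sum>b\<in>?V - {a}. of_bool ((a, b) \<in> conn E (A - {k})))"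
      unfolding avg_sum sum_distrib_left using term_eq[OF k a] by (intro sum.cong) auto
    also have "\<dots> \<le> ?q * avg (A - {k} \<rightarrow>\<^sub>E ?S) (\<lambda>E. cluster_size N E (A - {k}) a)"
      unfolding cluster_size_def by (intro mult_left_mono q0 avg_mono sum_mono2) auto
    also have "\<dots> \<le> ?q * ?C"
    proof (intro mult_left_mono q0 avg_cluster_size_le)
      have "real (card (A - {k})) \<le> real (card A)"
        using assms(1) by (simp add: card_mono)
      then have "real (card (A - {k})) * (real p * (real p - 1)) \<le> real (card A) * (real p * (real p - 1))"
        using pp by (rule mult_right_mono)
      then show "real (card (A - {k})) * (real p * (real p - 1)) \<le> \<tau> * real N"
        using card by linarith
    qed (use assms a in auto)
    finally show ?thesis .
  qed
  have "avg (A \<rightarrow>\<^sub>E ?S) (\<lambda>e. real (defect e A)) \<le> avg (A \<rightarrow>\<^sub>E ?S) (\<lambda>e. \<Sum>k\<in>A. \<Sum>a\<in>?V. \<Sum>b\<in>?V - {a}. ?t e k a b)"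
    by (rule avg_mono) (rule le)
  also have "\<dots> = (\<Sum>k\<in>A. \<Sum>a\<in>?V. \<Sum>b\<in>?V - {a}. avg (A \<rightarrow>\<^sub>E ?S) (\<lambda>e. ?t e k a b))"
    by (simp only: avg_sum)
  also have "\<dots> \<le> (\<Sum>k\<in>A. \<Sum>a\<in>?V. ?q * ?C)"
    by (intro sum_mono inner)
  also have "\<dots> = (real (card A) * (real p * (real p - 1))) / (real N - 1) * ?C"
  proof -
    have "real N * ?q = real p * (real p - 1) / (real N - 1)"
      using assms by (simp add: divide_simps)
    then have "real N * (?q * ?C) = real p * (real p - 1) / (real N - 1) * ?C"
      by (metis mult.assoc)
    then show ?thesis
      by simp
  qed
  also have "\<dots> \<le> real N / (real N - 1) * ?C"
  proof (intro mult_right_mono divide_right_mono)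
    have "\<tau> * real N \<le> 1 * real N"
      using assms by (intro mult_right_mono) auto
    then show "real (card A) * (real p * (real p - 1)) \<le> real N"
      using card by linarith
  qed (use assms in auto)
  also have "\<dots> \<le> 2 * ?C"
    using assms by (intro mult_right_mono) (auto simp: field_simps)
  finally show ?thesis by simp
qed

text \<open>
  Chernoff's bound for the defect, with parameter \<open>\<delta> / 2\<close>: the mean contributes at most
  \<open>\<delta>\<^sup>2 N / 4\<close> and the bounded differences at most \<open>\<delta>\<^sup>2 N / 8\<close> to the exponent, against a gain of
  \<open>\<delta>\<^sup>2 N / 2\<close>.
\<close>

theorem avg_defect_tail:
  fixes A :: "nat set"
  assumes "finite A" "2 \<le> N" "p \<le> N" "0 \<le> \<tau>" "\<tau> < 1" "card A \<le> N" "0 < \<delta>"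
    and card: "real (card A) * (real p * (real p - 1)) \<le> \<tau> * real N"
    and N: "2 / (1 - \<tau>) \<le> \<delta> / 2 * real N"
  shows "avg (A \<rightarrow>\<^sub>E edges p N) (\<lambda>e. of_bool (\<delta> * real N \<le> real (defect e A))) \<le> exp (- (\<delta>\<^sup>2 / 8) * real N)"
proof -
  let ?S = "edges p N" and ?l = "\<delta> / 2"
  let ?f = "\<lambda>e. real (defect e A)"
  have "avg (A \<rightarrow>\<^sub>E ?S) (\<lambda>e. of_bool (\<delta> * real N \<le> ?f e)) \<le> avg (A \<rightarrow>\<^sub>E ?S) (\<lambda>e. exp (- ?l * (\<delta> * real N)) * exp (?l * ?f e))"
  proof (rule avg_mono)
    fix e
    have "1 \<le> exp (?l * (?f e - \<delta> * real N))" if "\<delta> * real N \<le> ?f e"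
      using that assms(7) by simp
    then show "of_bool (\<delta> * real N \<le> ?f e) \<le> exp (- ?l * (\<delta> * real N)) * exp (?l * ?f e)"
      by (auto simp: exp_add[symmetric] algebra_simps)
  qed
  also have "\<dots> = exp (- ?l * (\<delta> * real N)) * avg (A \<rightarrow>\<^sub>E ?S) (\<lambda>e. exp (?l * ?f e))"
    by (rule avg_cmult)
  also have "\<dots> \<le> exp (- ?l * (\<delta> * real N)) * exp (?l * avg (A \<rightarrow>\<^sub>E ?S) ?f + real (card A) * (?l\<^sup>2 / 2))"
  proof (intro mult_left_mono avg_exp_bounded_differences)
    fix e k s assume "k \<in> A"
    then show "\<bar>?f (e(k := s)) - ?f e\<bar> \<le> 1"
      using defect_update_le[OF assms(1), of k e s] defect_update_le[OF assms(1), of k "e(k := s)" "e k"]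
      by (simp add: abs_le_iff)
  qed (use assms finite_edges edges_nonempty in auto)
  also have "\<dots> \<le> exp (- ?l * (\<delta> * real N)) * exp (?l * (\<delta> / 2 * real N) + real N * (?l\<^sup>2 / 2))"
  proof -
    have "avg (A \<rightarrow>\<^sub>E ?S) ?f \<le> \<delta> / 2 * real N"
      using avg_defect_le[OF assms(1-5) card] N by linarith
    then have "?l * avg (A \<rightarrow>\<^sub>E ?S) ?f \<le> ?l * (\<delta> / 2 * real N)"
      using assms(7) by (intro mult_left_mono) auto
    moreover have "real (card A) * (?l\<^sup>2 / 2) \<le> real N * (?l\<^sup>2 / 2)"
      using assms(6) by (intro mult_right_mono) auto
    ultimately show ?thesis
      by (intro mult_left_mono) auto
  qed
  also have "\<dots> = exp (- (\<delta>\<^sup>2 / 8) * real N)"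
    by (simp add: exp_add[symmetric] power2_eq_square field_simps)
  finally show ?thesis .
qed

section \<open>Counting assignments on a hyperforest\<close>

definition num_sat :: "'k set \<Rightarrow> ('k \<Rightarrow> 'v list) \<Rightarrow> ('k \<Rightarrow> spin list \<Rightarrow> real) \<Rightarrow> ('v \<Rightarrow> spin) \<Rightarrow> real"
  where "num_sat A e \<theta> \<sigma> = (\<Sum>k\<in>A. of_bool (\<theta> k (map \<sigma> (e k)) = 0))"

text \<open>
  Under the uniform measure, the constraints of a hyperforest are satisfied independently with
  probability \<open>\<rho>\<close>. This is the density of the measure under which that probability becomes \<open>t\<close>,
  so that the atypical fraction \<open>t\<close> of satisfied constraints becomes typical.
\<close>

definition tilt ::
  "'k set \<Rightarrow> ('k \<Rightarrow> 'v list) \<Rightarrow> ('k \<Rightarrow> spin list \<Rightarrow> real) \<Rightarrow> real \<Rightarrow> real \<Rightarrow> ('v \<Rightarrow> spin) \<Rightarrow> real"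
  where "tilt A e \<theta> \<rho> t \<sigma> =
    (\<Prod>k\<in>A. if \<theta> k (map \<sigma> (e k)) = 0 then t / \<rho> else (1 - t) / (1 - \<rho>))"

text \<open>
  Minus the relative entropy of a Bernoulli variable of parameter \<open>t\<close> with respect to one of
  parameter \<open>\<rho>\<close>.
\<close>

definition rate :: "real \<Rightarrow> real \<Rightarrow> real"
  where "rate \<rho> t = t * ln (\<rho> / t) + (1 - t) * ln ((1 - \<rho>) / (1 - t))"

text \<open>
  The amount by which the logarithm of the tilting density changes when one constraint changes between
  satisfied and violated.
\<close>

definition slope :: "real \<Rightarrow> real \<Rightarrow> real"
  where "slope \<rho> t = \<bar>ln (t / \<rho>) - ln ((1 - t) / (1 - \<rho>))\<bar>"

context
  fixes V :: "nat set" and A :: "nat set" and e :: "nat \<Rightarrow> nat list" and p :: nat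
    and \<theta> :: "nat \<Rightarrow> spin list \<Rightarrow> real" and \<rho> :: real
  assumes V: "finite V" and A: "finite A" and hf: "hyperforest e A"
    and e: "\<And>k. k \<in> A \<Longrightarrow> distinct (e k) \<and> length (e k) = p \<and> set (e k) \<subseteq> V"
    and sym: "\<And>k. k \<in> A \<Longrightarrow> symmetric_fun p (\<theta> k)"
    and \<rho>: "\<And>k. k \<in> A \<Longrightarrow> avg (cube p) (\<lambda>x. of_bool (\<theta> k x = 0)) = \<rho>"
begin

lemma avg_prod_satisfied:
  "avg (V \<rightarrow>\<^sub>E UNIV) (\<lambda>\<sigma>. \<Prod>k\<in>A. if \<theta> k (map \<sigma> (e k)) = 0 then c k else d k)
    = (\<Prod>k\<in>A. \<rho> * c k + (1 - \<rho>) * d k)"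
proof -
  have "avg (V \<rightarrow>\<^sub>E UNIV) (\<lambda>\<sigma>. \<Prod>k\<in>A. (\<lambda>x. if \<theta> k x = 0 then c k else d k) (map \<sigma> (e k)))
      = (\<Prod>k\<in>A. avg (cube p) (\<lambda>x. if \<theta> k x = 0 then c k else d k))"
    by (rule avg_prod_hyperforest[OF V A hf e, where w = "\<lambda>k x. if \<theta> k x = 0 then c k else d k"])
       (use sym in \<open>auto simp: symmetric_fun_def\<close>)
  also have "\<dots> = (\<Prod>k\<in>A. \<rho> * c k + (1 - \<rho>) * d k)"
  proof (rule prod.cong[OF refl])
    fix k assume k: "k \<in> A"
    have "avg (cube p) (\<lambda>x. if \<theta> k x = 0 then c k else d k)
        = avg (cube p) (\<lambda>x. d k + of_bool (\<theta> k x = 0) * (c k - d k))"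
      by (rule avg_cong) auto
    also have "\<dots> = \<rho> * c k + (1 - \<rho>) * d k"
      using \<rho>[OF k] unfolding avg_add avg_multc avg_const[OF finite_cube cube_nonempty]
      by (simp add: algebra_simps)
    finally show "avg (cube p) (\<lambda>x. if \<theta> k x = 0 then c k else d k) = \<rho> * c k + (1 - \<rho>) * d k" .
  qed
  finally show ?thesis by simp
qed

context
  fixes t :: real
  assumes t: "0 < t" "t < 1" and \<rho>01: "0 < \<rho>" "\<rho> < 1"
begin

lemma tilt_pos: "0 < tilt A e \<theta> \<rho> t \<sigma>"
  unfolding tilt_def using t \<rho>01 by (intro prod_pos) auto

lemma avg_tilt: "avg (V \<rightarrow>\<^sub>E UNIV) (tilt A e \<theta> \<rho> t) = 1"
  unfolding tilt_def using t \<rho>01 by (subst avg_prod_satisfied) simp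

text \<open>
  Under the tilted measure the number of satisfied constraints is a sum of independent Bernoulli
  variables of parameter \<open>t\<close>. The covariances are again averages of products of one weight per edge,
  and an edge carrying a single centred factor makes the product vanish.
\<close>

lemma avg_tilt_variance:
  "avg (V \<rightarrow>\<^sub>E UNIV) (\<lambda>\<sigma>. tilt A e \<theta> \<rho> t \<sigma> * (num_sat A e \<theta> \<sigma> - real (card A) * t)\<^sup>2) = real (card A) * (t * (1 - t))"
proof -
  let ?s = "\<lambda>k \<sigma>. \<theta> k (map \<sigma> (e k)) = 0"
  have cov: "avg (V \<rightarrow>\<^sub>E UNIV) (\<lambda>\<sigma>. tilt A e \<theta> \<rho> t \<sigma> * ((of_bool (?s k \<sigma>) - t) * (of_bool (?s l \<sigma>) - t)))
      = (if k = l then t * (1 - t) else 0)" if k: "k \<in> A" and l: "l \<in> A" for k l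
  proof -
    let ?c = "\<lambda>j. t / \<rho> * ((if j = k then 1 - t else 1) * (if j = l then 1 - t else 1))"
    let ?d = "\<lambda>j. (1 - t) / (1 - \<rho>) * ((if j = k then - t else 1) * (if j = l then - t else 1))"
    have "tilt A e \<theta> \<rho> t \<sigma> * ((of_bool (?s k \<sigma>) - t) * (of_bool (?s l \<sigma>) - t))
        = (\<Prod>j\<in>A. if ?s j \<sigma> then ?c j else ?d j)" for \<sigma>
    proof -
      have "(\<Prod>j\<in>A. if ?s j \<sigma> then ?c j else ?d j)
          = (\<Prod>j\<in>A. (if ?s j \<sigma> then t / \<rho> else (1 - t) / (1 - \<rho>))
              * ((if j = k then of_bool (?s k \<sigma>) - t else 1) * (if j = l then of_bool (?s l \<sigma>) - t else 1)))"
        by (rule prod.cong) auto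
      also have "\<dots> = tilt A e \<theta> \<rho> t \<sigma> * ((\<Prod>j\<in>A. if j = k then of_bool (?s k \<sigma>) - t else 1)
              * (\<Prod>j\<in>A. if j = l then of_bool (?s l \<sigma>) - t else 1))"
        unfolding prod.distrib tilt_def ..
      also have "\<dots> = tilt A e \<theta> \<rho> t \<sigma> * ((of_bool (?s k \<sigma>) - t) * (of_bool (?s l \<sigma>) - t))"
        using k l A by (simp add: prod.delta)
      finally show ?thesis by simp
    qed
    then have "avg (V \<rightarrow>\<^sub>E UNIV) (\<lambda>\<sigma>. tilt A e \<theta> \<rho> t \<sigma> * ((of_bool (?s k \<sigma>) - t) * (of_bool (?s l \<sigma>) - t)))
        = (\<Prod>j\<in>A. \<rho> * ?c j + (1 - \<rho>) * ?d j)"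
      by (simp only: avg_prod_satisfied)
    also have "\<dots> = (\<Prod>j\<in>A. if j = k then (if k = l then t * (1 - t) else 0) else if j = l then 0 else 1)"
    proof (rule prod.cong[OF refl])
      have "\<rho> * (t / \<rho> * c) = t * c" "(1 - \<rho>) * ((1 - t) / (1 - \<rho>) * c) = (1 - t) * c" for c
        using \<rho>01 by auto
      then show "\<rho> * ?c j + (1 - \<rho>) * ?d j =
          (if j = k then (if k = l then t * (1 - t) else 0) else if j = l then 0 else 1)" for j
        by (simp only:) (auto simp: algebra_simps)
    qed
    also have "\<dots> = (if k = l then t * (1 - t) else 0)"
    proof (cases "k = l")
      case True
      then have "(\<Prod>j\<in>A. if j = k then (if k = l then t * (1 - t) else 0) else if j = l then 0 else 1)
          = (\<Prod>j\<in>A. if j = k then t * (1 - t) else 1)"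
        by (intro prod.cong) auto
      then show ?thesis
        using True k A by (simp add: prod.delta)
    next
      case False
      then show ?thesis
        using k A by (intro trans[OF prod_zero]) auto
    qed
    finally show ?thesis .
  qed
  have sq: "(num_sat A e \<theta> \<sigma> - real (card A) * t)\<^sup>2 = (\<Sum>k\<in>A. \<Sum>l\<in>A. (of_bool (?s k \<sigma>) - t) * (of_bool (?s l \<sigma>) - t))" for \<sigma>
  proof -
    have "num_sat A e \<theta> \<sigma> - real (card A) * t = (\<Sum>k\<in>A. of_bool (?s k \<sigma>) - t)"
      by (simp add: num_sat_def sum_subtractf)
    then show ?thesis
      by (simp only: power2_eq_square sum_product)
  qed
  have "avg (V \<rightarrow>\<^sub>E UNIV) (\<lambda>\<sigma>. tilt A e \<theta> \<rho> t \<sigma> * (num_sat A e \<theta> \<sigma> - real (card A) * t)\<^sup>2)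
      = (\<Sum>k\<in>A. \<Sum>l\<in>A. avg (V \<rightarrow>\<^sub>E UNIV) (\<lambda>\<sigma>. tilt A e \<theta> \<rho> t \<sigma> * ((of_bool (?s k \<sigma>) - t) * (of_bool (?s l \<sigma>) - t))))"
    unfolding sq sum_distrib_left avg_sum ..
  also have "\<dots> = (\<Sum>k\<in>A. \<Sum>l\<in>A. if k = l then t * (1 - t) else 0)"
    by (intro sum.cong refl cov)
  also have "\<dots> = real (card A) * (t * (1 - t))"
    using A by (simp add: sum.delta)
  finally show ?thesis .
qed

lemma tilt_bounds:
  assumes "\<bar>num_sat A e \<theta> \<sigma> - real (card A) * t\<bar> \<le> \<zeta>"
  shows "tilt A e \<theta> \<rho> t \<sigma> \<le> exp (- real (card A) * rate \<rho> t + \<zeta> * slope \<rho> t)"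
    and "exp (- real (card A) * rate \<rho> t - \<zeta> * slope \<rho> t) \<le> tilt A e \<theta> \<rho> t \<sigma>"
proof -
  let ?m = "real (card A)" and ?a = "ln (t / \<rho>)" and ?b = "ln ((1 - t) / (1 - \<rho>))"
  let ?s = "\<lambda>k \<sigma>. \<theta> k (map \<sigma> (e k)) = 0"
  have r: "rate \<rho> t = - (t * ?a + (1 - t) * ?b)"
    using t \<rho>01 by (simp add: rate_def ln_div algebra_simps)
  have "ln (tilt A e \<theta> \<rho> t \<sigma>) = (\<Sum>k\<in>A. ln (if ?s k \<sigma> then t / \<rho> else (1 - t) / (1 - \<rho>)))"
    unfolding tilt_def by (rule ln_prod) (use A t \<rho>01 in auto)
  also have "\<dots> = (\<Sum>k\<in>A. ?b + of_bool (?s k \<sigma>) * (?a - ?b))"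
    by (rule sum.cong) auto
  also have "\<dots> = ?m * ?b + num_sat A e \<theta> \<sigma> * (?a - ?b)"
    by (simp add: sum.distrib num_sat_def sum_distrib_right)
  also have "\<dots> = - ?m * rate \<rho> t + (num_sat A e \<theta> \<sigma> - ?m * t) * (?a - ?b)"
    unfolding r by (simp add: algebra_simps)
  finally have ln: "ln (tilt A e \<theta> \<rho> t \<sigma>) = - ?m * rate \<rho> t + (num_sat A e \<theta> \<sigma> - ?m * t) * (?a - ?b)" .
  have "\<bar>(num_sat A e \<theta> \<sigma> - ?m * t) * (?a - ?b)\<bar> \<le> \<zeta> * slope \<rho> t"
    unfolding abs_mult slope_def using assms by (intro mult_right_mono) auto
  then have "ln (tilt A e \<theta> \<rho> t \<sigma>) \<le> - ?m * rate \<rho> t + \<zeta> * slope \<rho> t" "- ?m * rate \<rho> t - \<zeta> * slope \<rho> t \<le> ln (tilt A e \<theta> \<rho> t \<sigma>)"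
    unfolding ln by linarith+
  moreover have "tilt A e \<theta> \<rho> t \<sigma> = exp (ln (tilt A e \<theta> \<rho> t \<sigma>))"
    using tilt_pos by simp
  ultimately show "tilt A e \<theta> \<rho> t \<sigma> \<le> exp (- real (card A) * rate \<rho> t + \<zeta> * slope \<rho> t)"
    "exp (- real (card A) * rate \<rho> t - \<zeta> * slope \<rho> t) \<le> tilt A e \<theta> \<rho> t \<sigma>"
    by (metis exp_le_cancel_iff)+
qed

text \<open>
  On the window the tilted density is at least \<open>exp (- m rate - \<zeta> slope)\<close>, where \<open>m\<close> is the number of
  edges, and its mean is 1.
\<close>

lemma window_upper:
  "avg (V \<rightarrow>\<^sub>E UNIV) (\<lambda>\<sigma>. of_bool (\<bar>num_sat A e \<theta> \<sigma> - real (card A) * t\<bar> \<le> \<zeta>)) \<le> exp (real (card A) * rate \<rho> t + \<zeta> * slope \<rho> t)"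
proof -
  have "avg (V \<rightarrow>\<^sub>E UNIV) (\<lambda>\<sigma>. of_bool (\<bar>num_sat A e \<theta> \<sigma> - real (card A) * t\<bar> \<le> \<zeta>))
      \<le> avg (V \<rightarrow>\<^sub>E UNIV) (\<lambda>\<sigma>. exp (real (card A) * rate \<rho> t + \<zeta> * slope \<rho> t) * tilt A e \<theta> \<rho> t \<sigma>)"
  proof (rule avg_mono)
    fix \<sigma>
    show "of_bool (\<bar>num_sat A e \<theta> \<sigma> - real (card A) * t\<bar> \<le> \<zeta>) \<le> exp (real (card A) * rate \<rho> t + \<zeta> * slope \<rho> t) * tilt A e \<theta> \<rho> t \<sigma>"
    proof (cases "\<bar>num_sat A e \<theta> \<sigma> - real (card A) * t\<bar> \<le> \<zeta>")
      case True
      have "1 = exp (real (card A) * rate \<rho> t + \<zeta> * slope \<rho> t) * exp (- real (card A) * rate \<rho> t - \<zeta> * slope \<rho> t)"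
        by (simp flip: exp_add)
      also have "\<dots> \<le> exp (real (card A) * rate \<rho> t + \<zeta> * slope \<rho> t) * tilt A e \<theta> \<rho> t \<sigma>"
        using tilt_bounds(2)[OF True] by (intro mult_left_mono) auto
      finally show ?thesis
        using True by simp
    qed (use tilt_pos[of \<sigma>] in simp)
  qed
  then show ?thesis
    by (simp add: avg_cmult avg_tilt)
qed

text \<open>
  By Chebyshev's inequality the window carries at least half of the tilted measure, and the density
  is at most \<open>exp (- m rate + \<zeta> slope)\<close> there.
\<close>

lemma window_lower:
  assumes "0 < \<zeta>" "real (card A) \<le> 2 * \<zeta>\<^sup>2"
  shows "exp (real (card A) * rate \<rho> t - \<zeta> * slope \<rho> t) / 2 \<le> avg (V \<rightarrow>\<^sub>E UNIV) (\<lambda>\<sigma>. of_bool (\<bar>num_sat A e \<theta> \<sigma> - real (card A) * t\<bar> \<le> \<zeta>))"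
proof -
  let ?X = "\<lambda>\<sigma>. num_sat A e \<theta> \<sigma> - real (card A) * t"
  have "t * (1 - t) \<le> 1 / 4"
    using zero_le_power2[of "t - 1 / 2"] by (simp add: power2_eq_square algebra_simps)
  then have "real (card A) * (t * (1 - t)) \<le> 2 * \<zeta>\<^sup>2 * (1 / 4)"
    using assms t by (intro mult_mono) auto
  then have half: "1 / 2 \<le> 1 - real (card A) * (t * (1 - t)) / \<zeta>\<^sup>2"
    using assms(1) by (simp add: field_simps)
  also have "\<dots> = avg (V \<rightarrow>\<^sub>E UNIV) (\<lambda>\<sigma>. tilt A e \<theta> \<rho> t \<sigma> - tilt A e \<theta> \<rho> t \<sigma> * (?X \<sigma>)\<^sup>2 * (1 / \<zeta>\<^sup>2))"
    unfolding avg_diff avg_multc avg_tilt avg_tilt_variance by simp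
  also have "\<dots> \<le> avg (V \<rightarrow>\<^sub>E UNIV) (\<lambda>\<sigma>. exp (- real (card A) * rate \<rho> t + \<zeta> * slope \<rho> t) * of_bool (\<bar>?X \<sigma>\<bar> \<le> \<zeta>))"
  proof (rule avg_mono)
    fix \<sigma>
    have nn: "0 \<le> tilt A e \<theta> \<rho> t \<sigma> * (?X \<sigma>)\<^sup>2 * (1 / \<zeta>\<^sup>2)"
      using tilt_pos[of \<sigma>] by (intro mult_nonneg_nonneg) auto
    show "tilt A e \<theta> \<rho> t \<sigma> - tilt A e \<theta> \<rho> t \<sigma> * (?X \<sigma>)\<^sup>2 * (1 / \<zeta>\<^sup>2) \<le> exp (- real (card A) * rate \<rho> t + \<zeta> * slope \<rho> t) * of_bool (\<bar>?X \<sigma>\<bar> \<le> \<zeta>)"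
    proof (cases "\<bar>?X \<sigma>\<bar> \<le> \<zeta>")
      case True
      then show ?thesis
        using tilt_bounds(1)[OF True] nn by simp
    next
      case False
      then have "\<zeta>\<^sup>2 \<le> (?X \<sigma>)\<^sup>2"
        using assms(1) power_mono[of \<zeta> "\<bar>?X \<sigma>\<bar>" 2] by simp
      then have "1 \<le> (?X \<sigma>)\<^sup>2 * (1 / \<zeta>\<^sup>2)"
        using assms(1) by (simp add: field_simps)
      then have "tilt A e \<theta> \<rho> t \<sigma> * 1 \<le> tilt A e \<theta> \<rho> t \<sigma> * ((?X \<sigma>)\<^sup>2 * (1 / \<zeta>\<^sup>2))"
        using tilt_pos[of \<sigma>] by (intro mult_left_mono) auto
      then show ?thesis
        using False by (simp add: mult.assoc)
    qed
  qed
  also have "\<dots> = exp (- real (card A) * rate \<rho> t + \<zeta> * slope \<rho> t) * avg (V \<rightarrow>\<^sub>E UNIV) (\<lambda>\<sigma>. of_bool (\<bar>?X \<sigma>\<bar> \<le> \<zeta>))"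
    by (rule avg_cmult)
  finally have "exp (real (card A) * rate \<rho> t - \<zeta> * slope \<rho> t) * (1 / 2)
      \<le> exp (real (card A) * rate \<rho> t - \<zeta> * slope \<rho> t) * (exp (- real (card A) * rate \<rho> t + \<zeta> * slope \<rho> t) * avg (V \<rightarrow>\<^sub>E UNIV) (\<lambda>\<sigma>. of_bool (\<bar>?X \<sigma>\<bar> \<le> \<zeta>)))"
    by (intro mult_left_mono) auto
  also have "\<dots> = avg (V \<rightarrow>\<^sub>E UNIV) (\<lambda>\<sigma>. of_bool (\<bar>?X \<sigma>\<bar> \<le> \<zeta>))"
    by (simp add: mult.assoc[symmetric] flip: exp_add)
  finally show ?thesis
    by simp
qed

end

end

section \<open>The level sets of the constraint satisfaction model\<close>

text \<open>
  Deleting \<open>d\<close> constraints moves the number of satisfied constraints, centred at its target value,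
  by at most \<open>d\<close>. Hence the count is sandwiched between counts for the hyperforest, with a slightly
  smaller and a slightly larger window, and all errors are linear in \<open>\<epsilon>\<close>.
\<close>

lemma AN_log_bound:
  assumes N: "1 / \<epsilon> \<le> real N" "0 < \<epsilon>" "\<epsilon> < 1" and t: "0 < t" "t < 1" and \<rho>01: "0 < \<rho>" "\<rho> < 1" and "0 < \<alpha>"
    and K: "2 / \<epsilon>\<^sup>2 \<le> real K" "\<bar>real K - \<alpha> * real N\<bar> \<le> \<epsilon> * real N"
    and I: "\<And>k. k \<in> {1..K} \<Longrightarrow> I k \<in> edges p N"
    and \<Theta>: "\<And>k. k \<in> {1..K} \<Longrightarrow> \<Theta> k \<in> constraint_funs p" "\<And>k. k \<in> {1..K} \<Longrightarrow> symmetric_fun p (\<Theta> k)"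
      "\<And>k. k \<in> {1..K} \<Longrightarrow> avg (cube p) (\<lambda>x. of_bool (\<Theta> k x = 0)) = \<rho>"
    and defect: "real (defect I {1..K}) \<le> \<epsilon> / 4 * real K"
  shows "0 < AN N K \<Theta> I \<epsilon> t"
    and "\<bar>1 / real N * ln (real (AN N K \<Theta> I \<epsilon> t)) - (ln 2 + \<alpha> * rate \<rho> t)\<bar>
      \<le> \<epsilon> * (1 + (\<alpha> + 1) * (2 * slope \<rho> t + \<bar>rate \<rho> t\<bar>) + \<bar>rate \<rho> t\<bar>)"
proof -
  let ?V = "{1..N}" and ?r = "rate \<rho> t" and ?L = "slope \<rho> t"
  let ?C = "?V \<rightarrow>\<^sub>E (UNIV :: spin set)"
  obtain B where B: "B \<subseteq> {1..K}" "card B = defect I {1..K}" and hf: "hyperforest I ({1..K} - B)"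
    using defect_witness by metis
  define A where "A = {1..K} - B"
  let ?m = "real (card A)" and ?d = "real (card B)"
  have finB: "finite B"
    using B(1) by (rule finite_subset) auto
  have m: "?m = real K - ?d"
    using B(1) finB card_mono[OF _ B(1)] unfolding A_def
    by (simp add: card_Diff_subset of_nat_diff)
  have d: "?d \<le> \<epsilon> / 4 * real K"
    using B(2) defect by simp
  have A': "finite A" "hyperforest I A"
    using hf by (auto simp: A_def)
  have eA: "\<And>k. k \<in> A \<Longrightarrow> distinct (I k) \<and> length (I k) = p \<and> set (I k) \<subseteq> ?V"
    using I by (auto simp: A_def edges_def)
  have sA: "\<And>k. k \<in> A \<Longrightarrow> symmetric_fun p (\<Theta> k)"
    "\<And>k. k \<in> A \<Longrightarrow> avg (cube p) (\<lambda>x. of_bool (\<Theta> k x = 0)) = \<rho>"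
    using \<Theta> by (auto simp: A_def)
  note upper = window_upper[OF finite_atLeastAtMost[of 1 N] A' eA sA t \<rho>01]
  note lower = window_lower[OF finite_atLeastAtMost[of 1 N] A' eA sA t \<rho>01]
  let ?S = "num_sat A I \<Theta>"
  let ?R = "\<lambda>\<sigma>. num_sat B I \<Theta> \<sigma> - ?d * t"
  have N0: "0 < real N"
    using N less_le_trans[of 0 "1 / \<epsilon>" "real N"] by auto
  have K0: "0 < real K"
    using K(1) N less_le_trans[of 0 "2 / \<epsilon>\<^sup>2" "real K"] by auto
  have val: "\<Theta> k (map \<sigma> (I k)) \<in> {-1, 0}" if "k \<in> {1..K}" for k \<sigma>
  proof -
    have "map \<sigma> (I k) \<in> cube p"
      using I[OF that] by (simp add: edges_def cube_def)
    then show ?thesis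
      using \<Theta>(1)[OF that] unfolding constraint_funs_def by (rule PiE_mem[rotated])
  qed
  have total: "(\<Sum>k=1..K. 1 + \<Theta> k (map \<sigma> (I k))) - real K * t = (?S \<sigma> - ?m * t) + ?R \<sigma>" for \<sigma>
  proof -
    have "(\<Sum>k=1..K. 1 + \<Theta> k (map \<sigma> (I k))) = (\<Sum>k=1..K. of_bool (\<Theta> k (map \<sigma> (I k)) = 0))"
    proof (rule sum.cong[OF refl])
      fix k assume "k \<in> {1..K}"
      then show "1 + \<Theta> k (map \<sigma> (I k)) = of_bool (\<Theta> k (map \<sigma> (I k)) = 0)"
        using val[of k \<sigma>] by auto
    qed
    also have "\<dots> = ?S \<sigma> + num_sat B I \<Theta> \<sigma>"
      unfolding num_sat_def A_def using B(1) by (intro sum.subset_diff) auto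
    finally show ?thesis
      by (simp add: m algebra_simps)
  qed
  have R: "\<bar>?R \<sigma>\<bar> \<le> ?d" for \<sigma>
  proof -
    have "0 \<le> num_sat B I \<Theta> \<sigma>"
      unfolding num_sat_def by (intro sum_nonneg) auto
    moreover have "num_sat B I \<Theta> \<sigma> \<le> (\<Sum>k\<in>B. 1)"
      unfolding num_sat_def by (intro sum_mono) auto
    moreover have "0 \<le> ?d * t" "?d * t \<le> ?d * 1"
      by (use t in simp) (intro mult_left_mono, use t in auto)
    ultimately show ?thesis
      by (simp add: abs_le_iff)
  qed
  have in_window: "1 / real K * (\<Sum>k=1..K. (1 + \<Theta> k (map \<sigma> (I k)))) \<in> {t - \<epsilon> <..< t + \<epsilon>}
      \<longleftrightarrow> \<bar>(?S \<sigma> - ?m * t) + ?R \<sigma>\<bar> < \<epsilon> * real K" for \<sigma>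
    unfolding total[symmetric] using K0 by (auto simp: abs_less_iff field_simps)
  have AN: "real (AN N K \<Theta> I \<epsilon> t) = 2 ^ N * avg ?C (\<lambda>\<sigma>. of_bool (\<bar>(?S \<sigma> - ?m * t) + ?R \<sigma>\<bar> < \<epsilon> * real K))"
    unfolding AN_def in_window by (subst avg_indicator) (simp_all add: card_PiE card_UNIV_spin finite_configs)
  have "avg ?C (\<lambda>\<sigma>. of_bool (\<bar>(?S \<sigma> - ?m * t) + ?R \<sigma>\<bar> < \<epsilon> * real K))
      \<le> avg ?C (\<lambda>\<sigma>. of_bool (\<bar>?S \<sigma> - ?m * t\<bar> \<le> \<epsilon> * real K + ?d))"
  proof (rule avg_mono)
    fix \<sigma>
    show "of_bool (\<bar>(?S \<sigma> - ?m * t) + ?R \<sigma>\<bar> < \<epsilon> * real K) \<le> (of_bool (\<bar>?S \<sigma> - ?m * t\<bar> \<le> \<epsilon> * real K + ?d) :: real)"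
      using R[of \<sigma>] by (auto simp: abs_le_iff abs_less_iff)
  qed
  also have "\<dots> \<le> exp (?m * ?r + (\<epsilon> * real K + ?d) * ?L)"
    by (rule upper)
  finally have up: "real (AN N K \<Theta> I \<epsilon> t) \<le> 2 ^ N * exp (?m * ?r + (\<epsilon> * real K + ?d) * ?L)"
    unfolding AN by (intro mult_left_mono) auto
  \<comment> \<open>half of the window leaves room for the at most \<open>\<epsilon> K / 4\<close> deleted constraints\<close>
  define \<zeta> where "\<zeta> = \<epsilon> * real K / 2"
  have "exp (?m * ?r - \<zeta> * ?L) / 2 \<le> avg ?C (\<lambda>\<sigma>. of_bool (\<bar>?S \<sigma> - ?m * t\<bar> \<le> \<zeta>))"
  proof (rule lower)
    show "0 < \<zeta>"
      using N K0 by (simp add: \<zeta>_def)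
    have "2 \<le> \<epsilon>\<^sup>2 * real K"
      using K(1) N by (simp add: field_simps)
    then have "2 * real K \<le> \<epsilon>\<^sup>2 * real K * real K"
      using K0 by (intro mult_right_mono) auto
    moreover have "2 * \<zeta>\<^sup>2 = \<epsilon>\<^sup>2 * real K * real K / 2"
      by (simp add: \<zeta>_def power2_eq_square)
    moreover have "?m \<le> real K"
      using m by simp
    ultimately show "?m \<le> 2 * \<zeta>\<^sup>2"
      by linarith
  qed
  also have "\<dots> \<le> avg ?C (\<lambda>\<sigma>. of_bool (\<bar>(?S \<sigma> - ?m * t) + ?R \<sigma>\<bar> < \<epsilon> * real K))"
  proof (rule avg_mono)
    fix \<sigma>
    have "\<bar>(?S \<sigma> - ?m * t) + ?R \<sigma>\<bar> < \<epsilon> * real K" if "\<bar>?S \<sigma> - ?m * t\<bar> \<le> \<zeta>"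
    proof -
      have "0 < \<epsilon> * real K"
        using N K0 by simp
      then show ?thesis
        using R[of \<sigma>] that d abs_triangle_ineq[of "?S \<sigma> - ?m * t" "?R \<sigma>"] unfolding \<zeta>_def by linarith
    qed
    then show "of_bool (\<bar>?S \<sigma> - ?m * t\<bar> \<le> \<zeta>) \<le> (of_bool (\<bar>(?S \<sigma> - ?m * t) + ?R \<sigma>\<bar> < \<epsilon> * real K) :: real)"
      by auto
  qed
  finally have lo: "2 ^ N * (exp (?m * ?r - \<zeta> * ?L) / 2) \<le> real (AN N K \<Theta> I \<epsilon> t)"
    unfolding AN by (intro mult_left_mono) auto
  have "0 < 2 ^ N * (exp (?m * ?r - \<zeta> * ?L) / 2)"
    by simp
  with lo have "0 < real (AN N K \<Theta> I \<epsilon> t)"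
    by linarith
  then show pos: "0 < AN N K \<Theta> I \<epsilon> t"
    by simp
  let ?l = "ln (real (AN N K \<Theta> I \<epsilon> t))"
  have l_up: "?l \<le> real N * ln 2 + (?m * ?r + (\<epsilon> * real K + ?d) * ?L)"
  proof -
    have "?l \<le> ln (2 ^ N * exp (?m * ?r + (\<epsilon> * real K + ?d) * ?L))"
      using pos up by (subst ln_le_cancel_iff) auto
    then show ?thesis
      by (simp add: ln_mult ln_realpow)
  qed
  have l_lo: "real N * ln 2 + (?m * ?r - \<zeta> * ?L) - ln 2 \<le> ?l"
  proof -
    have "ln (2 ^ N * (exp (?m * ?r - \<zeta> * ?L) / 2)) \<le> ?l"
      using pos lo by (subst ln_le_cancel_iff) auto
    then show ?thesis
      by (simp add: ln_mult ln_realpow ln_div)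
  qed
  have L0: "0 \<le> ?L"
    by (simp add: slope_def)
  have dr: "\<bar>?d * ?r\<bar> \<le> \<epsilon> * real K * \<bar>?r\<bar>"
  proof -
    have "?d \<le> \<epsilon> * real K"
      using d N K0 mult_pos_pos[of \<epsilon> "real K"] by linarith
    then show ?thesis
      unfolding abs_mult by (intro mult_right_mono) auto
  qed
  have "(\<epsilon> * real K + ?d) * ?L \<le> 2 * \<epsilon> * real K * ?L"
    using d N K0 mult_pos_pos[of \<epsilon> "real K"] L0 by (intro mult_right_mono) auto
  moreover have "\<zeta> * ?L \<le> 2 * \<epsilon> * real K * ?L"
    using N K0 mult_pos_pos[of \<epsilon> "real K"] L0 unfolding \<zeta>_def by (intro mult_right_mono) auto
  moreover have "?m * ?r = real K * ?r - ?d * ?r"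
    by (simp add: m algebra_simps)
  moreover have "ln 2 \<le> (1 :: real)"
    using ln_le_minus_one[of 2] by simp
  ultimately have "\<bar>?l - real N * ln 2 - real K * ?r\<bar> \<le> 1 + 2 * \<epsilon> * real K * ?L + \<epsilon> * real K * \<bar>?r\<bar>"
    using l_up l_lo dr ln_gt_zero[of "2 :: real"] by linarith
  moreover have "\<bar>real K * ?r - \<alpha> * real N * ?r\<bar> \<le> \<epsilon> * real N * \<bar>?r\<bar>"
    unfolding left_diff_distrib[symmetric] abs_mult using K(2) by (intro mult_right_mono) auto
  ultimately have "\<bar>?l - real N * (ln 2 + \<alpha> * ?r)\<bar> \<le> 1 + \<epsilon> * real K * (2 * ?L + \<bar>?r\<bar>) + \<epsilon> * real N * \<bar>?r\<bar>"
    by (simp add: algebra_simps abs_le_iff)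
  also have "\<dots> \<le> \<epsilon> * real N + \<epsilon> * ((\<alpha> + 1) * real N) * (2 * ?L + \<bar>?r\<bar>) + \<epsilon> * real N * \<bar>?r\<bar>"
  proof -
    have "\<epsilon> * real N \<le> 1 * real N"
      using N by (intro mult_right_mono) auto
    then have "real K \<le> (\<alpha> + 1) * real N"
      using K(2) by (simp add: algebra_simps abs_le_iff)
    then have "\<epsilon> * real K * (2 * ?L + \<bar>?r\<bar>) \<le> \<epsilon> * ((\<alpha> + 1) * real N) * (2 * ?L + \<bar>?r\<bar>)"
      using N L0 by (intro mult_right_mono mult_left_mono) auto
    moreover have "1 \<le> \<epsilon> * real N"
      using N by (simp add: field_simps)
    ultimately show ?thesis
      by linarith
  qed
  also have "\<dots> = real N * (\<epsilon> * (1 + (\<alpha> + 1) * (2 * ?L + \<bar>?r\<bar>) + \<bar>?r\<bar>))"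
    by (simp add: algebra_simps)
  finally have *: "\<bar>?l - real N * (ln 2 + \<alpha> * ?r)\<bar> \<le> real N * (\<epsilon> * (1 + (\<alpha> + 1) * (2 * ?L + \<bar>?r\<bar>) + \<bar>?r\<bar>))" .
  have "\<bar>1 / real N * ?l - (ln 2 + \<alpha> * ?r)\<bar> = \<bar>?l - real N * (ln 2 + \<alpha> * ?r)\<bar> / real N"
  proof -
    have "1 / real N * ?l - (ln 2 + \<alpha> * ?r) = (?l - real N * (ln 2 + \<alpha> * ?r)) / real N"
      using N0 by (simp add: diff_divide_distrib)
    then show ?thesis
      using N0 by (simp add: abs_divide)
  qed
  also have "\<dots> \<le> \<epsilon> * (1 + (\<alpha> + 1) * (2 * ?L + \<bar>?r\<bar>) + \<bar>?r\<bar>)"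
    using * N0 by (simp add: divide_le_eq mult.commute)
  finally show "\<bar>1 / real N * ?l - (ln 2 + \<alpha> * ?r)\<bar> \<le> \<epsilon> * (1 + (\<alpha> + 1) * (2 * ?L + \<bar>?r\<bar>) + \<bar>?r\<bar>)" .
qed

text \<open>
  The deterministic core of the limit: it holds for every realisation in which the number of
  constraints is \<open>\<alpha> N + o(N)\<close> and the defect is \<open>o(N)\<close>, for all \<open>\<epsilon>\<close> at once.
\<close>

lemma AN_limit:
  assumes t: "0 < t" "t < 1" and \<rho>01: "0 < \<rho>" "\<rho> < 1" and \<alpha>: "0 < \<alpha>"
    and I: "\<forall>\<^sub>F N in sequentially. \<forall>k\<in>{1..}. I N k \<in> edges p N"
    and \<Theta>: "\<And>k. k \<in> {1..} \<Longrightarrow> \<Theta> k \<in> constraint_funs p \<and> symmetric_fun p (\<Theta> k) \<and>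
      avg (cube p) (\<lambda>x. of_bool (\<Theta> k x = 0)) = \<rho>"
    and K: "\<And>\<delta>. 0 < \<delta> \<Longrightarrow> \<forall>\<^sub>F N in sequentially. \<bar>real (K N) - \<alpha> * real N\<bar> \<le> \<delta> * real N"
    and D: "\<And>\<delta>. 0 < \<delta> \<Longrightarrow> \<forall>\<^sub>F N in sequentially. real (defect (I N) {1..K N}) \<le> \<delta> * real N"
  shows "((\<lambda>\<epsilon>. limsup (\<lambda>N. \<bar>ereal (1 / real N) * log_count (AN N (K N) \<Theta> (I N) \<epsilon> t) -
            ereal (ln 2 + \<alpha> * (1 - t) * ln ((1 - \<rho>) / (1 - t)) + \<alpha> * t * ln (\<rho> / t))\<bar>))
          \<longlongrightarrow> 0) (at_right 0)"
proof -
  define C where "C = 1 + (\<alpha> + 1) * (2 * slope \<rho> t + \<bar>rate \<rho> t\<bar>) + \<bar>rate \<rho> t\<bar>"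
  let ?x = "ln 2 + \<alpha> * (1 - t) * ln ((1 - \<rho>) / (1 - t)) + \<alpha> * t * ln (\<rho> / t)"
  have x: "?x = ln 2 + \<alpha> * rate \<rho> t"
    by (simp add: rate_def algebra_simps)
  let ?f = "\<lambda>\<epsilon> N. \<bar>ereal (1 / real N) * log_count (AN N (K N) \<Theta> (I N) \<epsilon> t) - ereal ?x\<bar>"
  have up: "limsup (?f \<epsilon>) \<le> ereal (\<epsilon> * C)" if \<epsilon>: "0 < \<epsilon>" "\<epsilon> < 1" for \<epsilon>
  proof (rule Limsup_bounded)
    have a2: "0 < \<alpha> / 2"
      using \<alpha> by simp
    have e1: "\<forall>\<^sub>F N in sequentially. 1 / \<epsilon> \<le> real N"
      using filterlim_real_sequentially by (simp add: filterlim_at_top)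
    have e2: "\<forall>\<^sub>F N in sequentially. 2 / \<epsilon>\<^sup>2 / (\<alpha> / 2) \<le> real N"
      using filterlim_real_sequentially by (simp add: filterlim_at_top)
    have d: "0 < \<epsilon> / 4 * (\<alpha> / 2)"
      using \<epsilon> \<alpha> by simp
    show "\<forall>\<^sub>F N in sequentially. ?f \<epsilon> N \<le> ereal (\<epsilon> * C)"
      using I K[OF \<epsilon>(1)] K[OF a2] D[OF d] e1 e2
    proof eventually_elim
      case (elim N)
      have "\<alpha> * real N = \<alpha> / 2 * real N + \<alpha> / 2 * real N"
        by (simp add: field_simps)
      then have KN: "\<alpha> / 2 * real N \<le> real (K N)"
        using elim(3) by linarith
      have K2: "2 / \<epsilon>\<^sup>2 \<le> real (K N)"
      proof -
        have "2 / \<epsilon>\<^sup>2 \<le> \<alpha> / 2 * real N"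
          using elim(6) a2 by (simp only: pos_divide_le_eq mult.commute)
        then show ?thesis
          using KN by linarith
      qed
      have "real (defect (I N) {1..K N}) \<le> \<epsilon> / 4 * (\<alpha> / 2 * real N)"
        using elim(4) by (simp add: mult.assoc)
      also have "\<dots> \<le> \<epsilon> / 4 * real (K N)"
        using KN \<epsilon> by (intro mult_left_mono) auto
      finally have dN: "real (defect (I N) {1..K N}) \<le> \<epsilon> / 4 * real (K N)" .
      note * = AN_log_bound[OF elim(5) \<epsilon> t \<rho>01 \<alpha> K2 elim(2) _ _ _ _ dN]
      have pos: "0 < AN N (K N) \<Theta> (I N) \<epsilon> t"
        using elim(1) \<Theta> by (intro *(1)) auto
      have "\<bar>1 / real N * ln (real (AN N (K N) \<Theta> (I N) \<epsilon> t)) - (ln 2 + \<alpha> * rate \<rho> t)\<bar> \<le> \<epsilon> * C"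
        unfolding C_def using elim(1) \<Theta> by (intro *(2)) auto
      then show ?case
        using pos unfolding x by (simp add: log_count_def)
    qed
  qed
  have lo: "0 \<le> limsup (?f \<epsilon>)" for \<epsilon>
    by (rule le_Limsup) auto
  have "((\<lambda>\<epsilon>. ereal (\<epsilon> * C)) \<longlongrightarrow> ereal (0 * C)) (at_right 0)"
    by (intro tendsto_intros)
  then have lim: "((\<lambda>\<epsilon>. ereal (\<epsilon> * C)) \<longlongrightarrow> 0) (at_right 0)"
    by (simp add: zero_ereal_def)
  have "\<forall>\<^sub>F \<epsilon> in at_right 0. 0 < \<epsilon> \<and> \<epsilon> < (1 :: real)"
    by (auto simp: eventually_at_right_field intro: exI[of _ 1])
  then have "\<forall>\<^sub>F \<epsilon> in at_right 0. limsup (?f \<epsilon>) \<le> ereal (\<epsilon> * C)"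
    by (rule eventually_mono) (use up in auto)
  then show ?thesis
    by (intro tendsto_sandwich[OF _ _ tendsto_const lim]) (use lo in auto)
qed

section \<open>The Poisson distribution\<close>

lemma nn_integral_poisson:
  assumes "0 < l" "\<And>k. 0 \<le> h k" "(\<lambda>k. l ^ k / fact k * exp (- l) * h k) sums s"
  shows "(\<integral>\<^sup>+ k. ennreal (h k) \<partial>measure_pmf (poisson_pmf l)) = ennreal s"
proof -
  have "(\<integral>\<^sup>+ k. ennreal (h k) \<partial>measure_pmf (poisson_pmf l))
      = (\<integral>\<^sup>+ k. ennreal (l ^ k / fact k * exp (- l) * h k) \<partial>count_space UNIV)"
    unfolding nn_integral_measure_pmf pmf_poisson[OF assms(1)]
    by (intro nn_integral_cong, subst ennreal_mult''[symmetric]) (auto intro: assms)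
  also have "\<dots> = (\<Sum>k. ennreal (l ^ k / fact k * exp (- l) * h k))"
    by (rule nn_integral_count_space_nat)
  also have "\<dots> = ennreal (\<Sum>k. l ^ k / fact k * exp (- l) * h k)"
    using assms by (intro suminf_ennreal_eq[THEN trans, OF _ assms(3)]) (auto simp: sums_iff)
  finally show ?thesis
    using assms(3) by (simp add: sums_iff)
qed

lemma nn_integral_poisson_exp:
  assumes "0 < l"
  shows "(\<integral>\<^sup>+ k. ennreal (exp (u * real k)) \<partial>measure_pmf (poisson_pmf l)) = ennreal (exp (l * (exp u - 1)))"
proof (rule nn_integral_poisson)
  have "(\<lambda>k. exp (- l) * ((l * exp u) ^ k /\<^sub>R fact k)) sums (exp (- l) * exp (l * exp u))"
    by (intro sums_mult exp_converges)
  moreover have "exp (- l) * ((l * exp u) ^ k /\<^sub>R fact k) = l ^ k / fact k * exp (- l) * exp (u * real k)" for k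
    by (simp add: power_mult_distrib exp_of_nat2_mult divide_inverse mult_ac)
  ultimately show "(\<lambda>k. l ^ k / fact k * exp (- l) * exp (u * real k)) sums exp (l * (exp u - 1))"
    by (simp add: exp_add[symmetric] algebra_simps)
qed (use assms in auto)

lemma nn_integral_poisson_id:
  assumes "0 < l"
  shows "(\<integral>\<^sup>+ k. ennreal (real k) \<partial>measure_pmf (poisson_pmf l)) = ennreal l"
proof (rule nn_integral_poisson)
  have "(\<lambda>k. (l * exp (- l)) * (l ^ k /\<^sub>R fact k)) sums (l * exp (- l) * exp l)"
    by (intro sums_mult exp_converges)
  moreover have "(l * exp (- l)) * (l ^ k /\<^sub>R fact k) = l ^ Suc k / fact (Suc k) * exp (- l) * real (Suc k)" for k
    by (simp add: divide_simps del: of_nat_Suc)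
  moreover have "l * exp (- l) * exp l = l"
    by (simp add: exp_minus)
  ultimately have "(\<lambda>k. l ^ Suc k / fact (Suc k) * exp (- l) * real (Suc k)) sums l"
    by (simp only:)
  then show "(\<lambda>k. l ^ k / fact k * exp (- l) * real k) sums l"
    by (subst (asm) sums_Suc_iff) simp
qed (use assms in auto)

text \<open>
  Chernoff's bound for both tails: \<open>u\<close> is positive for the upper and negative for the lower tail.
\<close>

lemma poisson_tail:
  assumes "0 < l" "exp u \<le> 1 + u + u\<^sup>2"
  shows "emeasure (measure_pmf (poisson_pmf l)) {k. y \<le> u * (real k - l)} \<le> ennreal (exp (l * u\<^sup>2 - y))"
proof -
  have "emeasure (measure_pmf (poisson_pmf l)) {k. y \<le> u * (real k - l)}
      = (\<integral>\<^sup>+ k. indicator {k. y \<le> u * (real k - l)} k \<partial>measure_pmf (poisson_pmf l))"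
    by simp
  also have "\<dots> \<le> (\<integral>\<^sup>+ k. ennreal (exp (- u * l - y)) * ennreal (exp (u * real k)) \<partial>measure_pmf (poisson_pmf l))"
  proof (rule nn_integral_mono)
    fix k
    show "indicator {k. y \<le> u * (real k - l)} k \<le> ennreal (exp (- u * l - y)) * ennreal (exp (u * real k))"
      by (auto simp: indicator_def algebra_simps simp flip: ennreal_mult exp_add)
  qed
  also have "\<dots> = ennreal (exp (- u * l - y)) * ennreal (exp (l * (exp u - 1)))"
    by (simp add: nn_integral_cmult nn_integral_poisson_exp[OF assms(1)])
  also have "\<dots> = ennreal (exp (- u * l - y + l * (exp u - 1)))"
    by (simp add: exp_add ennreal_mult)
  also have "\<dots> \<le> ennreal (exp (l * u\<^sup>2 - y))"
  proof -
    have "l * exp u \<le> l * (1 + u + u\<^sup>2)"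
      using assms by (intro mult_left_mono) auto
    then show ?thesis
      by (intro ennreal_leI) (simp add: algebra_simps)
  qed
  finally show ?thesis .
qed

lemma exp_minus_bound:
  assumes "0 \<le> (x :: real)"
  shows "exp (- x) \<le> 1 + (- x) + (- x)\<^sup>2"
proof -
  have "exp (- x) \<le> 1 / (1 + x)"
    using assms exp_ge_add_one_self[of x] by (simp add: exp_minus divide_simps)
  also have "\<dots> \<le> 1 + (- x) + (- x)\<^sup>2"
  proof -
    have "1 \<le> (1 + (- x) + (- x)\<^sup>2) * (1 + x)"
      using assms by (simp add: algebra_simps power2_eq_square)
    then show ?thesis
      using assms by (simp add: divide_le_eq)
  qed
  finally show ?thesis .
qed

lemma poisson_concentration:
  assumes "0 < a" "0 < \<delta>"
  obtains c where "0 < c" "\<And>N. 0 < N \<Longrightarrow>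
    emeasure (measure_pmf (poisson_pmf (a * real N))) {k. \<delta> * real N \<le> \<bar>real k - a * real N\<bar>} \<le> ennreal (2 * exp (- c) ^ N)"
proof
  \<comment> \<open>small enough for the quadratic term \<open>a s\<^sup>2\<close> to be at most half of the linear gain \<open>s \<delta>\<close>\<close>
  define s where "s = min 1 (\<delta> / (2 * a))"
  have s: "0 < s" "s \<le> 1"
    using assms by (auto simp: s_def)
  have as: "a * s \<le> \<delta> / 2"
  proof -
    have "a * s \<le> a * (\<delta> / (2 * a))"
      using assms by (intro mult_left_mono) (auto simp: s_def)
    then show ?thesis
      using assms by simp
  qed
  show "0 < s * \<delta> / 2"
    using s assms by simp
  fix N :: nat assume N: "0 < N"
  let ?P = "measure_pmf (poisson_pmf (a * real N))" and ?l = "a * real N"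
  have l: "0 < ?l"
    using N assms by simp
  have tail: "emeasure ?P {k. s * (\<delta> * real N) \<le> u * (real k - ?l)} \<le> ennreal (exp (- (s * \<delta> / 2)) ^ N)"
    if u: "exp u \<le> 1 + u + u\<^sup>2" "u\<^sup>2 = s\<^sup>2" for u
  proof -
    have "a * s * (s * real N) \<le> \<delta> / 2 * (s * real N)"
      using as s by (intro mult_right_mono) auto
    then have "?l * u\<^sup>2 - s * (\<delta> * real N) \<le> real N * (- (s * \<delta> / 2))"
      unfolding u(2) by (simp add: power2_eq_square algebra_simps)
    then have "ennreal (exp (?l * u\<^sup>2 - s * (\<delta> * real N))) \<le> ennreal (exp (- (s * \<delta> / 2)) ^ N)"
      unfolding exp_of_nat_mult[symmetric] by (intro ennreal_leI) simp
    then show ?thesis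
      using poisson_tail[OF l u(1), of "s * (\<delta> * real N)"] by (rule order_trans[rotated])
  qed
  have "{k. \<delta> * real N \<le> \<bar>real k - ?l\<bar>}
      \<subseteq> {k. s * (\<delta> * real N) \<le> s * (real k - ?l)} \<union> {k. s * (\<delta> * real N) \<le> - s * (real k - ?l)}"
  proof
    fix k assume "k \<in> {k. \<delta> * real N \<le> \<bar>real k - ?l\<bar>}"
    then have "\<delta> * real N \<le> real k - ?l \<or> \<delta> * real N \<le> - (real k - ?l)"
      by auto
    then have "s * (\<delta> * real N) \<le> s * (real k - ?l) \<or> s * (\<delta> * real N) \<le> s * (- (real k - ?l))"
      using s by (meson less_imp_le mult_left_mono)
    then show "k \<in> {k. s * (\<delta> * real N) \<le> s * (real k - ?l)} \<union> {k. s * (\<delta> * real N) \<le> - s * (real k - ?l)}"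
      by (auto simp: algebra_simps)
  qed
  then have "emeasure ?P {k. \<delta> * real N \<le> \<bar>real k - ?l\<bar>}
      \<le> emeasure ?P ({k. s * (\<delta> * real N) \<le> s * (real k - ?l)} \<union> {k. s * (\<delta> * real N) \<le> - s * (real k - ?l)})"
    by (intro emeasure_mono) auto
  also have "\<dots> \<le> emeasure ?P {k. s * (\<delta> * real N) \<le> s * (real k - ?l)} + emeasure ?P {k. s * (\<delta> * real N) \<le> - s * (real k - ?l)}"
    by (intro emeasure_subadditive) auto
  also have "\<dots> \<le> ennreal (exp (- (s * \<delta> / 2)) ^ N) + ennreal (exp (- (s * \<delta> / 2)) ^ N)"
    using exp_bound[of s] exp_minus_bound[of s] s by (intro add_mono tail) auto
  also have "\<dots> = ennreal (2 * exp (- (s * \<delta> / 2)) ^ N)"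
    by (subst ennreal_plus[symmetric]) auto
  finally show "emeasure ?P {k. \<delta> * real N \<le> \<bar>real k - ?l\<bar>} \<le> ennreal (2 * exp (- (s * \<delta> / 2)) ^ N)" .
qed

section \<open>Almost sure properties of the random instances\<close>

lemma defect_mono:
  assumes "A \<subseteq> A'" "finite A'"
  shows "defect e A \<le> defect e A'"
proof -
  obtain B where B: "B \<subseteq> A'" "card B = defect e A'" "hyperforest e (A' - B)"
    using defect_witness by metis
  have "defect e A \<le> card (B \<inter> A)"
    using B(3) assms by (intro defect_le) (auto elim!: hyperforest_subset)
  also have "\<dots> \<le> card B"
    using B(1) assms(2) by (intro card_mono) (auto intro: finite_subset)
  finally show ?thesis
    using B by simp
qed

lemma defect_superset_le:
  assumes "A \<subseteq> A'" "finite A'"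
  shows "defect e A' \<le> defect e A + card (A' - A)"
proof -
  obtain B where B: "B \<subseteq> A" "card B = defect e A" "hyperforest e (A - B)"
    using defect_witness by metis
  have "defect e A' \<le> card (B \<union> (A' - A))"
    using B assms by (intro defect_le) (auto elim!: hyperforest_subset)
  also have "\<dots> \<le> card B + card (A' - A)"
    by (rule card_Un_le)
  finally show ?thesis
    using B by simp
qed

lemma defect_atLeastAtMost_le: "defect e {1..K} \<le> defect e {1..n} + (K - n)" for K n :: nat
proof (cases "K \<le> n")
  case True
  then have "defect e {1..K} \<le> defect e {1..n}"
    by (intro defect_mono) auto
  then show ?thesis by simp
next
  case False
  then have "{1..K} - {1..n} = {n+1..K}"
    by auto
  then show ?thesis
    using False defect_superset_le[of "{1..n}" "{1..K}" e] by simp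
qed

context
  fixes \<alpha> :: real and p :: nat and T :: "(spin list \<Rightarrow> real) pmf" and M :: "'w measure"
    and \<Theta> :: "nat \<Rightarrow> 'w \<Rightarrow> spin list \<Rightarrow> real" and K :: "nat \<Rightarrow> 'w \<Rightarrow> nat" and I :: "nat \<Rightarrow> nat \<Rightarrow> 'w \<Rightarrow> nat list"
  assumes model: "csp_model \<alpha> p T M \<Theta> K I" and \<alpha>: "0 < \<alpha>" and p: "2 \<le> p"
begin

interpretation prob_space M
  using model by (simp add: csp_model_def)

lemma csp_event:
  assumes N: "p \<le> N" and C: "C \<in> sets (\<Pi>\<^sub>M k\<in>{1..}. measure_pmf T)"
    and D: "D \<in> sets (\<Pi>\<^sub>M k\<in>{1..}. measure_pmf (index_law p N))"
  shows "{\<omega>\<in>space M. K N \<omega> \<in> B \<and> (\<lambda>k\<in>{1..}. \<Theta> k \<omega>) \<in> C \<and> (\<lambda>k\<in>{1..}. I N k \<omega>) \<in> D} \<in> sets M" (is "?E \<in> _")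
    and "emeasure M {\<omega>\<in>space M. K N \<omega> \<in> B \<and> (\<lambda>k\<in>{1..}. \<Theta> k \<omega>) \<in> C \<and> (\<lambda>k\<in>{1..}. I N k \<omega>) \<in> D}
      = emeasure (measure_pmf (poisson_pmf (\<alpha> * real N))) B * (emeasure (\<Pi>\<^sub>M k\<in>{1..}. measure_pmf T) C *
          emeasure (\<Pi>\<^sub>M k\<in>{1..}. measure_pmf (index_law p N)) D)"
proof -
  let ?X = "\<lambda>\<omega>. (K N \<omega>, \<lambda>k\<in>{1..}. \<Theta> k \<omega>, \<lambda>k\<in>{1..}. I N k \<omega>)"
  let ?L = "instance_law \<alpha> p T N"
  let ?Q = "\<Pi>\<^sub>M k\<in>{1::nat..}. measure_pmf T" and ?R = "\<Pi>\<^sub>M k\<in>{1::nat..}. measure_pmf (index_law p N)"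
  have X: "?X \<in> M \<rightarrow>\<^sub>M ?L" and distr: "distr M ?L ?X = ?L"
    using model N by (auto simp: csp_model_def)
  interpret Q: prob_space ?Q
    by (intro prob_space_PiM measure_pmf.prob_space_axioms)
  interpret R: prob_space ?R
    by (intro prob_space_PiM measure_pmf.prob_space_axioms)
  interpret QR: pair_prob_space ?Q ?R ..
  have E: "?E = ?X -` (B \<times> (C \<times> D)) \<inter> space M"
    by auto
  have S: "B \<times> (C \<times> D) \<in> sets ?L"
    unfolding instance_law_def using C D by (intro pair_measureI) auto
  show "?E \<in> sets M"
    unfolding E using X S by (rule measurable_sets)
  have "emeasure M ?E = emeasure (distr M ?L ?X) (B \<times> (C \<times> D))"
    unfolding E by (rule emeasure_distr[OF X S, symmetric])
  also have "\<dots> = emeasure (measure_pmf (poisson_pmf (\<alpha> * real N))) B * (emeasure ?Q C * emeasure ?R D)"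
    unfolding distr unfolding instance_law_def
    by (subst QR.P.emeasure_pair_measure_Times, simp, rule pair_measureI[OF C D],
        subst R.emeasure_pair_measure_Times[OF C D], rule refl)
  finally show "emeasure M ?E = emeasure (measure_pmf (poisson_pmf (\<alpha> * real N))) B * (emeasure ?Q C * emeasure ?R D)" .
qed

lemma csp_K_event:
  assumes N: "p \<le> N"
  shows "{\<omega>\<in>space M. K N \<omega> \<in> B} \<in> sets M"
    and "emeasure M {\<omega>\<in>space M. K N \<omega> \<in> B} = emeasure (measure_pmf (poisson_pmf (\<alpha> * real N))) B"
proof -
  let ?Q = "\<Pi>\<^sub>M k\<in>{1::nat..}. measure_pmf T" and ?R = "\<Pi>\<^sub>M k\<in>{1::nat..}. measure_pmf (index_law p N)"
  interpret Q: prob_space ?Q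
    by (intro prob_space_PiM measure_pmf.prob_space_axioms)
  interpret R: prob_space ?R
    by (intro prob_space_PiM measure_pmf.prob_space_axioms)
  have *: "{\<omega>\<in>space M. K N \<omega> \<in> B \<and> (\<lambda>k\<in>{1..}. \<Theta> k \<omega>) \<in> space ?Q \<and> (\<lambda>k\<in>{1..}. I N k \<omega>) \<in> space ?R}
      = {\<omega>\<in>space M. K N \<omega> \<in> B}"
    by (auto simp: space_PiM)
  show "{\<omega>\<in>space M. K N \<omega> \<in> B} \<in> sets M"
    "emeasure M {\<omega>\<in>space M. K N \<omega> \<in> B} = emeasure (measure_pmf (poisson_pmf (\<alpha> * real N))) B"
    using csp_event[OF N sets.top sets.top, of B] unfolding *
    by (simp_all only: Q.emeasure_space_1 R.emeasure_space_1 mult_1_right)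
qed

lemma csp_cylinder:
  assumes N: "p \<le> N" and J: "finite J" "J \<subseteq> {1..}" and J': "finite J'" "J' \<subseteq> {1..}"
  shows "{\<omega>\<in>space M. (\<forall>k\<in>J. \<Theta> k \<omega> \<in> Y k) \<and> (\<forall>k\<in>J'. I N k \<omega> \<in> X k)} \<in> sets M"
    and "emeasure M {\<omega>\<in>space M. (\<forall>k\<in>J. \<Theta> k \<omega> \<in> Y k) \<and> (\<forall>k\<in>J'. I N k \<omega> \<in> X k)}
      = (\<Prod>k\<in>J. emeasure (measure_pmf T) (Y k)) * (\<Prod>k\<in>J'. emeasure (measure_pmf (index_law p N)) (X k))"
proof -
  let ?Q = "\<Pi>\<^sub>M k\<in>{1::nat..}. measure_pmf T" and ?R = "\<Pi>\<^sub>M k\<in>{1::nat..}. measure_pmf (index_law p N)"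
  interpret Q: product_prob_space "\<lambda>_. measure_pmf T" "{1::nat..}" ..
  interpret R: product_prob_space "\<lambda>_. measure_pmf (index_law p N)" "{1::nat..}" ..
  let ?C = "{x\<in>space ?Q. \<forall>k\<in>J. x k \<in> Y k}" and ?D = "{x\<in>space ?R. \<forall>k\<in>J'. x k \<in> X k}"
  have C: "?C \<in> sets ?Q"
    using J by (intro sets.sets_Collect_finite_All sets_Collect_single) auto
  have D: "?D \<in> sets ?R"
    using J' by (intro sets.sets_Collect_finite_All sets_Collect_single) auto
  have QC: "emeasure ?Q ?C = (\<Prod>k\<in>J. emeasure (measure_pmf T) (Y k))"
    using J by (intro Q.emeasure_PiM_Collect) auto
  have RD: "emeasure ?R ?D = (\<Prod>k\<in>J'. emeasure (measure_pmf (index_law p N)) (X k))"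
    using J' by (intro R.emeasure_PiM_Collect) auto
  have *: "{\<omega>\<in>space M. K N \<omega> \<in> UNIV \<and> (\<lambda>k\<in>{1..}. \<Theta> k \<omega>) \<in> ?C \<and> (\<lambda>k\<in>{1..}. I N k \<omega>) \<in> ?D}
      = {\<omega>\<in>space M. (\<forall>k\<in>J. \<Theta> k \<omega> \<in> Y k) \<and> (\<forall>k\<in>J'. I N k \<omega> \<in> X k)}"
    using J J' by (auto simp: space_PiM subset_iff)
  show "{\<omega>\<in>space M. (\<forall>k\<in>J. \<Theta> k \<omega> \<in> Y k) \<and> (\<forall>k\<in>J'. I N k \<omega> \<in> X k)} \<in> sets M"
    using csp_event(1)[OF N C D, of UNIV] unfolding * .
  show "emeasure M {\<omega>\<in>space M. (\<forall>k\<in>J. \<Theta> k \<omega> \<in> Y k) \<and> (\<forall>k\<in>J'. I N k \<omega> \<in> X k)}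
      = (\<Prod>k\<in>J. emeasure (measure_pmf T) (Y k)) * (\<Prod>k\<in>J'. emeasure (measure_pmf (index_law p N)) (X k))"
    using csp_event(2)[OF N C D, of UNIV] unfolding * QC RD by simp
qed

lemma csp_Theta_AE: "AE \<omega> in M. \<forall>k\<in>{1..}. \<Theta> k \<omega> \<in> set_pmf T"
proof -
  have "AE \<omega> in M. \<Theta> k \<omega> \<in> set_pmf T" if k: "k \<in> {1..}" for k
  proof (rule AE_I')
    have "emeasure (measure_pmf T) (- set_pmf T) = 0"
      by (simp add: measure_pmf.emeasure_eq_measure measure_pmf_zero_iff)
    then show "{\<omega>\<in>space M. \<Theta> k \<omega> \<in> - set_pmf T} \<in> null_sets M"
      using csp_cylinder[OF order.refl, of "{k}" "{}" "\<lambda>_. - set_pmf T" "\<lambda>_. UNIV"] k by (auto simp: null_sets_def)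
  qed auto
  then show ?thesis
    by (subst AE_ball_countable) auto
qed

lemma index_law_eq: "index_law p N = pmf_of_set (edges p N)"
  by (simp add: index_law_def edges_def)

lemma csp_I_AE: "AE \<omega> in M. \<forall>N\<in>{p..}. \<forall>k\<in>{1..}. I N k \<omega> \<in> edges p N"
proof -
  have "AE \<omega> in M. I N k \<omega> \<in> edges p N" if N: "N \<in> {p..}" and k: "k \<in> {1..}" for N k
  proof (rule AE_I')
    have "set_pmf (index_law p N) = edges p N"
      unfolding index_law_eq using N by (intro set_pmf_of_set finite_edges edges_nonempty) auto
    then have "emeasure (measure_pmf (index_law p N)) (- edges p N) = 0"
      by (simp add: measure_pmf.emeasure_eq_measure measure_pmf_zero_iff)
    then show "{\<omega>\<in>space M. I N k \<omega> \<in> - edges p N} \<in> null_sets M"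
      using csp_cylinder[of N "{}" "{k}" "\<lambda>_. UNIV" "\<lambda>_. - edges p N"] k N by (auto simp: null_sets_def)
  qed auto
  then show ?thesis
    by (subst AE_ball_countable, simp, intro ballI, subst AE_ball_countable) auto
qed

lemma csp_K_AE:
  assumes "0 < \<delta>"
  shows "AE \<omega> in M. \<forall>\<^sub>F N in sequentially. \<bar>real (K N \<omega>) - \<alpha> * real N\<bar> \<le> \<delta> * real N"
proof -
  obtain c where c: "0 < c" "\<And>N. 0 < N \<Longrightarrow>
    emeasure (measure_pmf (poisson_pmf (\<alpha> * real N))) {k. \<delta> * real N \<le> \<bar>real k - \<alpha> * real N\<bar>} \<le> ennreal (2 * exp (- c) ^ N)"
    using poisson_concentration[OF \<alpha> assms] by metis
  define E where "E N = (if p \<le> N then {\<omega>\<in>space M. K N \<omega> \<in> {k. \<delta> * real N \<le> \<bar>real k - \<alpha> * real N\<bar>}} else {})" for N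
  have E: "E N \<in> sets M" for N
    unfolding E_def by (cases "p \<le> N") (simp_all only: if_True if_False csp_K_event(1) sets.empty_sets)
  have "measure M (E N) \<le> 2 * exp (- c) ^ N" for N
  proof (cases "p \<le> N")
    case True
    then have "emeasure M (E N) \<le> ennreal (2 * exp (- c) ^ N)"
      using c(2)[of N] p unfolding E_def by (simp only: csp_K_event(2) if_True)
    then show ?thesis
      by (simp add: emeasure_eq_measure)
  qed (simp add: E_def)
  then have "summable (\<lambda>N. measure M (E N))"
    using c(1) by (intro summable_comparison_test'[OF summable_mult[OF summable_geometric[of "exp (- c)"]]]) auto
  then have "AE \<omega> in M. \<forall>\<^sub>F N in sequentially. \<omega> \<in> space M - E N"
    by (intro borel_cantelli_AE1 E) (auto simp: emeasure_eq_measure)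
  then show ?thesis
  proof (rule AE_mp, intro AE_I2 impI)
    fix \<omega> assume "\<forall>\<^sub>F N in sequentially. \<omega> \<in> space M - E N"
    then show "\<forall>\<^sub>F N in sequentially. \<bar>real (K N \<omega>) - \<alpha> * real N\<bar> \<le> \<delta> * real N"
      using eventually_ge_at_top[of p] by eventually_elim (auto simp: E_def)
  qed
qed

text \<open>
  The first \<open>a N\<close> edges form a subcritical hypergraph. Their defect exceeds \<open>\<delta> N\<close> with exponentially
  small probability, so the Borel-Cantelli lemma applies however systems of different sizes
  are coupled.
\<close>

lemma csp_prefix_defect_AE:
  assumes "0 < \<delta>" "0 \<le> a" "a * (real p * (real p - 1)) < 1"
  shows "AE \<omega> in M. \<forall>\<^sub>F N in sequentially. real (defect (\<lambda>k. I N k \<omega>) {1..nat \<lfloor>a * real N\<rfloor>}) \<le> \<delta> * real N"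
proof -
  define \<tau> where "\<tau> = a * (real p * (real p - 1))"
  define n where "n N = nat \<lfloor>a * real N\<rfloor>" for N
  have pp: "1 \<le> real p * (real p - 1)"
    using p mult_mono[of 1 "real p" 1 "real p - 1"] by simp
  have \<tau>: "0 \<le> \<tau>" "\<tau> < 1"
    using assms pp by (auto simp: \<tau>_def)
  have n: "real (n N) \<le> a * real N" for N
    unfolding n_def using assms by simp
  have "a * 1 \<le> a * (real p * (real p - 1))"
    using assms pp by (intro mult_left_mono) auto
  then have "a \<le> 1"
    using assms by simp
  then have "a * real N \<le> 1 * real N" for N
    by (intro mult_right_mono) auto
  then have nN: "n N \<le> N" for N
    using n[of N] by (metis mult_1 of_nat_le_iff order_trans)
  define bad where "bad N E \<longleftrightarrow> \<delta> * real N \<le> real (defect E {1..n N})" for N and E :: "nat \<Rightarrow> nat list"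
  define N0 where "N0 = max p (nat \<lceil>2 / (1 - \<tau>) / (\<delta> / 2)\<rceil>)"
  \<comment> \<open>the bad event as a finite union of cylinders, which makes its measurability evident and turns
    its probability into a uniform average over edge sequences\<close>
  define Ev where "Ev N = (\<Union>E\<in>{E \<in> {1..n N} \<rightarrow>\<^sub>E edges p N. bad N E}. {\<omega>\<in>space M. \<forall>k\<in>{1..n N}. I N k \<omega> \<in> {E k}})" for N
  define Ev' where "Ev' N = (if N0 \<le> N then Ev N else {})" for N
  have fin: "finite {E \<in> {1..n N} \<rightarrow>\<^sub>E edges p N. bad N E}" for N
    by (rule finite_subset[of _ "{1..n N} \<rightarrow>\<^sub>E edges p N"]) (auto intro!: finite_PiE finite_edges)
  have cyl: "{\<omega>\<in>space M. \<forall>k\<in>{1..n N}. I N k \<omega> \<in> {E k}} \<in> sets M" if "p \<le> N" for N E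
    using csp_cylinder(1)[OF that, of "{}" "{1..n N}" undefined "\<lambda>k. {E k}"] by simp
  have Ev: "Ev N \<in> sets M" if "p \<le> N" for N
    unfolding Ev_def using fin cyl[OF that] by (intro sets.finite_UN) auto
  have Ev': "Ev' N \<in> sets M" for N
    using Ev by (auto simp: Ev'_def N0_def)
  have le: "measure M (Ev' N) \<le> exp (- (\<delta>\<^sup>2 / 8)) ^ N" for N
  proof (cases "N0 \<le> N")
    case True
    then have pN: "p \<le> N" and N0: "2 / (1 - \<tau>) / (\<delta> / 2) \<le> real N"
      by (auto simp: N0_def)
    let ?J = "{1..n N}" and ?S = "edges p N"
    have S: "finite ?S" "?S \<noteq> {}"
      using finite_edges edges_nonempty[OF pN] by auto
    have prob_cyl: "measure M {\<omega>\<in>space M. \<forall>k\<in>?J. I N k \<omega> \<in> {E k}} = 1 / real (card ?S) ^ n N"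
      if E: "E \<in> ?J \<rightarrow>\<^sub>E ?S" for E
    proof -
      have "emeasure M {\<omega>\<in>space M. \<forall>k\<in>?J. I N k \<omega> \<in> {E k}} = (\<Prod>k\<in>?J. emeasure (measure_pmf (index_law p N)) {E k})"
        using csp_cylinder(2)[OF pN, of "{}" "{1..n N}" undefined "\<lambda>k. {E k}"] by simp
      also have "\<dots> = (\<Prod>k\<in>?J. ennreal (1 / real (card ?S)))"
        unfolding index_law_eq using PiE_mem[OF E]
        by (intro prod.cong refl) (simp add: emeasure_pmf_single pmf_of_set[OF S(2,1)])
      also have "\<dots> = ennreal ((1 / real (card ?S)) ^ n N)"
        by (simp add: ennreal_power)
      finally show ?thesis
        by (simp add: emeasure_eq_measure power_one_over)
    qed
    have "measure M (Ev N) \<le> (\<Sum>E\<in>{E \<in> ?J \<rightarrow>\<^sub>E ?S. bad N E}. measure M {\<omega>\<in>space M. \<forall>k\<in>?J. I N k \<omega> \<in> {E k}})"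
      unfolding Ev_def using fin cyl[OF pN] by (intro finite_measure_subadditive_finite) auto
    also have "\<dots> = (\<Sum>E\<in>{E \<in> ?J \<rightarrow>\<^sub>E ?S. bad N E}. 1 / real (card ?S) ^ n N)"
      using prob_cyl by (intro sum.cong) auto
    also have "\<dots> = avg (?J \<rightarrow>\<^sub>E ?S) (\<lambda>E. of_bool (bad N E))"
      using S by (subst avg_indicator) (auto intro!: finite_PiE simp: card_PiE)
    also have "\<dots> \<le> exp (- (\<delta>\<^sup>2 / 8) * real N)"
      unfolding bad_def
    proof (rule avg_defect_tail[OF _ _ pN \<tau>])
      show "real (card ?J) * (real p * (real p - 1)) \<le> \<tau> * real N"
      proof -
        have "real (n N) * (real p * (real p - 1)) \<le> (a * real N) * (real p * (real p - 1))"
          using pp by (intro mult_right_mono n) auto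
        then show ?thesis
          by (simp add: \<tau>_def mult_ac)
      qed
      show "2 / (1 - \<tau>) \<le> \<delta> / 2 * real N"
        using N0 assms(1) by (subst (asm) pos_divide_le_eq) (auto simp: mult.commute)
    qed (use assms p pN nN[of N] in auto)
    also have "\<dots> = exp (- (\<delta>\<^sup>2 / 8)) ^ N"
      by (simp only: exp_of_nat2_mult)
    finally show ?thesis
      using True by (simp add: Ev'_def)
  qed (simp add: Ev'_def)
  have "summable (\<lambda>N. exp (- (\<delta>\<^sup>2 / 8)) ^ N)"
    using assms(1) by (intro summable_geometric) auto
  then have "summable (\<lambda>N. measure M (Ev' N))"
    by (rule summable_comparison_test'[where N = 0]) (use le in simp)
  then have "AE \<omega> in M. \<forall>\<^sub>F N in sequentially. \<omega> \<in> space M - Ev' N"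
    by (intro borel_cantelli_AE1 Ev') (auto simp: emeasure_eq_measure)
  with csp_I_AE show ?thesis
  proof eventually_elim
    case (elim \<omega>)
    have "\<forall>\<^sub>F N in sequentially. N0 \<le> N"
      by (rule eventually_ge_at_top)
    with elim(2) show ?case
    proof eventually_elim
      case (elim N)
      define E where "E = (\<lambda>k\<in>{1..n N}. I N k \<omega>)"
      have "E \<in> {1..n N} \<rightarrow>\<^sub>E edges p N"
        using \<open>\<forall>N\<in>{p..}. \<forall>k\<in>{1..}. I N k \<omega> \<in> edges p N\<close> elim(2) by (auto simp: E_def N0_def)
      moreover have "\<forall>k\<in>{1..n N}. I N k \<omega> \<in> {E k}"
        by (auto simp: E_def)
      ultimately have "\<not> bad N E"
        using elim by (auto simp: Ev'_def Ev_def)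
      moreover have "defect E {1..n N} = defect (\<lambda>k. I N k \<omega>) {1..n N}"
        by (rule defect_cong) (simp add: E_def)
      ultimately show ?case
        by (simp add: bad_def n_def)
    qed
  qed
qed

text \<open>
  At the critical density itself expected cluster sizes are unbounded. But a fraction of the edges may
  be deleted at will, and the rest is subcritical.
\<close>

lemma csp_defect_AE:
  assumes "0 < \<delta>" and crit: "\<alpha> * real p * (real p - 1) \<le> 1"
  shows "AE \<omega> in M. \<forall>\<^sub>F N in sequentially. real (defect (\<lambda>k. I N k \<omega>) {1..K N \<omega>}) \<le> \<delta> * real N"
proof -
  \<comment> \<open>the first \<open>(\<alpha> - \<gamma>) N\<close> edges are treated as subcritical; at most \<open>2 \<gamma> N + 1\<close> further edges are
    deleted, which together with the defect of the former gives \<open>\<delta> N\<close>\<close>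
  define \<gamma> where "\<gamma> = min (\<delta> / 4) (\<alpha> / 2)"
  have \<gamma>: "0 < \<gamma>" "\<gamma> \<le> \<delta> / 4" "\<gamma> \<le> \<alpha> / 2"
    using assms \<alpha> by (auto simp: \<gamma>_def)
  have pp: "0 < real p * (real p - 1)"
    using p by simp
  have sub: "(\<alpha> - \<gamma>) * (real p * (real p - 1)) < 1"
    using crit mult_pos_pos[OF \<gamma>(1) pp] by (simp add: algebra_simps)
  have e: "\<forall>\<^sub>F N in sequentially. 1 / (\<delta> / 4) \<le> real N"
    using filterlim_real_sequentially by (simp add: filterlim_at_top)
  have d4: "0 < \<delta> / 4" and a0: "0 \<le> \<alpha> - \<gamma>"
    using assms \<gamma> \<alpha> by auto
  from csp_K_AE[OF \<gamma>(1)] csp_prefix_defect_AE[OF d4 a0 sub]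
  show ?thesis
  proof eventually_elim
    case (elim \<omega>)
    from elim e show ?case
    proof eventually_elim
      case (elim N)
      let ?n = "nat \<lfloor>(\<alpha> - \<gamma>) * real N\<rfloor>"
      have n: "(\<alpha> - \<gamma>) * real N - 1 \<le> real ?n"
        by linarith
      have "1 \<le> \<delta> / 4 * real N"
        using elim(3) d4 by (simp only: pos_divide_le_eq mult.commute)
      moreover have "\<gamma> * real N \<le> \<delta> / 4 * real N"
        using \<gamma> by (intro mult_right_mono) auto
      moreover have "real (K N \<omega> - ?n) \<le> max 0 (real (K N \<omega>) - real ?n)"
        by linarith
      moreover have "0 \<le> \<delta> * real N"
        using assms by simp
      ultimately have "real (K N \<omega> - ?n) \<le> 3 * (\<delta> / 4 * real N)"
        using elim(1) n by (simp add: algebra_simps abs_le_iff max_def split: if_splits)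
      moreover have "real (defect (\<lambda>k. I N k \<omega>) {1..K N \<omega>})
          \<le> real (defect (\<lambda>k. I N k \<omega>) {1..?n}) + real (K N \<omega> - ?n)"
        using defect_atLeastAtMost_le[of "\<lambda>k. I N k \<omega>" "K N \<omega>" ?n] by linarith
      ultimately show ?case
        using elim(2) by linarith
    qed
  qed
qed

text \<open>
  The exceptional null set can be chosen independently of \<open>\<delta>\<close>, which is what allows
  the window width \<open>\<epsilon>\<close> to tend to 0 along the reals afterwards.
\<close>

lemma AE_for_all_scales:
  assumes "\<And>\<delta>. 0 < \<delta> \<Longrightarrow> AE \<omega> in M. \<forall>\<^sub>F N in sequentially. f N \<omega> \<le> \<delta> * real N"
  shows "AE \<omega> in M. \<forall>\<delta>>0. \<forall>\<^sub>F N in sequentially. f N \<omega> \<le> \<delta> * real N"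
proof -
  have "AE \<omega> in M. \<forall>m. \<forall>\<^sub>F N in sequentially. f N \<omega> \<le> inverse (real (Suc m)) * real N"
    using assms by (subst AE_all_countable) auto
  then show ?thesis
  proof (rule AE_mp, intro AE_I2 impI allI)
    fix \<omega> and \<delta> :: real
    assume *: "\<forall>m. \<forall>\<^sub>F N in sequentially. f N \<omega> \<le> inverse (real (Suc m)) * real N" and "0 < \<delta>"
    then obtain m where m: "inverse (real (Suc m)) < \<delta>"
      using reals_Archimedean by blast
    show "\<forall>\<^sub>F N in sequentially. f N \<omega> \<le> \<delta> * real N"
      using spec[OF *, of m]
    proof eventually_elim
      case (elim N)
      have "inverse (real (Suc m)) * real N \<le> \<delta> * real N"
        using m by (intro mult_right_mono) auto
      then show ?case
        using elim by linarith
    qed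
  qed
qed

theorem csp_AN_limit:
  assumes crit: "\<alpha> * real p * (real p - 1) \<le> 1" and t: "0 < t" "t < 1" and \<rho>: "0 < \<rho>" "\<rho> < 1"
    and T: "\<And>\<theta>. \<theta> \<in> set_pmf T \<Longrightarrow> \<theta> \<in> constraint_funs p \<and> symmetric_fun p \<theta> \<and>
      avg (cube p) (\<lambda>x. of_bool (\<theta> x = 0)) = \<rho>"
  shows "AE \<omega> in M.
        ((\<lambda>\<epsilon>. limsup (\<lambda>N. \<bar>ereal (1 / real N) *
              log_count (AN N (K N \<omega>) (\<lambda>k. \<Theta> k \<omega>) (\<lambda>k. I N k \<omega>) \<epsilon> t) -
            ereal (ln 2 + \<alpha> * (1 - t) * ln ((1 - \<rho>) / (1 - t)) + \<alpha> * t * ln (\<rho> / t))\<bar>))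
          \<longlongrightarrow> 0) (at_right 0)"
proof -
  have K_AE: "AE \<omega> in M. \<forall>\<delta>>0. \<forall>\<^sub>F N in sequentially. \<bar>real (K N \<omega>) - \<alpha> * real N\<bar> \<le> \<delta> * real N"
    by (intro AE_for_all_scales csp_K_AE)
  have D_AE: "AE \<omega> in M. \<forall>\<delta>>0. \<forall>\<^sub>F N in sequentially. real (defect (\<lambda>k. I N k \<omega>) {1..K N \<omega>}) \<le> \<delta> * real N"
    by (intro AE_for_all_scales csp_defect_AE crit)
  from csp_Theta_AE csp_I_AE K_AE D_AE show ?thesis
  proof eventually_elim
    case (elim \<omega>)
    have "\<forall>\<^sub>F N in sequentially. \<forall>k\<in>{1..}. I N k \<omega> \<in> edges p N"
      using eventually_ge_at_top[of p] by eventually_elim (use elim in auto)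
    then show ?case
      by (rule AN_limit[OF t \<rho> \<alpha>]) (use elim T in auto)
  qed
qed

end

section \<open>Random sums over the cavity space\<close>

lemma distr_pair_snd:
  assumes "prob_space M" "sigma_finite_measure N"
  shows "distr (M \<Otimes>\<^sub>M N) N snd = N"
proof (rule measure_eqI)
  interpret M: prob_space M by fact
  interpret N: sigma_finite_measure N by fact
  fix A assume "A \<in> sets (distr (M \<Otimes>\<^sub>M N) N snd)"
  then have A: "A \<in> sets N"
    by simp
  have "snd -` A \<inter> space (M \<Otimes>\<^sub>M N) = space M \<times> A"
    using sets.sets_into_space[OF A] by (auto simp: space_pair_measure)
  then show "emeasure (distr (M \<Otimes>\<^sub>M N) N snd) A = emeasure N A"
    using A by (simp add: emeasure_distr N.emeasure_pair_measure_Times M.emeasure_space_1)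
qed simp

context
  fixes \<alpha> :: real and p :: nat and T :: "(spin list \<Rightarrow> real) pmf" and \<mu> :: "(spin \<Rightarrow>\<^sub>C real) measure"
  assumes \<alpha>: "0 < \<alpha>" and p: "2 \<le> p" and sets_\<mu>: "sets \<mu> = sets borel" and prob_\<mu>: "prob_space \<mu>"
begin

abbreviation "X_space \<equiv> \<Pi>\<^sub>M k\<in>{1::nat..}. \<mu>"
abbreviation "r_space \<equiv> measure_pmf (poisson_pmf (\<alpha> * real p))"
abbreviation "\<Theta>_space \<equiv> \<Pi>\<^sub>M k\<in>{1::nat..}. measure_pmf T"
abbreviation "C_space \<equiv> cavity_space \<alpha> p T \<mu>"

interpretation XS: prob_space X_space by (intro prob_space_PiM prob_\<mu>)
interpretation TS: prob_space \<Theta>_space by (intro prob_space_PiM measure_pmf.prob_space_axioms)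
interpretation RT: pair_prob_space r_space \<Theta>_space ..
interpretation XRT: pair_prob_space X_space "r_space \<Otimes>\<^sub>M \<Theta>_space" ..

lemma cavity_space_prob: "prob_space C_space"
  unfolding cavity_space_def by (rule XRT.prob_space_axioms)

lemma measurable_cavity_X [measurable]: "k \<in> {1..} \<Longrightarrow> (\<lambda>x. fst x k) \<in> C_space \<rightarrow>\<^sub>M \<mu>"
  unfolding cavity_space_def by measurable

lemma measurable_cavity_r [measurable]: "(\<lambda>x. fst (snd x)) \<in> C_space \<rightarrow>\<^sub>M count_space UNIV"
  unfolding cavity_space_def by measurable

lemma measurable_cavity_Theta [measurable]: "k \<in> {1..} \<Longrightarrow> (\<lambda>x. snd (snd x) k) \<in> C_space \<rightarrow>\<^sub>M measure_pmf T"
  unfolding cavity_space_def by measurable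

lemma measurable_cavity_by_r:
  assumes "\<And>r. (\<lambda>x. f r x) \<in> C_space \<rightarrow>\<^sub>M N"
  shows "(\<lambda>x. f (fst (snd x)) x) \<in> C_space \<rightarrow>\<^sub>M N"
  by (rule measurable_compose_countable'[where I = UNIV and f = f and g = "\<lambda>x. fst (snd x)", OF assms measurable_cavity_r]) simp

lemma AE_cavity_X:
  assumes "AE f in \<mu>. Q f"
  shows "AE x in C_space. \<forall>k\<in>{1..}. Q (fst x k)"
proof -
  have "AE x in C_space. Q (fst x k)" if k: "k \<in> {1..}" for k
  proof (rule AE_distrD[of _ _ \<mu>])
    have "distr C_space X_space fst = X_space"
      unfolding cavity_space_def by (rule RT.P.distr_pair_fst)
    moreover have "distr C_space \<mu> (\<lambda>x. fst x k) = distr (distr C_space X_space fst) \<mu> (\<lambda>X. X k)"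
      using k by (subst distr_distr) (auto simp: o_def cavity_space_def)
    moreover have "distr X_space \<mu> (\<lambda>X. X k) = \<mu>"
      using k by (intro distr_PiM_component prob_\<mu>) auto
    ultimately have "distr C_space \<mu> (\<lambda>x. fst x k) = \<mu>"
      by metis
    then show "AE f in distr C_space \<mu> (\<lambda>x. fst x k). Q f"
      using assms by metis
  qed (use k in \<open>rule measurable_cavity_X\<close>)
  then show ?thesis
    by (subst AE_ball_countable) auto
qed

lemma distr_cavity_snd: "distr C_space (r_space \<Otimes>\<^sub>M \<Theta>_space) snd = r_space \<Otimes>\<^sub>M \<Theta>_space"
  unfolding cavity_space_def
  by (intro distr_pair_snd XS.prob_space_axioms RT.P.sigma_finite_measure_axioms)

lemma distr_r_Theta_snd: "distr (r_space \<Otimes>\<^sub>M \<Theta>_space) \<Theta>_space snd = \<Theta>_space"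
  by (intro distr_pair_snd measure_pmf.prob_space_axioms TS.sigma_finite_measure_axioms)

lemma AE_cavity_Theta:
  shows "AE x in C_space. \<forall>k\<in>{1..}. snd (snd x) k \<in> set_pmf T"
proof -
  have "AE x in C_space. snd (snd x) k \<in> set_pmf T" if k: "k \<in> {1..}" for k
  proof (rule AE_distrD[of _ _ "measure_pmf T"])
    have "distr C_space (measure_pmf T) (\<lambda>x. snd (snd x) k)
        = distr (distr (distr C_space (r_space \<Otimes>\<^sub>M \<Theta>_space) snd) \<Theta>_space snd) (measure_pmf T) (\<lambda>x. x k)"
      using k by (subst distr_distr, simp, simp, subst distr_distr) (auto simp: o_def cavity_space_def)
    also have "\<dots> = measure_pmf T"
      unfolding distr_cavity_snd distr_r_Theta_snd using k
      by (intro distr_PiM_component measure_pmf.prob_space_axioms) auto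
    finally have *: "distr C_space (measure_pmf T) (\<lambda>x. snd (snd x) k) = measure_pmf T" .
    show "AE f in distr C_space (measure_pmf T) (\<lambda>x. snd (snd x) k). f \<in> set_pmf T"
      unfolding * by (simp add: AE_measure_pmf_iff)
  qed (use k in \<open>rule measurable_cavity_Theta\<close>)
  then show ?thesis
    by (subst AE_ball_countable) auto
qed

lemma nn_integral_poisson_mult:
  "(\<integral>\<^sup>+ r. of_nat (r * c) * m \<partial>r_space) = ennreal (\<alpha> * real p * real c) * m"
proof -
  have "(\<integral>\<^sup>+ r. of_nat (r * c) * m \<partial>r_space) = (\<integral>\<^sup>+ r. ennreal (real r) * (ennreal (real c) * m) \<partial>r_space)"
    by (intro nn_integral_cong) (simp add: ennreal_of_nat_eq_real_of_nat ennreal_mult mult.assoc)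
  also have "\<dots> = ennreal (\<alpha> * real p) * (ennreal (real c) * m)"
    using \<alpha> p by (simp add: nn_integral_multc nn_integral_poisson_id)
  also have "\<dots> = ennreal (\<alpha> * real p * real c) * m"
    using \<alpha> by (simp add: ennreal_mult mult.assoc)
  finally show ?thesis .
qed

text \<open>
  Wald's identity: the number of summands is independent of the summands.
\<close>

lemma nn_integral_cavity_X_sum:
  assumes u [measurable]: "u \<in> borel_measurable \<mu>"
  shows "(\<integral>\<^sup>+ x. (\<Sum>k=1..fst (snd x) * c. u (fst x k)) \<partial>C_space)
    = ennreal (\<alpha> * real p * real c) * (\<integral>\<^sup>+ f. u f \<partial>\<mu>)"
proof -
  have meas: "(\<lambda>x. \<Sum>k=1..fst (snd x) * c. u (fst x k)) \<in> borel_measurable C_space"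
    by (intro measurable_cavity_by_r[where f = "\<lambda>r x. \<Sum>k=1..r * c. u (fst x k)"] borel_measurable_sum) simp
  have comp: "(\<integral>\<^sup>+ X. u (X k) \<partial>X_space) = (\<integral>\<^sup>+ f. u f \<partial>\<mu>)" if k: "k \<in> {1..}" for k
    using k by (subst (2) distr_PiM_component[where I = "{1..}" and M = "\<lambda>_. \<mu>" and i = k, symmetric])
               (auto intro: prob_\<mu> simp: nn_integral_distr)
  have "(\<integral>\<^sup>+ x. (\<Sum>k=1..fst (snd x) * c. u (fst x k)) \<partial>C_space)
      = (\<integral>\<^sup>+ y. \<integral>\<^sup>+ X. (\<Sum>k=1..fst y * c. u (X k)) \<partial>X_space \<partial>(r_space \<Otimes>\<^sub>M \<Theta>_space))"
    using meas unfolding cavity_space_def by (subst XRT.nn_integral_snd[symmetric]) auto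
  also have "\<dots> = (\<integral>\<^sup>+ y. of_nat (fst y * c) * (\<integral>\<^sup>+ f. u f \<partial>\<mu>) \<partial>(r_space \<Otimes>\<^sub>M \<Theta>_space))"
  proof (intro nn_integral_cong)
    fix y :: "nat \<times> (nat \<Rightarrow> spin list \<Rightarrow> real)"
    have "(\<integral>\<^sup>+ X. (\<Sum>k=1..fst y * c. u (X k)) \<partial>X_space) = (\<Sum>k=1..fst y * c. \<integral>\<^sup>+ X. u (X k) \<partial>X_space)"
      by (intro nn_integral_sum) auto
    also have "\<dots> = (\<Sum>k=1..fst y * c. \<integral>\<^sup>+ f. u f \<partial>\<mu>)"
      by (intro sum.cong comp) auto
    finally show "(\<integral>\<^sup>+ X. (\<Sum>k=1..fst y * c. u (X k)) \<partial>X_space) = of_nat (fst y * c) * (\<integral>\<^sup>+ f. u f \<partial>\<mu>)"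
      by simp
  qed
  also have "\<dots> = (\<integral>\<^sup>+ r. \<integral>\<^sup>+ \<Theta>. of_nat (r * c) * (\<integral>\<^sup>+ f. u f \<partial>\<mu>) \<partial>\<Theta>_space \<partial>r_space)"
    by (subst TS.nn_integral_fst[symmetric]) auto
  also have "\<dots> = (\<integral>\<^sup>+ r. of_nat (r * c) * (\<integral>\<^sup>+ f. u f \<partial>\<mu>) \<partial>r_space)"
    using TS.emeasure_space_1 by (intro nn_integral_cong) (simp only: nn_integral_const mult_1_right)
  also have "\<dots> = ennreal (\<alpha> * real p * real c) * (\<integral>\<^sup>+ f. u f \<partial>\<mu>)"
    by (rule nn_integral_poisson_mult)
  finally show ?thesis .
qed

lemma nn_integral_cavity_Theta_sum:
  "(\<integral>\<^sup>+ x. (\<Sum>k=1..fst (snd x). u (snd (snd x) k)) \<partial>C_space) = ennreal (\<alpha> * real p) * (\<integral>\<^sup>+ \<theta>. u \<theta> \<partial>measure_pmf T)"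
proof -
  have meas: "(\<lambda>y. \<Sum>k=1..fst y. u (snd y k)) \<in> borel_measurable (r_space \<Otimes>\<^sub>M \<Theta>_space)"
  proof (rule measurable_compose_countable'[where I = UNIV and g = fst and f = "\<lambda>r y. \<Sum>k=1..r. u (snd y k)"])
    fix r
    have "(\<lambda>y. u (snd y k)) \<in> borel_measurable (r_space \<Otimes>\<^sub>M \<Theta>_space)" if "k \<in> {1..r}" for k
    proof -
      have "(\<lambda>y. snd y k) \<in> r_space \<Otimes>\<^sub>M \<Theta>_space \<rightarrow>\<^sub>M measure_pmf T"
        using that by (intro measurable_compose[OF measurable_snd measurable_component_singleton]) auto
      then show ?thesis
        by (rule measurable_compose) simp
    qed
    then show "(\<lambda>y. \<Sum>k=1..r. u (snd y k)) \<in> borel_measurable (r_space \<Otimes>\<^sub>M \<Theta>_space)"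
      by (rule borel_measurable_sum)
  next
    show "fst \<in> r_space \<Otimes>\<^sub>M \<Theta>_space \<rightarrow>\<^sub>M count_space UNIV"
      by measurable
  qed simp
  have comp: "(\<integral>\<^sup>+ \<Theta>. u (\<Theta> k) \<partial>\<Theta>_space) = (\<integral>\<^sup>+ \<theta>. u \<theta> \<partial>measure_pmf T)" if k: "k \<in> {1..}" for k
    using k by (subst (2) distr_PiM_component[where I = "{1..}" and M = "\<lambda>_. measure_pmf T" and i = k, symmetric])
               (auto intro: measure_pmf.prob_space_axioms simp: nn_integral_distr)
  have "(\<integral>\<^sup>+ x. (\<Sum>k=1..fst (snd x). u (snd (snd x) k)) \<partial>C_space)
      = (\<integral>\<^sup>+ y. (\<Sum>k=1..fst y. u (snd y k)) \<partial>(r_space \<Otimes>\<^sub>M \<Theta>_space))"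
    using meas by (subst distr_cavity_snd[symmetric], subst nn_integral_distr) (auto simp: cavity_space_def)
  also have "\<dots> = (\<integral>\<^sup>+ r. \<integral>\<^sup>+ \<Theta>. (\<Sum>k=1..r. u (\<Theta> k)) \<partial>\<Theta>_space \<partial>r_space)"
    using meas by (subst TS.nn_integral_fst[symmetric]) auto
  also have "\<dots> = (\<integral>\<^sup>+ r. of_nat (r * 1) * (\<integral>\<^sup>+ \<theta>. u \<theta> \<partial>measure_pmf T) \<partial>r_space)"
  proof (intro nn_integral_cong)
    fix r :: nat
    have "(\<integral>\<^sup>+ \<Theta>. (\<Sum>k=1..r. u (\<Theta> k)) \<partial>\<Theta>_space) = (\<Sum>k=1..r. \<integral>\<^sup>+ \<Theta>. u (\<Theta> k) \<partial>\<Theta>_space)"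
      by (intro nn_integral_sum measurable_compose[OF measurable_component_singleton]) auto
    also have "\<dots> = (\<Sum>k=1..r. \<integral>\<^sup>+ \<theta>. u \<theta> \<partial>measure_pmf T)"
      by (intro sum.cong comp) auto
    finally show "(\<integral>\<^sup>+ \<Theta>. (\<Sum>k=1..r. u (\<Theta> k)) \<partial>\<Theta>_space) = of_nat (r * 1) * (\<integral>\<^sup>+ \<theta>. u \<theta> \<partial>measure_pmf T)"
      by simp
  qed
  also have "\<dots> = ennreal (\<alpha> * real p) * (\<integral>\<^sup>+ \<theta>. u \<theta> \<partial>measure_pmf T)"
    by (subst nn_integral_poisson_mult) simp
  finally show ?thesis .
qed

lemma integral_cavity_Theta_sum:
  fixes g :: "(spin list \<Rightarrow> real) \<Rightarrow> real"
  assumes fin: "finite (set_pmf T)"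
  shows "(\<integral>x. (\<Sum>k=1..fst (snd x). g (snd (snd x) k)) \<partial>C_space) = \<alpha> * real p * measure_pmf.expectation T g"
proof -
  have meas: "(\<lambda>x. \<Sum>k=1..fst (snd x). u (snd (snd x) k)) \<in> borel_measurable C_space" for u :: "(spin list \<Rightarrow> real) \<Rightarrow> real"
    by (intro measurable_cavity_by_r[where f = "\<lambda>r x. \<Sum>k=1..r. u (snd (snd x) k)"] borel_measurable_sum
        measurable_compose[OF measurable_cavity_Theta]) auto
  have int: "integrable (measure_pmf T) u" for u :: "(spin list \<Rightarrow> real) \<Rightarrow> real"
    using fin by (rule integrable_measure_pmf_finite)
  have nonneg: "has_bochner_integral C_space (\<lambda>x. \<Sum>k=1..fst (snd x). u (snd (snd x) k)) (\<alpha> * real p * measure_pmf.expectation T u)"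
    if u: "\<And>\<theta>. 0 \<le> u \<theta>" for u :: "(spin list \<Rightarrow> real) \<Rightarrow> real"
  proof (rule has_bochner_integral_nn_integral[OF meas])
    show "AE x in C_space. 0 \<le> (\<Sum>k=1..fst (snd x). u (snd (snd x) k))"
      using u by (intro AE_I2 sum_nonneg) auto
    show E: "0 \<le> \<alpha> * real p * measure_pmf.expectation T u"
      using \<alpha> u by (intro mult_nonneg_nonneg integral_nonneg) auto
    have "(\<integral>\<^sup>+ x. ennreal (\<Sum>k=1..fst (snd x). u (snd (snd x) k)) \<partial>C_space)
        = (\<integral>\<^sup>+ x. (\<Sum>k=1..fst (snd x). ennreal (u (snd (snd x) k))) \<partial>C_space)"
      using u by (intro nn_integral_cong) (simp add: sum_ennreal)
    also have "\<dots> = ennreal (\<alpha> * real p) * (\<integral>\<^sup>+ \<theta>. ennreal (u \<theta>) \<partial>measure_pmf T)"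
      by (rule nn_integral_cavity_Theta_sum)
    also have "(\<integral>\<^sup>+ \<theta>. ennreal (u \<theta>) \<partial>measure_pmf T) = ennreal (measure_pmf.expectation T u)"
      using u by (intro nn_integral_eq_integral int) auto
    finally show "(\<integral>\<^sup>+ x. ennreal (\<Sum>k=1..fst (snd x). u (snd (snd x) k)) \<partial>C_space) = ennreal (\<alpha> * real p * measure_pmf.expectation T u)"
      using \<alpha> by (simp add: ennreal_mult')
  qed
  let ?pos = "\<lambda>\<theta>. max (g \<theta>) 0" and ?neg = "\<lambda>\<theta>. max (- g \<theta>) 0"
  have "has_bochner_integral C_space
      (\<lambda>x. (\<Sum>k=1..fst (snd x). ?pos (snd (snd x) k)) - (\<Sum>k=1..fst (snd x). ?neg (snd (snd x) k)))
      (\<alpha> * real p * measure_pmf.expectation T ?pos - \<alpha> * real p * measure_pmf.expectation T ?neg)"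
    by (intro has_bochner_integral_diff nonneg) auto
  moreover have "(\<Sum>k=1..fst (snd x). ?pos (snd (snd x) k)) - (\<Sum>k=1..fst (snd x). ?neg (snd (snd x) k))
      = (\<Sum>k=1..fst (snd x). g (snd (snd x) k))" for x :: "(nat \<Rightarrow> spin \<Rightarrow>\<^sub>C real) \<times> nat \<times> (nat \<Rightarrow> spin list \<Rightarrow> real)"
    unfolding sum_subtractf[symmetric] by (intro sum.cong) auto
  moreover have "\<alpha> * real p * measure_pmf.expectation T ?pos - \<alpha> * real p * measure_pmf.expectation T ?neg
      = \<alpha> * real p * measure_pmf.expectation T g"
  proof -
    have "measure_pmf.expectation T ?pos - measure_pmf.expectation T ?neg = measure_pmf.expectation T (\<lambda>\<theta>. ?pos \<theta> - ?neg \<theta>)"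
      by (rule Bochner_Integration.integral_diff[symmetric]) (rule int)+
    also have "(\<lambda>\<theta>. ?pos \<theta> - ?neg \<theta>) = g"
      by (auto simp: max_def)
    finally show ?thesis
      by (simp add: right_diff_distrib[symmetric])
  qed
  ultimately show ?thesis
    by (simp add: has_bochner_integral_integral_eq)
qed

end

section \<open>The cavity map for symmetric constraints\<close>

text \<open>
  The fields enter the cavity map only through the differences of their two values, since additive
  constants cancel in the quotient. The whole analysis rests on the global flip: by symmetry of the constraints, changing
  the sign of the root amounts to changing the sign of all the arguments of the fields.
\<close>

lemma bracket_eq_avg:
  "bracket \<beta> X n f = avg ({1..n} \<rightarrow>\<^sub>E UNIV) (\<lambda>\<sigma>. f \<sigma> * (\<Prod>k=1..n. exp (\<beta> * apply_bcontfun (X k) (\<sigma> k))))"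
proof -
  have PiE: "PiE_dflt {1..n} undefined (\<lambda>_. UNIV :: spin set) = {1..n} \<rightarrow>\<^sub>E UNIV"
    by (auto simp: PiE_dflt_def PiE_def extensional_def)
  have "Pi_pmf {1..n} undefined (\<lambda>_. \<nu>) = pmf_of_set ({1..n} \<rightarrow>\<^sub>E (UNIV :: spin set))"
    unfolding \<nu>_def PiE[symmetric] by (rule Pi_pmf_of_set) auto
  then show ?thesis
    unfolding bracket_def by (simp add: expectation_pmf_of_set finite_configs configs_nonempty)
qed

lemma expectation_\<nu>: "measure_pmf.expectation \<nu> f = avg UNIV f"
  unfolding \<nu>_def by (rule expectation_pmf_of_set) auto

definition cavity_Z ::
  "nat \<Rightarrow> real \<Rightarrow> (nat \<Rightarrow> spin \<Rightarrow>\<^sub>C real) \<Rightarrow> nat \<Rightarrow> (nat \<Rightarrow> spin list \<Rightarrow> real) \<Rightarrow> spin \<Rightarrow> real"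
  where "cavity_Z p \<beta> X r \<Theta> t = bracket \<beta> X (r * (p - 1)) (\<lambda>\<sigma>. \<E> p \<beta> r \<Theta> \<sigma> t)"

definition cavity_field ::
  "nat \<Rightarrow> real \<Rightarrow> (nat \<Rightarrow> spin \<Rightarrow>\<^sub>C real) \<Rightarrow> nat \<Rightarrow> (nat \<Rightarrow> spin list \<Rightarrow> real) \<Rightarrow> spin \<Rightarrow> real"
  where "cavity_field p \<beta> X r \<Theta> t = 1 / \<beta> * ln (cavity_Z p \<beta> X r \<Theta> t / avg UNIV (cavity_Z p \<beta> X r \<Theta>))"

definition osc :: "(spin \<Rightarrow>\<^sub>C real) \<Rightarrow> real"
  where "osc f = \<bar>apply_bcontfun f 1 - apply_bcontfun f (- 1)\<bar>"

lemma bracket_mean_eq_avg_cavity_Z: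
  "bracket \<beta> X (r * (p - 1)) (\<lambda>\<sigma>. measure_pmf.expectation \<nu> (\<lambda>s. \<E> p \<beta> r \<Theta> \<sigma> s)) = avg UNIV (cavity_Z p \<beta> X r \<Theta>)"
  unfolding cavity_Z_def bracket_eq_avg expectation_\<nu> avg_multc[symmetric] by (rule avg_swap)

lemma avg_UNIV_spin: "avg UNIV f = (f 1 + f (- 1)) / 2" for f :: "spin \<Rightarrow> real"
  unfolding avg_def card_UNIV_spin unfolding UNIV_spin using one_neq_minus_one_spin by simp

lemma cavity_Z_pos: "0 < cavity_Z p \<beta> X r \<Theta> t"
  unfolding cavity_Z_def bracket_eq_avg \<E>_def
  by (intro avg_pos finite_configs configs_nonempty mult_pos_pos prod_pos) auto

lemma cavity_Z_nonzero [simp]: "cavity_Z p \<beta> X r \<Theta> t \<noteq> 0"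
  using cavity_Z_pos[of p \<beta> X r \<Theta> t] by simp

lemma apply_diff_le_osc: "apply_bcontfun f s - apply_bcontfun f (- s) \<le> osc f"
  using spin_cases[of s] by (auto simp: osc_def)

lemma osc_attained: "\<exists>s. apply_bcontfun f s - apply_bcontfun f (- s) = - osc f"
proof (cases "apply_bcontfun f 1 \<le> apply_bcontfun f (- 1)")
  case True
  then show ?thesis
    by (intro exI[of _ 1]) (simp add: osc_def)
next
  case False
  then show ?thesis
    by (intro exI[of _ "- 1"]) (simp add: osc_def)
qed

lemma avg_strict_mono:
  assumes "finite S" "\<And>x. x \<in> S \<Longrightarrow> f x \<le> g x" "x0 \<in> S" "f x0 < g x0"
  shows "avg S f < avg S g"
proof -
  have "0 < card S"
    using assms by (auto simp: card_gt_0_iff)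
  moreover have "sum f S < sum g S"
    using assms by (intro sum_strict_mono_ex1) auto
  ultimately show ?thesis
    by (simp add: avg_def divide_strict_right_mono)
qed

context
  fixes p r :: nat and \<beta> :: real and \<Theta> :: "nat \<Rightarrow> spin list \<Rightarrow> real"
  assumes p: "2 \<le> p" and \<beta>: "0 < \<beta>" and sym: "\<And>k. k \<in> {1..r} \<Longrightarrow> symmetric_fun p (\<Theta> k)"
begin

lemma block_subset:
  assumes "k \<in> {1..r}" "v \<in> set [(k - 1) * (p - 1) + 1 ..< k * (p - 1) + 1]"
  shows "v \<in> {1..r * (p - 1)}"
proof -
  have "k * (p - 1) \<le> r * (p - 1)"
    using assms by (intro mult_right_mono) auto
  moreover have "1 \<le> v \<and> v < k * (p - 1) + 1"
    using assms(2) unfolding set_upt atLeastLessThan_iff by linarith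
  ultimately show ?thesis
    unfolding atLeastAtMost_iff by linarith
qed

lemma length_block:
  assumes "k \<in> {1..r}"
  shows "length [(k - 1) * (p - 1) + 1 ..< k * (p - 1) + 1] = p - 1"
proof -
  obtain j where "k = Suc j"
    using assms by (cases k) auto
  then have "k * (p - 1) = (k - 1) * (p - 1) + (p - 1)"
    by simp
  then show ?thesis
    unfolding length_upt by linarith
qed

text \<open>
  The restriction to the vertices of the blocks keeps the flipped assignment extensional.
\<close>

lemma \<E>_flip: "\<E> p \<beta> r \<Theta> (\<lambda>v\<in>{1..r * (p - 1)}. - \<sigma> v) (- t) = \<E> p \<beta> r \<Theta> \<sigma> t"
proof -
  have "\<Theta> k (map (\<lambda>v\<in>{1..r * (p - 1)}. - \<sigma> v) [(k - 1) * (p - 1) + 1 ..< k * (p - 1) + 1] @ [- t])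
      = \<Theta> k (map \<sigma> [(k - 1) * (p - 1) + 1 ..< k * (p - 1) + 1] @ [t])" if k: "k \<in> {1..r}" for k
  proof -
    let ?b = "[(k - 1) * (p - 1) + 1 ..< k * (p - 1) + 1]"
    have "map (\<lambda>v\<in>{1..r * (p - 1)}. - \<sigma> v) ?b = map (\<lambda>v. - \<sigma> v) ?b"
    proof (rule map_cong[OF refl])
      fix v assume "v \<in> set ?b"
      from block_subset[OF k this] show "(\<lambda>v\<in>{1..r * (p - 1)}. - \<sigma> v) v = - \<sigma> v"
        by simp
    qed
    then have "map (\<lambda>v\<in>{1..r * (p - 1)}. - \<sigma> v) ?b @ [- t] = map uminus (map \<sigma> ?b @ [t])"
      by simp
    moreover have "map \<sigma> ?b @ [t] \<in> cube p"
      using length_block[OF k] p by (simp add: cube_def)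
    ultimately show ?thesis
      using sym[OF k] unfolding symmetric_fun_def by metis
  qed
  then show ?thesis
    unfolding \<E>_def by simp
qed

lemma cavity_Z_flip:
  "cavity_Z p \<beta> X r \<Theta> (- t) = avg ({1..r * (p - 1)} \<rightarrow>\<^sub>E UNIV)
    (\<lambda>\<sigma>. \<E> p \<beta> r \<Theta> \<sigma> t * (\<Prod>k=1..r * (p - 1). exp (\<beta> * apply_bcontfun (X k) (- \<sigma> k))))"
proof -
  let ?V = "{1..r * (p - 1)}"
  let ?g = "\<lambda>\<sigma>. \<lambda>v\<in>?V. - \<sigma> v"
  have bij: "bij_betw ?g (?V \<rightarrow>\<^sub>E UNIV) (?V \<rightarrow>\<^sub>E (UNIV :: spin set))"
    by (rule bij_betw_byWitness[where f' = ?g]) (auto simp: fun_eq_iff PiE_def extensional_def)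
  show ?thesis
    unfolding cavity_Z_def bracket_eq_avg
    by (subst avg_bij[OF bij, symmetric], rule avg_cong) (simp only: \<E>_flip, simp)
qed

lemma weight_ratio:
  fixes n :: nat
  assumes "\<And>k. k \<in> {1..n} \<Longrightarrow> apply_bcontfun (X k) (\<sigma> k) - apply_bcontfun (X k) (- \<sigma> k) \<le> h k"
  shows "(\<Prod>k=1..n. exp (\<beta> * apply_bcontfun (X k) (\<sigma> k)))
    \<le> exp (\<beta> * (\<Sum>k=1..n. h k)) * (\<Prod>k=1..n. exp (\<beta> * apply_bcontfun (X k) (- \<sigma> k)))"
proof -
  have "(\<Prod>k=1..n. exp (\<beta> * apply_bcontfun (X k) (\<sigma> k)))
      \<le> (\<Prod>k=1..n. exp (\<beta> * h k) * exp (\<beta> * apply_bcontfun (X k) (- \<sigma> k)))"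
  proof (rule prod_mono)
    fix k assume k: "k \<in> {1..n}"
    have "\<beta> * apply_bcontfun (X k) (\<sigma> k) \<le> \<beta> * (h k + apply_bcontfun (X k) (- \<sigma> k))"
      using assms[OF k] \<beta> by (intro mult_left_mono) auto
    then show "0 \<le> exp (\<beta> * apply_bcontfun (X k) (\<sigma> k)) \<and>
        exp (\<beta> * apply_bcontfun (X k) (\<sigma> k)) \<le> exp (\<beta> * h k) * exp (\<beta> * apply_bcontfun (X k) (- \<sigma> k))"
      by (simp add: exp_add[symmetric] distrib_left)
  qed
  moreover have "exp (\<beta> * (\<Sum>k=1..n. h k)) = (\<Prod>k=1..n. exp (\<beta> * h k))"
    unfolding sum_distrib_left by (rule exp_sum) simp
  ultimately show ?thesis
    by (simp only: prod.distrib)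
qed

text \<open>
  After the global flip, the two sides differ only in the weights of the fields, and the ratio of the
  weights of an assignment is bounded by the exponential of the total oscillation.
\<close>

lemma cavity_Z_le: "cavity_Z p \<beta> X r \<Theta> t \<le> exp (\<beta> * (\<Sum>k=1..r * (p - 1). osc (X k))) * cavity_Z p \<beta> X r \<Theta> (- t)"
  unfolding cavity_Z_flip unfolding cavity_Z_def bracket_eq_avg avg_cmult[symmetric]
proof (rule avg_mono)
  fix \<sigma> :: "nat \<Rightarrow> spin"
  have "\<E> p \<beta> r \<Theta> \<sigma> t * (\<Prod>k=1..r * (p - 1). exp (\<beta> * apply_bcontfun (X k) (\<sigma> k)))
      \<le> \<E> p \<beta> r \<Theta> \<sigma> t * (exp (\<beta> * (\<Sum>k=1..r * (p - 1). osc (X k))) *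
        (\<Prod>k=1..r * (p - 1). exp (\<beta> * apply_bcontfun (X k) (- \<sigma> k))))"
    by (intro mult_left_mono weight_ratio apply_diff_le_osc) (simp add: \<E>_def)
  then show "\<E> p \<beta> r \<Theta> \<sigma> t * (\<Prod>k=1..r * (p - 1). exp (\<beta> * apply_bcontfun (X k) (\<sigma> k)))
      \<le> exp (\<beta> * (\<Sum>k=1..r * (p - 1). osc (X k))) *
        (\<E> p \<beta> r \<Theta> \<sigma> t * (\<Prod>k=1..r * (p - 1). exp (\<beta> * apply_bcontfun (X k) (- \<sigma> k))))"
    by (simp only: mult.left_commute)
qed

text \<open>
  At the assignment that minimises every field, the ratio of the weights is the inverse of its upper
  bound. This strictness is what excludes further fixed points at the critical density.
\<close>

lemma cavity_Z_less:
  assumes H: "0 < (\<Sum>k=1..r * (p - 1). osc (X k))" (is "0 < ?H")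
  shows "cavity_Z p \<beta> X r \<Theta> t < exp (\<beta> * (\<Sum>k=1..r * (p - 1). osc (X k))) * cavity_Z p \<beta> X r \<Theta> (- t)"
proof -
  let ?n = "r * (p - 1)"
  let ?W = "\<lambda>\<sigma>. \<Prod>k=1..?n. exp (\<beta> * apply_bcontfun (X k) (\<sigma> k))" and ?W' = "\<lambda>\<sigma>. \<Prod>k=1..?n. exp (\<beta> * apply_bcontfun (X k) (- \<sigma> k))"
  obtain s where s: "\<And>k. apply_bcontfun (X k) (s k) - apply_bcontfun (X k) (- s k) = - osc (X k)"
    using choice[of "\<lambda>k s. apply_bcontfun (X k) s - apply_bcontfun (X k) (- s) = - osc (X k)"] osc_attained
    by blast
  define \<sigma>0 where "\<sigma>0 = (\<lambda>v\<in>{1..?n}. s v)"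
  have "?W \<sigma>0 \<le> exp (\<beta> * (\<Sum>k=1..?n. - osc (X k))) * ?W' \<sigma>0"
    using s by (intro weight_ratio) (simp add: \<sigma>0_def)
  also have "\<dots> < exp (\<beta> * ?H) * ?W' \<sigma>0"
    using mult_pos_pos[OF \<beta> H] by (intro mult_strict_right_mono prod_pos) (auto simp: sum_negf)
  finally have strict: "?W \<sigma>0 < exp (\<beta> * ?H) * ?W' \<sigma>0" .
  show ?thesis
    unfolding cavity_Z_flip unfolding cavity_Z_def bracket_eq_avg avg_cmult[symmetric] mult.left_commute[of "exp _"]
  proof (rule avg_strict_mono)
    show "finite ({1..?n} \<rightarrow>\<^sub>E (UNIV :: spin set))"
      by (rule finite_configs) simp
    show "\<sigma>0 \<in> {1..?n} \<rightarrow>\<^sub>E UNIV"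
      by (simp add: \<sigma>0_def)
    show "\<E> p \<beta> r \<Theta> \<sigma> t * ?W \<sigma> \<le> \<E> p \<beta> r \<Theta> \<sigma> t * (exp (\<beta> * ?H) * ?W' \<sigma>)" for \<sigma>
      by (intro mult_left_mono weight_ratio apply_diff_le_osc) (simp add: \<E>_def)
    show "\<E> p \<beta> r \<Theta> \<sigma>0 t * ?W \<sigma>0 < \<E> p \<beta> r \<Theta> \<sigma>0 t * (exp (\<beta> * ?H) * ?W' \<sigma>0)"
      using strict by (intro mult_strict_left_mono) (auto simp: \<E>_def)
  qed
qed

lemma osc_cavity_field:
  "osc (Bcontfun (cavity_field p \<beta> X r \<Theta>)) = 1 / \<beta> * \<bar>ln (cavity_Z p \<beta> X r \<Theta> 1) - ln (cavity_Z p \<beta> X r \<Theta> (- 1))\<bar>"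
proof -
  have "0 < avg UNIV (cavity_Z p \<beta> X r \<Theta>)"
    by (intro avg_pos cavity_Z_pos) auto
  then have "cavity_field p \<beta> X r \<Theta> 1 - cavity_field p \<beta> X r \<Theta> (- 1)
      = 1 / \<beta> * (ln (cavity_Z p \<beta> X r \<Theta> 1) - ln (cavity_Z p \<beta> X r \<Theta> (- 1)))"
    unfolding cavity_field_def by (simp add: ln_div right_diff_distrib diff_divide_distrib)
  then show ?thesis
    using \<beta> by (simp add: osc_def abs_mult)
qed

lemma osc_cavity_field_le: "osc (Bcontfun (cavity_field p \<beta> X r \<Theta>)) \<le> (\<Sum>k=1..r * (p - 1). osc (X k))"
proof -
  let ?Z = "cavity_Z p \<beta> X r \<Theta>" and ?H = "\<Sum>k=1..r * (p - 1). osc (X k)"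
  have "ln (?Z t) - ln (?Z (- t)) \<le> \<beta> * ?H" for t
  proof -
    have "ln (?Z t) \<le> ln (exp (\<beta> * ?H) * ?Z (- t))"
      using cavity_Z_le[of X t] cavity_Z_pos by (subst ln_le_cancel_iff) auto
    then show ?thesis
      by (simp add: ln_mult)
  qed
  from this[of 1] this[of "- 1"] have "\<bar>ln (?Z 1) - ln (?Z (- 1))\<bar> \<le> \<beta> * ?H"
    by (simp add: abs_le_iff)
  then show ?thesis
    unfolding osc_cavity_field using \<beta> by (simp add: divide_le_eq mult.commute)
qed

lemma osc_cavity_field_less:
  assumes H: "0 < (\<Sum>k=1..r * (p - 1). osc (X k))"
  shows "osc (Bcontfun (cavity_field p \<beta> X r \<Theta>)) < (\<Sum>k=1..r * (p - 1). osc (X k))"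
proof -
  let ?Z = "cavity_Z p \<beta> X r \<Theta>" and ?H = "\<Sum>k=1..r * (p - 1). osc (X k)"
  have "ln (?Z t) - ln (?Z (- t)) < \<beta> * ?H" for t
  proof -
    have "ln (?Z t) < ln (exp (\<beta> * ?H) * ?Z (- t))"
      using cavity_Z_less[OF H, of t] cavity_Z_pos by (subst ln_less_cancel_iff) auto
    then show ?thesis
      by (simp add: ln_mult)
  qed
  from this[of 1] this[of "- 1"] have "\<bar>ln (?Z 1) - ln (?Z (- 1))\<bar> < \<beta> * ?H"
    by (simp add: abs_less_iff)
  then show ?thesis
    unfolding osc_cavity_field using \<beta> by (simp add: divide_less_eq mult.commute)
qed

lemma cavity_field_eq_0:
  assumes "(\<Sum>k=1..r * (p - 1). osc (X k)) = 0"
  shows "Bcontfun (cavity_field p \<beta> X r \<Theta>) = 0"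
proof -
  have "cavity_Z p \<beta> X r \<Theta> 1 = cavity_Z p \<beta> X r \<Theta> (- 1)"
    using cavity_Z_le[of X 1] cavity_Z_le[of X "- 1"] assms by simp
  then have "cavity_Z p \<beta> X r \<Theta> t = avg UNIV (cavity_Z p \<beta> X r \<Theta>)" for t
    using spin_cases[of t] by (auto simp: avg_UNIV_spin)
  then have "cavity_field p \<beta> X r \<Theta> t = 0" for t
    unfolding cavity_field_def by (metis cavity_Z_pos divide_self ln_one mult_zero_right less_irrefl)
  then show ?thesis
    by (intro bcontfun_eqI) simp
qed

text \<open>
  The cavity graph is a star: the blocks are disjoint, and vertex 0 stands for the spin of the
  root.
\<close>

lemma hyperforest_star: "hyperforest (\<lambda>k. [(k - 1) * (p - 1) + 1 ..< k * (p - 1) + 1] @ [0]) {1..r}"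
proof -
  let ?b = "\<lambda>k. [(k - 1) * (p - 1) + 1 ..< k * (p - 1) + 1]"
  let ?e = "\<lambda>k. ?b k @ [0]"
  have iso: "(v, w) \<notin> conn ?e {j\<in>{1..r}. j < k}" if v: "v \<in> set (?b k)" and vw: "v \<noteq> w" for v w k
  proof
    assume "(v, w) \<in> conn ?e {j\<in>{1..r}. j < k}"
    then obtain u where "(v, u) \<in> adj ?e {j\<in>{1..r}. j < k}"
      using vw unfolding conn_def by (meson converse_rtranclE)
    then obtain j where j: "j < k" "v \<in> set (?e j)"
      by (auto simp: adj_def)
    have "j * (p - 1) \<le> (k - 1) * (p - 1)"
      using j by (intro mult_right_mono) auto
    moreover have "(k - 1) * (p - 1) + 1 \<le> v"
      using v unfolding set_upt atLeastLessThan_iff by linarith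
    moreover have "v = 0 \<or> v < j * (p - 1) + 1"
      using j(2) unfolding set_append set_upt Un_iff atLeastLessThan_iff by auto
    ultimately show False
      by linarith
  qed
  show ?thesis
    unfolding hyperforest_def
  proof (intro ballI impI)
    fix k a b assume *: "k \<in> {1..r}" "a \<in> set (?e k)" "b \<in> set (?e k)" "a \<noteq> b"
    consider "a \<in> set (?b k)" | "b \<in> set (?b k)"
      using * by auto
    then show "(a, b) \<notin> conn ?e {j \<in> {1..r}. j < k}"
    proof cases
      case 1
      then show ?thesis
        using * by (intro iso) auto
    next
      case 2
      then show ?thesis
        using iso[OF 2, of a] *(4) conn_sym[of a b] by blast
    qed
  qed
qed

lemma avg_cavity_Z_0:
  assumes X: "\<And>k. k \<in> {1..} \<Longrightarrow> X k = 0"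
  shows "avg UNIV (cavity_Z p \<beta> X r \<Theta>) = (\<Prod>k=1..r. avg (cube p) (\<lambda>x. exp (\<beta> * \<Theta> k x)))"
proof -
  let ?n = "r * (p - 1)" and ?b = "\<lambda>k. [(k - 1) * (p - 1) + 1 ..< k * (p - 1) + 1]"
  have V: "insert 0 {1..?n} = {0..?n}"
    by auto
  have "cavity_Z p \<beta> X r \<Theta> t = avg ({1..?n} \<rightarrow>\<^sub>E UNIV) (\<lambda>\<sigma>. \<Prod>k=1..r. exp (\<beta> * \<Theta> k (map (\<sigma>(0 := t)) (?b k @ [0]))))" for t
    unfolding cavity_Z_def bracket_eq_avg
  proof (rule avg_cong)
    fix \<sigma> :: "nat \<Rightarrow> spin"
    have "(\<Prod>k=1..?n. exp (\<beta> * apply_bcontfun (X k) (\<sigma> k))) = 1"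
      using X by (intro prod.neutral) auto
    moreover have "map (\<sigma>(0 := t)) (?b k @ [0]) = map \<sigma> (?b k) @ [t]" for k
      by auto
    ultimately show "\<E> p \<beta> r \<Theta> \<sigma> t * (\<Prod>k=1..?n. exp (\<beta> * apply_bcontfun (X k) (\<sigma> k)))
        = (\<Prod>k=1..r. exp (\<beta> * \<Theta> k (map (\<sigma>(0 := t)) (?b k @ [0]))))"
      unfolding \<E>_def by (simp only: sum_distrib_left exp_sum finite_atLeastAtMost mult_1_right)
  qed
  then have "avg UNIV (cavity_Z p \<beta> X r \<Theta>)
      = avg UNIV (\<lambda>t. avg ({1..?n} \<rightarrow>\<^sub>E UNIV) (\<lambda>\<sigma>. \<Prod>k=1..r. exp (\<beta> * \<Theta> k (map (\<sigma>(0 := t)) (?b k @ [0])))))"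
    by (rule avg_cong)
  also have "\<dots> = avg (insert 0 {1..?n} \<rightarrow>\<^sub>E UNIV) (\<lambda>\<sigma>. \<Prod>k=1..r. exp (\<beta> * \<Theta> k (map \<sigma> (?b k @ [0]))))"
    by (rule avg_PiE_insert[symmetric]) auto
  also have "\<dots> = avg ({0..?n} \<rightarrow>\<^sub>E UNIV) (\<lambda>\<sigma>. \<Prod>k=1..r. (\<lambda>k x. exp (\<beta> * \<Theta> k x)) k (map \<sigma> ((\<lambda>k. ?b k @ [0]) k)))"
    unfolding V ..
  also have "\<dots> = (\<Prod>k=1..r. avg (cube p) (\<lambda>x. exp (\<beta> * \<Theta> k x)))"
  proof (rule avg_prod_hyperforest[OF _ _ hyperforest_star])
    fix k assume k: "k \<in> {1..r}"
    show "symmetric_fun p (\<lambda>x. exp (\<beta> * \<Theta> k x))"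
      using sym[OF k] by (simp add: symmetric_fun_def)
    have "set (?b k) \<subseteq> {0..?n}"
      using block_subset[OF k] by fastforce
    then show "distinct (?b k @ [0]) \<and> length (?b k @ [0]) = p \<and> set (?b k @ [0]) \<subseteq> {0..?n}"
      using length_block[OF k] p by (auto simp del: upt_Suc)
  qed auto
  finally show ?thesis .
qed

end

section \<open>The fixed point and the function F\<close>

context
  fixes \<alpha> \<beta> :: real and p :: nat and T :: "(spin list \<Rightarrow> real) pmf"
  assumes \<alpha>: "0 < \<alpha>" and p: "2 \<le> p" and \<beta>: "0 < \<beta>" and crit: "\<alpha> * real p * (real p - 1) \<le> 1"
    and fin: "finite (set_pmf T)" and sym: "\<And>\<theta>. \<theta> \<in> set_pmf T \<Longrightarrow> symmetric_fun p \<theta>"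
begin

abbreviation "cavity_image x \<equiv> Bcontfun (cavity_field p \<beta> (fst x) (fst (snd x)) (snd (snd x)))"

lemma \<T>_eq: "\<T> \<alpha> p T \<beta> \<mu> = distr (cavity_space \<alpha> p T \<mu>) borel (\<lambda>x. cavity_image x)"
  unfolding \<T>_def cavity_field_def cavity_Z_def[symmetric] bracket_mean_eq_avg_cavity_Z case_prod_beta ..

lemma continuous_apply_bcontfun: "continuous_on UNIV (\<lambda>f. apply_bcontfun f s)"
  by (rule lipschitz_on_continuous_on[where L = 1]) (auto intro!: lipschitz_onI dist_bounded)

lemma measurable_apply_bcontfun: "(\<lambda>f. apply_bcontfun f s) \<in> borel_measurable borel"
  by (rule borel_measurable_continuous_onI[OF continuous_apply_bcontfun])

text \<open>
  A function on two points is a linear combination of two fixed functions, so the map from its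
  values to the function is continuous.
\<close>

lemma borel_measurable_Bcontfun:
  assumes "\<And>s. (\<lambda>x. g x s) \<in> borel_measurable M"
  shows "(\<lambda>x. Bcontfun (g x) :: spin \<Rightarrow>\<^sub>C real) \<in> borel_measurable M"
proof -
  let ?e = "\<lambda>s. Bcontfun (\<lambda>t. if t = s then 1 else 0) :: spin \<Rightarrow>\<^sub>C real"
  have eq: "Bcontfun f = f 1 *\<^sub>R ?e 1 + f (- 1) *\<^sub>R ?e (- 1)" for f
  proof (rule bcontfun_eqI)
    show "apply_bcontfun (Bcontfun f) t = apply_bcontfun (f 1 *\<^sub>R ?e 1 + f (- 1) *\<^sub>R ?e (- 1)) t" for t
      using spin_cases[of t] one_neq_minus_one_spin by auto
  qed
  have decomp: "(\<lambda>x. Bcontfun (g x)) = (\<lambda>y. fst y *\<^sub>R ?e 1 + snd y *\<^sub>R ?e (- 1)) \<circ> (\<lambda>x. (g x 1, g x (- 1)))"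
    unfolding comp_def fst_conv snd_conv by (rule ext, rule eq)
  have m1: "(\<lambda>y. fst y *\<^sub>R ?e 1 + snd y *\<^sub>R ?e (- 1)) \<in> borel_measurable (borel :: (real \<times> real) measure)"
    by (intro borel_measurable_continuous_onI continuous_intros)
  have m2: "(\<lambda>x. (g x 1, g x (- 1))) \<in> M \<rightarrow>\<^sub>M (borel :: (real \<times> real) measure)"
    using assms by (intro borel_measurable_Pair) auto
  show ?thesis
    unfolding decomp by (rule measurable_comp[OF m2 m1])
qed

lemma borel_measurable_osc: "osc \<in> borel_measurable borel"
  unfolding osc_def[abs_def]
  by (intro borel_measurable_abs borel_measurable_diff measurable_apply_bcontfun)

lemma osc_nonneg: "0 \<le> osc f"
  by (simp add: osc_def)

context
  fixes \<mu> :: "(spin \<Rightarrow>\<^sub>C real) measure"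
  assumes \<mu>: "sets \<mu> = sets borel" "prob_space \<mu>"
begin

abbreviation "Cs \<equiv> cavity_space \<alpha> p T \<mu>"

lemma measurable_cavity_Z: "(\<lambda>x. cavity_Z p \<beta> (fst x) (fst (snd x)) (snd (snd x)) t) \<in> borel_measurable Cs"
proof (rule measurable_cavity_by_r[OF \<alpha> p \<mu>, where f = "\<lambda>r x. cavity_Z p \<beta> (fst x) r (snd (snd x)) t"])
  fix r
  have X: "(\<lambda>x. apply_bcontfun (fst x k) s) \<in> borel_measurable Cs" if "k \<in> {1..}" for k s
    using that measurable_apply_bcontfun[of s] \<mu>(1)
    by (intro measurable_compose[OF measurable_cavity_X[OF \<alpha> p \<mu>]]) (auto cong: measurable_cong_sets)
  have Th: "(\<lambda>x. snd (snd x) k L) \<in> borel_measurable Cs" if "k \<in> {1..}" for k L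
    using that by (intro measurable_compose[OF measurable_cavity_Theta[OF \<alpha> p \<mu>]]) auto
  show "(\<lambda>x. cavity_Z p \<beta> (fst x) r (snd (snd x)) t) \<in> borel_measurable Cs"
    unfolding cavity_Z_def bracket_eq_avg avg_def \<E>_def
    by (intro borel_measurable_divide borel_measurable_sum borel_measurable_times borel_measurable_prod
        borel_measurable_const measurable_compose[OF _ borel_measurable_exp] X Th) auto
qed

lemma measurable_cavity_image: "(\<lambda>x. cavity_image x) \<in> borel_measurable Cs"
proof (rule borel_measurable_Bcontfun)
  have "(\<lambda>x. avg UNIV (cavity_Z p \<beta> (fst x) (fst (snd x)) (snd (snd x)))) \<in> borel_measurable Cs"
    unfolding avg_UNIV_spin by (intro borel_measurable_divide borel_measurable_add measurable_cavity_Z) simp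
  then show "(\<lambda>x. cavity_field p \<beta> (fst x) (fst (snd x)) (snd (snd x)) s) \<in> borel_measurable Cs" for s
    unfolding cavity_field_def
    by (intro borel_measurable_times borel_measurable_ln borel_measurable_divide measurable_cavity_Z) auto
qed

abbreviation "total_osc x \<equiv> (\<Sum>k=1..fst (snd x) * (p - 1). osc (fst x k))"

text \<open>
  Under the measure concentrated at the zero field this says that it is a fixed point; for an arbitrary
  fixed point it is the last step of the proof of uniqueness.
\<close>

lemma AE_cavity_image_0:
  assumes "AE x in Cs. total_osc x = 0"
  shows "\<T> \<alpha> p T \<beta> \<mu> = return borel 0"
proof -
  have "AE x in Cs. cavity_image x = 0"
    using assms AE_cavity_Theta[OF \<alpha> p \<mu>, of T]
  proof eventually_elim
    case (elim x)
    then show ?case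
      using sym by (intro cavity_field_eq_0[OF p \<beta>]) auto
  qed
  then have "\<T> \<alpha> p T \<beta> \<mu> = distr Cs borel (\<lambda>x. 0)"
    unfolding \<T>_eq by (intro distr_cong_AE refl measurable_cavity_image) auto
  also have "\<dots> = return borel 0"
  proof -
    interpret prob_space Cs
      by (rule cavity_space_prob[OF \<alpha> p \<mu>])
    show ?thesis
      by (intro measure_eqI) (auto simp: emeasure_distr emeasure_space_1 indicator_def)
  qed
  finally show ?thesis .
qed

text \<open>
  A new field oscillates at most as much as all the fields it is made of together. Their mean total
  oscillation is \<open>\<alpha> p (p - 1)\<close> times that of one field, hence at most the latter. For a fixed point
  there is equality in the mean, and therefore almost surely; by strictness of the bound the total
  oscillation vanishes.
\<close>

lemma fixed_point_imp_0:
  assumes int: "integrable \<mu> norm" and fixed: "\<T> \<alpha> p T \<beta> \<mu> = \<mu>"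
  shows "\<mu> = return borel 0"
proof -
  let ?m = "\<integral>\<^sup>+ f. ennreal (osc f) \<partial>\<mu>"
  have osc_\<mu>: "(\<lambda>f. ennreal (osc f)) \<in> borel_measurable \<mu>"
    using borel_measurable_osc \<mu>(1) by (auto cong: measurable_cong_sets)
  have m_fin: "?m < \<infinity>"
  proof -
    have "?m \<le> (\<integral>\<^sup>+ f. ennreal (2 * norm f) \<partial>\<mu>)"
    proof (intro nn_integral_mono ennreal_leI)
      fix f :: "spin \<Rightarrow>\<^sub>C real"
      show "osc f \<le> 2 * norm f"
        using norm_bounded[of f 1] norm_bounded[of f "- 1"] unfolding osc_def by simp
    qed
    also have "\<dots> < \<infinity>"
    proof -
      have "integrable \<mu> (\<lambda>f. 2 * norm f)"
        using int by simp
      then show ?thesis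
        unfolding integrable_iff_bounded by simp
    qed
    finally show ?thesis .
  qed
  have image_eq: "(\<integral>\<^sup>+ x. ennreal (osc (cavity_image x)) \<partial>Cs) = ?m"
  proof -
    have "?m = (\<integral>\<^sup>+ f. ennreal (osc f) \<partial>distr Cs borel (\<lambda>x. cavity_image x))"
      using fixed unfolding \<T>_eq by simp
    also have "\<dots> = (\<integral>\<^sup>+ x. ennreal (osc (cavity_image x)) \<partial>Cs)"
      using borel_measurable_osc by (intro nn_integral_distr measurable_cavity_image) auto
    finally show ?thesis ..
  qed
  have "(\<integral>\<^sup>+ x. ennreal (total_osc x) \<partial>Cs) = (\<integral>\<^sup>+ x. (\<Sum>k=1..fst (snd x) * (p - 1). ennreal (osc (fst x k))) \<partial>Cs)"
    by (intro nn_integral_cong) (simp add: sum_ennreal osc_nonneg)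
  also have "\<dots> = ennreal (\<alpha> * real p * real (p - 1)) * ?m"
    by (rule nn_integral_cavity_X_sum[OF \<alpha> p \<mu> osc_\<mu>])
  also have "\<dots> \<le> 1 * ?m"
    using crit p by (intro mult_right_mono) (auto simp: of_nat_diff)
  finally have total_le: "(\<integral>\<^sup>+ x. ennreal (total_osc x) \<partial>Cs) \<le> ?m"
    by simp
  have total_meas: "(\<lambda>x. ennreal (total_osc x)) \<in> borel_measurable Cs"
  proof (rule measurable_cavity_by_r[OF \<alpha> p \<mu>, where f = "\<lambda>r x. ennreal (\<Sum>k=1..r * (p - 1). osc (fst x k))"])
    fix r
    have "(\<lambda>x. osc (fst x k)) \<in> borel_measurable Cs" if "k \<in> {1..}" for k
      using that borel_measurable_osc \<mu>(1)
      by (intro measurable_compose[OF measurable_cavity_X[OF \<alpha> p \<mu>]]) (auto cong: measurable_cong_sets)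
    then show "(\<lambda>x. ennreal (\<Sum>k=1..r * (p - 1). osc (fst x k))) \<in> borel_measurable Cs"
      by (intro measurable_compose[OF _ measurable_ennreal] borel_measurable_sum) auto
  qed
  have image_meas: "(\<lambda>x. ennreal (osc (cavity_image x))) \<in> borel_measurable Cs"
    by (intro measurable_compose[OF _ measurable_ennreal] measurable_compose[OF measurable_cavity_image borel_measurable_osc])
  have le: "AE x in Cs. ennreal (osc (cavity_image x)) \<le> ennreal (total_osc x)"
    using AE_cavity_Theta[OF \<alpha> p \<mu>, of T]
  proof eventually_elim
    case (elim x)
    then show ?case
      using sym by (intro ennreal_leI osc_cavity_field_le[OF p \<beta>]) auto
  qed
  have ge: "AE x in Cs. ennreal (total_osc x) \<le> ennreal (osc (cavity_image x))"
  proof (rule ccontr)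
    assume "\<not> ?thesis"
    then have "(\<integral>\<^sup>+ x. ennreal (osc (cavity_image x)) \<partial>Cs) < (\<integral>\<^sup>+ x. ennreal (total_osc x) \<partial>Cs)"
      using m_fin le unfolding image_eq[symmetric]
      by (intro nn_integral_less image_meas total_meas) auto
    then show False
      using total_le image_eq by simp
  qed
  have "AE x in Cs. total_osc x = 0"
    using ge AE_cavity_Theta[OF \<alpha> p \<mu>, of T]
  proof eventually_elim
    case (elim x)
    have "total_osc x \<le> osc (cavity_image x)"
      using elim(1) osc_nonneg by (subst (asm) ennreal_le_iff) auto
    moreover have "osc (cavity_image x) < total_osc x" if "0 < total_osc x"
      using that elim(2) sym by (intro osc_cavity_field_less[OF p \<beta>]) auto
    moreover have "0 \<le> total_osc x"
      by (intro sum_nonneg osc_nonneg)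
    ultimately show ?case
      by linarith
  qed
  from AE_cavity_image_0[OF this] show ?thesis
    using fixed by simp
qed

end

lemma return_0: "sets (return borel (0 :: spin \<Rightarrow>\<^sub>C real)) = sets borel" "prob_space (return borel (0 :: spin \<Rightarrow>\<^sub>C real))"
  by (auto intro: prob_space_return)

lemma AE_return_0: "AE f in return borel (0 :: spin \<Rightarrow>\<^sub>C real). f = 0"
proof -
  have "{f \<in> space borel. f = (0 :: spin \<Rightarrow>\<^sub>C real)} \<in> sets borel"
    by simp
  then show ?thesis
    by (subst AE_return) (auto simp: pred_def)
qed

lemma AE_cavity_X_0: "AE x in cavity_space \<alpha> p T (return borel 0). \<forall>k\<in>{1..}. fst x k = 0"
  by (rule AE_cavity_X[OF \<alpha> p return_0 AE_return_0])

lemma unique_fixed_point: "(THE \<mu>. \<mu> \<in> Pr1 \<and> \<T> \<alpha> p T \<beta> \<mu> = \<mu>) = return borel 0"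
proof (rule the_equality)
  have "AE x in cavity_space \<alpha> p T (return borel 0). (\<Sum>k=1..fst (snd x) * (p - 1). osc (fst x k)) = 0"
    using AE_cavity_X_0 by eventually_elim (auto intro!: sum.neutral simp: osc_def)
  then have "\<T> \<alpha> p T \<beta> (return borel 0) = return borel 0"
    by (rule AE_cavity_image_0[OF return_0])
  moreover have "integrable (return borel (0 :: spin \<Rightarrow>\<^sub>C real)) norm"
  proof -
    have "integrable (return borel (0 :: spin \<Rightarrow>\<^sub>C real)) norm
        \<longleftrightarrow> integrable (return borel (0 :: spin \<Rightarrow>\<^sub>C real)) (\<lambda>_. 0 :: real)"
      using AE_return_0 by (intro integrable_cong_AE) (auto elim: AE_mp)
    then show ?thesis
      by simp
  qed
  ultimately show "return borel 0 \<in> Pr1 \<and> \<T> \<alpha> p T \<beta> (return borel 0) = return borel 0"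
    using return_0 by (simp add: Pr1_def)
  show "\<mu> = return borel 0" if "\<mu> \<in> Pr1 \<and> \<T> \<alpha> p T \<beta> \<mu> = \<mu>" for \<mu>
    using that by (intro fixed_point_imp_0) (auto simp: Pr1_def)
qed

text \<open>
  With vanishing fields both terms are expectations over hyperforests with independent constraints:
  a star with \<open>\<alpha> p\<close> edges in the mean and a single edge. The weights \<open>\<alpha> p\<close> and \<open>\<alpha> (p - 1)\<close> combine
  to \<open>\<alpha>\<close>.
\<close>

theorem F_pos_eq: "F_pos \<alpha> p T \<beta> = \<alpha> * measure_pmf.expectation T (\<lambda>\<theta>. ln (avg (cube p) (\<lambda>x. exp (\<beta> * \<theta> x))))"
proof -
  let ?\<mu> = "return borel (0 :: spin \<Rightarrow>\<^sub>C real)"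
  let ?C = "cavity_space \<alpha> p T ?\<mu>" and ?X = "\<Pi>\<^sub>M k\<in>{1::nat..}. ?\<mu>"
  let ?g = "\<lambda>\<theta>. ln (avg (cube p) (\<lambda>x. exp (\<beta> * \<theta> x)))"
  interpret X: prob_space ?X
    by (intro prob_space_PiM return_0)
  have "(\<integral>(X, r, \<Theta>). ln (bracket \<beta> X (r * (p - 1)) (\<lambda>\<sigma>. measure_pmf.expectation \<nu> (\<lambda>s. \<E> p \<beta> r \<Theta> \<sigma> s))) \<partial>?C)
      = (\<integral>x. ln (avg UNIV (cavity_Z p \<beta> (fst x) (fst (snd x)) (snd (snd x)))) \<partial>?C)"
    unfolding bracket_mean_eq_avg_cavity_Z case_prod_beta ..
  also have "\<dots> = (\<integral>x. (\<Sum>k=1..fst (snd x). ?g (snd (snd x) k)) \<partial>?C)"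
  proof (rule integral_cong_AE)
    show "AE x in ?C. ln (avg UNIV (cavity_Z p \<beta> (fst x) (fst (snd x)) (snd (snd x)))) = (\<Sum>k=1..fst (snd x). ?g (snd (snd x) k))"
      using AE_cavity_X_0 AE_cavity_Theta[OF \<alpha> p return_0, of T]
    proof eventually_elim
      case (elim x)
      have "avg UNIV (cavity_Z p \<beta> (fst x) (fst (snd x)) (snd (snd x)))
          = (\<Prod>k=1..fst (snd x). avg (cube p) (\<lambda>y. exp (\<beta> * snd (snd x) k y)))"
        using elim sym by (intro avg_cavity_Z_0[OF p \<beta>]) auto
      moreover have pos: "0 < avg (cube p) (\<lambda>y. exp (\<beta> * snd (snd x) k y))" for k
        by (intro avg_pos finite_cube cube_nonempty) auto
      have "ln (\<Prod>k=1..fst (snd x). avg (cube p) (\<lambda>y. exp (\<beta> * snd (snd x) k y))) = (\<Sum>k=1..fst (snd x). ?g (snd (snd x) k))"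
        by (rule ln_prod) (simp_all add: less_imp_neq[OF pos, symmetric])
      ultimately show ?case
        by simp
    qed
    show "(\<lambda>x. ln (avg UNIV (cavity_Z p \<beta> (fst x) (fst (snd x)) (snd (snd x))))) \<in> borel_measurable ?C"
      unfolding avg_UNIV_spin
      by (intro borel_measurable_ln borel_measurable_divide borel_measurable_add measurable_cavity_Z[OF return_0]) simp
    show "(\<lambda>x. \<Sum>k=1..fst (snd x). ?g (snd (snd x) k)) \<in> borel_measurable ?C"
      by (intro measurable_cavity_by_r[OF \<alpha> p return_0, where f = "\<lambda>r x. \<Sum>k=1..r. ?g (snd (snd x) k)"]
          borel_measurable_sum measurable_compose[OF measurable_cavity_Theta[OF \<alpha> p return_0]]) auto
  qed
  also have "\<dots> = \<alpha> * real p * measure_pmf.expectation T ?g"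
    by (rule integral_cavity_Theta_sum[OF \<alpha> p return_0 fin])
  finally have first: "(\<integral>(X, r, \<Theta>). ln (bracket \<beta> X (r * (p - 1)) (\<lambda>\<sigma>. measure_pmf.expectation \<nu> (\<lambda>s. \<E> p \<beta> r \<Theta> \<sigma> s))) \<partial>?C)
      = \<alpha> * real p * measure_pmf.expectation T ?g" .
  let ?XT = "?X \<Otimes>\<^sub>M measure_pmf T"
  let ?f = "\<lambda>y. ln (bracket \<beta> (fst y) p (\<lambda>\<sigma>. exp (\<beta> * snd y (map \<sigma> [1..<p+1]))))"
  have snd: "distr ?XT (measure_pmf T) snd = measure_pmf T"
    by (intro distr_pair_snd X.prob_space_axioms measure_pmf.sigma_finite_measure_axioms)
  have "(\<integral>y. ?f y \<partial>?XT) = (\<integral>y. ?g (snd y) \<partial>?XT)"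
  proof (rule integral_cong_AE)
    have "AE y in ?XT. snd y \<in> set_pmf T"
      by (rule AE_distrD[of snd _ "measure_pmf T"]) (simp_all only: snd measurable_snd, simp add: AE_measure_pmf_iff)
    moreover have "AE y in ?XT. \<forall>k\<in>{1..}. fst y k = 0"
    proof (rule AE_distrD[of fst _ ?X])
      have "AE X in ?X. X k = 0" if "k \<in> {1..}" for k
        by (rule AE_PiM_component[where M = "\<lambda>_. ?\<mu>" and P = "\<lambda>f. f = 0", OF return_0(2) that AE_return_0])
      then have "AE X in ?X. \<forall>k\<in>{1..}. X k = 0"
        by (subst AE_ball_countable) auto
      then show "AE X in distr ?XT ?X fst. \<forall>k\<in>{1..}. X k = 0"
        by (simp only: measure_pmf.distr_pair_fst)
    qed simp
    ultimately show "AE y in ?XT. ?f y = ?g (snd y)"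
    proof eventually_elim
      case (elim y)
      have "bracket \<beta> (fst y) p (\<lambda>\<sigma>. exp (\<beta> * snd y (map \<sigma> [1..<p+1])))
          = avg ({1..p} \<rightarrow>\<^sub>E UNIV) (\<lambda>\<sigma>. \<Prod>k\<in>{0 :: nat}. (\<lambda>k x. exp (\<beta> * snd y x)) k (map \<sigma> ((\<lambda>k. [1..<p+1]) k)))"
        unfolding bracket_eq_avg using elim by (intro avg_cong) simp
      also have "\<dots> = (\<Prod>k\<in>{0 :: nat}. avg (cube p) (\<lambda>x. exp (\<beta> * snd y x)))"
      proof (rule avg_prod_hyperforest)
        show "hyperforest (\<lambda>k. [1..<p+1]) {0 :: nat}"
          by (simp add: hyperforest_def conn_def adj_def)
        show "symmetric_fun p (\<lambda>x. exp (\<beta> * snd y x))"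
          using sym[OF elim(1)] by (simp add: symmetric_fun_def)
      qed auto
      finally show ?case
        by simp
    qed
    have X: "(\<lambda>y. apply_bcontfun (fst y k) s) \<in> borel_measurable ?XT" if "k \<in> {1..}" for k s
      using that measurable_apply_bcontfun[of s]
      by (intro measurable_compose[OF measurable_compose[OF measurable_fst measurable_component_singleton]])
         (auto cong: measurable_cong_sets)
    have Th: "(\<lambda>y. snd y L) \<in> borel_measurable ?XT" for L
      by (intro measurable_compose[OF measurable_snd]) auto
    show "?f \<in> borel_measurable ?XT"
      unfolding bracket_eq_avg avg_def
      by (intro borel_measurable_ln borel_measurable_divide borel_measurable_sum borel_measurable_times borel_measurable_prod
        borel_measurable_const measurable_compose[OF _ borel_measurable_exp] X Th) auto
    show "(\<lambda>y. ?g (snd y)) \<in> borel_measurable ?XT"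
      by (intro measurable_compose[OF measurable_snd]) auto
  qed
  also have "\<dots> = (\<integral>\<theta>. ?g \<theta> \<partial>distr ?XT (measure_pmf T) snd)"
    by (intro integral_distr[symmetric]) auto
  also have "\<dots> = measure_pmf.expectation T ?g"
    unfolding snd ..
  finally have second: "(\<integral>(X, \<theta>). ln (bracket \<beta> X p (\<lambda>\<sigma>. exp (\<beta> * \<theta> (map \<sigma> [1..<p+1])))) \<partial>?XT)
      = measure_pmf.expectation T ?g"
    by (simp only: case_prod_unfold)
  show ?thesis
    unfolding F_pos_def unique_fixed_point \<P>_def first second by (simp add: algebra_simps)
qed

end

section \<open>Differentiability of F\<close>

lemma differentiable_ln_avg_exp:
  fixes \<theta> :: "spin list \<Rightarrow> real"
  shows "(\<lambda>\<beta>. ln (avg (cube p) (\<lambda>x. exp (\<beta> * \<theta> x)))) differentiable (at \<beta>)"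
proof -
  have "((\<lambda>\<beta>. avg (cube p) (\<lambda>x. exp (\<beta> * \<theta> x))) has_real_derivative avg (cube p) (\<lambda>x. \<theta> x * exp (\<beta> * \<theta> x))) (at \<beta>)"
    unfolding avg_def divide_inverse
    by (intro DERIV_cmult_right DERIV_sum) (auto intro!: derivative_eq_intros)
  moreover have "0 < avg (cube p) (\<lambda>x. exp (\<beta> * \<theta> x))"
    by (intro avg_pos finite_cube cube_nonempty) auto
  ultimately show ?thesis
    unfolding real_differentiable_def by (intro exI) (rule DERIV_chain2[OF DERIV_ln])
qed

text \<open>
  The formula is insensitive to the sign of \<open>\<beta>\<close>, because changing the signs of both \<open>\<beta>\<close> and the
  constraint does not change \<open>\<beta> \<theta>\<close>. It is this uniformity that gives differentiability at 0.
\<close>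

lemma F_eq:
  assumes "0 < \<alpha>" "2 \<le> p" "\<alpha> * real p * (real p - 1) \<le> 1"
    and fin: "finite (set_pmf T)" and sym: "\<And>\<theta>. \<theta> \<in> set_pmf T \<Longrightarrow> symmetric_fun p \<theta>"
  shows "F \<alpha> p T \<beta> = \<alpha> * measure_pmf.expectation T (\<lambda>\<theta>. ln (avg (cube p) (\<lambda>x. exp (\<beta> * \<theta> x))))"
proof -
  let ?neg = "\<lambda>\<theta>. \<lambda>x\<in>cube p. - \<theta> x :: real"
  have uminus_cube: "map uminus x \<in> cube p" if "x \<in> cube p" for x :: "spin list"
    using that by (simp add: cube_def)
  consider "\<beta> > 0" | "\<beta> < 0" | "\<beta> = 0"
    by linarith
  then show ?thesis
  proof cases
    case 1
    then show ?thesis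
      using F_pos_eq[OF assms(1,2) 1 assms(3) fin sym] by (simp add: F_def)
  next
    case 2
    have "symmetric_fun p \<theta>" if "\<theta> \<in> set_pmf (map_pmf ?neg T)" for \<theta>
      using that sym uminus_cube by (auto simp: symmetric_fun_def)
    then have "F \<alpha> p T \<beta> = \<alpha> * measure_pmf.expectation (map_pmf ?neg T) (\<lambda>\<theta>. ln (avg (cube p) (\<lambda>x. exp (\<bar>\<beta>\<bar> * \<theta> x))))"
      using 2 F_pos_eq[OF assms(1,2) _ assms(3), of "\<bar>\<beta>\<bar>" "map_pmf ?neg T"] fin by (simp add: F_def)
    also have "avg (cube p) (\<lambda>x. exp (\<bar>\<beta>\<bar> * ?neg \<theta> x)) = avg (cube p) (\<lambda>x. exp (\<beta> * \<theta> x))" for \<theta>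
      using 2 by (intro avg_cong) simp
    then have "measure_pmf.expectation (map_pmf ?neg T) (\<lambda>\<theta>. ln (avg (cube p) (\<lambda>x. exp (\<bar>\<beta>\<bar> * \<theta> x))))
        = measure_pmf.expectation T (\<lambda>\<theta>. ln (avg (cube p) (\<lambda>x. exp (\<beta> * \<theta> x))))"
      unfolding integral_map_pmf by simp
    finally show ?thesis .
  next
    case 3
    then show ?thesis
      by (simp add: F_def avg_const finite_cube cube_nonempty)
  qed
qed

lemma F_differentiable:
  assumes "0 < \<alpha>" "2 \<le> p" "\<alpha> * real p * (real p - 1) \<le> 1"
    and fin: "finite (set_pmf T)" and "\<And>\<theta>. \<theta> \<in> set_pmf T \<Longrightarrow> symmetric_fun p \<theta>"
  shows "F \<alpha> p T differentiable (at \<beta>)"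
proof -
  have "F \<alpha> p T = (\<lambda>\<beta>. \<alpha> * (\<Sum>\<theta>\<in>set_pmf T. ln (avg (cube p) (\<lambda>x. exp (\<beta> * \<theta> x))) * pmf T \<theta>))"
    using F_eq[OF assms] by (intro ext) (simp add: integral_measure_pmf_real[OF fin])
  then show ?thesis
    using fin by (simp add: differentiable_ln_avg_exp)
qed

section \<open>Randomly signed constraints\<close>

lemma finite_constraint_funs: "finite (constraint_funs p)"
  unfolding constraint_funs_def by (intro finite_PiE finite_cube) auto

lemma replicate_pmf_\<nu>: "replicate_pmf p \<nu> = pmf_of_set (cube p)"
proof (induction p)
  case 0
  have "cube 0 = {[]}"
    by (auto simp: cube_def)
  then show ?case
    by (simp add: pmf_of_set_singleton)
next
  case (Suc p)
  have pair: "pair_pmf \<nu> (pmf_of_set (cube p)) = pmf_of_set (UNIV \<times> cube p)"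
  proof (rule pmf_eqI)
    fix y :: "spin \<times> spin list"
    show "pmf (pair_pmf \<nu> (pmf_of_set (cube p))) y = pmf (pmf_of_set (UNIV \<times> cube p)) y"
      unfolding \<nu>_def by (cases y) (simp add: pmf_pair finite_cube cube_nonempty card_cartesian_product indicator_def)
  qed
  have "replicate_pmf (Suc p) \<nu> = map_pmf (\<lambda>(x, xs). x # xs) (pair_pmf \<nu> (replicate_pmf p \<nu>))"
    by (simp add: pair_pmf_def map_bind_pmf bind_return_pmf map_pmf_def bind_assoc_pmf)
  also have "\<dots> = map_pmf (\<lambda>(x, xs). x # xs) (pmf_of_set (UNIV \<times> cube p))"
    by (simp add: Suc.IH pair)
  also have "\<dots> = pmf_of_set ((\<lambda>(x, xs). x # xs) ` (UNIV \<times> cube p))"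
    by (rule map_pmf_of_set_inj) (auto simp: inj_on_def finite_cube cube_nonempty)
  also have "(\<lambda>(x, xs). x # xs) ` (UNIV \<times> cube p) = cube (Suc p)"
    by (force simp: cube_def image_iff length_Suc_conv)
  finally show ?case .
qed

lemma prob_uniform_cube: "measure_pmf.prob (replicate_pmf p \<nu>) {x. \<phi> x = 0} = avg (cube p) (\<lambda>x. of_bool (\<phi> x = 0))"
  unfolding replicate_pmf_\<nu>
  by (subst measure_pmf_of_set[OF cube_nonempty finite_cube], subst avg_indicator[OF finite_cube]) (simp add: Int_def)

lemma avg_zero_strictly_between:
  assumes \<phi>: "\<phi> \<in> constraint_funs p" and xy: "x \<in> cube p" "y \<in> cube p" "\<phi> x \<noteq> \<phi> y"
  shows "0 < avg (cube p) (\<lambda>x. of_bool (\<phi> x = 0))" "avg (cube p) (\<lambda>x. of_bool (\<phi> x = 0)) < 1"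
proof -
  have "\<phi> x \<in> {-1, 0}" "\<phi> y \<in> {-1, 0}"
    using \<phi> xy by (auto simp: constraint_funs_def)
  then obtain a b where a: "a \<in> cube p" "\<phi> a = 0" and b: "b \<in> cube p" "\<phi> b \<noteq> 0"
    using xy by (metis insertE singletonD)
  have "avg (cube p) (\<lambda>_. 0) < avg (cube p) (\<lambda>x. of_bool (\<phi> x = 0))"
    by (rule avg_strict_mono[OF finite_cube _ a(1)]) (use a in auto)
  then show "0 < avg (cube p) (\<lambda>x. of_bool (\<phi> x = 0))"
    by (simp add: avg_const finite_cube cube_nonempty)
  have "avg (cube p) (\<lambda>x. of_bool (\<phi> x = 0)) < avg (cube p) (\<lambda>_. 1)"
    by (rule avg_strict_mono[OF finite_cube _ b(1)]) (use b in auto)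
  then show "avg (cube p) (\<lambda>x. of_bool (\<phi> x = 0)) < 1"
    by (simp add: avg_const finite_cube cube_nonempty)
qed

text \<open>
  Multiplication by a fixed sign vector is a bijection of the cube that commutes with the global
  flip.
\<close>

lemma signed_law_support:
  assumes \<phi>: "\<phi> \<in> constraint_funs p" and sym: "symmetric_fun p \<phi>" and \<theta>: "\<theta> \<in> set_pmf (signed_law p \<phi> G)"
  shows "\<theta> \<in> constraint_funs p \<and> symmetric_fun p \<theta> \<and>
    avg (cube p) (\<lambda>x. of_bool (\<theta> x = 0)) = avg (cube p) (\<lambda>x. of_bool (\<phi> x = 0))"
proof -
  obtain g where g: "g \<in> cube p" and \<theta>: "\<theta> = (\<lambda>x\<in>cube p. \<phi> (map2 (*) g x))"
    using \<theta> by (auto simp: signed_law_def set_replicate_pmf cube_def)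
  have mult: "map2 (*) g x \<in> cube p" if "x \<in> cube p" for x
    using g that by (simp add: cube_def)
  have "map2 (*) g (map uminus x) = map uminus (map2 (*) g x)" if "x \<in> cube p" for x
  proof (rule nth_equalityI)
    have "a * - b = - (a * b)" for a b :: spin
      by transfer simp
    then show "map2 (*) g (map uminus x) ! i = map uminus (map2 (*) g x) ! i" if "i < length (map2 (*) g (map uminus x))" for i
      using that by simp
  qed simp
  moreover have "map uminus x \<in> cube p" if "x \<in> cube p" for x :: "spin list"
    using that by (simp add: cube_def)
  ultimately have "symmetric_fun p \<theta>"
    using sym mult unfolding symmetric_fun_def \<theta> by (metis restrict_apply')
  moreover have "\<theta> \<in> constraint_funs p"
    using \<phi> mult unfolding \<theta> constraint_funs_def by (auto simp: PiE_def Pi_def)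
  moreover have "avg (cube p) (\<lambda>x. of_bool (\<theta> x = 0)) = avg (cube p) (\<lambda>x. of_bool (\<phi> (map2 (*) g x) = 0))"
    unfolding \<theta> by (rule avg_cong) simp
  moreover have "\<dots> = avg (cube p) (\<lambda>x. of_bool (\<phi> x = 0))"
    by (rule avg_bij[OF bij_betw_cube_mult_left[OF g], of "\<lambda>x. of_bool (\<phi> x = 0)"])
  ultimately show ?thesis
    by simp
qed

theorem corollary2p2:
  fixes p :: nat and \<alpha> :: real and T :: "(spin list \<Rightarrow> real) pmf"
    and \<phi> :: "spin list \<Rightarrow> real" and G :: "spin pmf"
    and M :: "'w measure" and \<Theta> :: "nat \<Rightarrow> 'w \<Rightarrow> spin list \<Rightarrow> real"
    and K :: "nat \<Rightarrow> 'w \<Rightarrow> nat" and I :: "nat \<Rightarrow> nat \<Rightarrow> 'w \<Rightarrow> nat list"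
  defines "\<rho> \<equiv> measure_pmf.prob (replicate_pmf p \<nu>) {x. \<phi> x = 0}"
  assumes "p \<ge> 2" and "\<alpha> > 0" and "\<alpha> * real p * (real p - 1) \<le> 1"
    and "set_pmf T \<subseteq> constraint_funs p"
  shows "((\<forall>\<theta>\<in>set_pmf T. symmetric_fun p \<theta>) \<longrightarrow> (\<forall>\<beta>. F \<alpha> p T differentiable (at \<beta>))) \<and>
    (\<phi> \<in> constraint_funs p \<and> (\<exists>x\<in>cube p. \<exists>y\<in>cube p. \<phi> x \<noteq> \<phi> y) \<and> symmetric_fun p \<phi> \<and>
       T = signed_law p \<phi> G \<longrightarrow>
     0 < \<rho> \<and> \<rho> < 1 \<and>
     (csp_model \<alpha> p T M \<Theta> K I \<longrightarrow>
      (\<forall>t. 0 < t \<and> t < 1 \<longrightarrow>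
       (AE \<omega> in M.
        ((\<lambda>\<epsilon>. limsup (\<lambda>N. \<bar>ereal (1 / real N) *
              log_count (AN N (K N \<omega>) (\<lambda>k. \<Theta> k \<omega>) (\<lambda>k. I N k \<omega>) \<epsilon> t) -
            ereal (ln 2 + \<alpha> * (1 - t) * ln ((1 - \<rho>) / (1 - t)) + \<alpha> * t * ln (\<rho> / t))\<bar>))
          \<longlongrightarrow> 0) (at_right 0)))))"
proof (intro conjI impI)
  have fin: "finite (set_pmf T)"
    using assms(5) finite_constraint_funs by (rule finite_subset)
  show "\<forall>\<beta>. F \<alpha> p T differentiable (at \<beta>)" if "\<forall>\<theta>\<in>set_pmf T. symmetric_fun p \<theta>"
    using F_differentiable[OF assms(3,2,4) fin] that by blast
next
  assume *: "\<phi> \<in> constraint_funs p \<and> (\<exists>x\<in>cube p. \<exists>y\<in>cube p. \<phi> x \<noteq> \<phi> y) \<and> symmetric_fun p \<phi> \<and>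
       T = signed_law p \<phi> G"
  have \<rho>: "\<rho> = avg (cube p) (\<lambda>x. of_bool (\<phi> x = 0))"
    unfolding \<rho>_def by (rule prob_uniform_cube)
  show \<rho>0: "0 < \<rho>" and \<rho>1: "\<rho> < 1"
    using * avg_zero_strictly_between[of \<phi> p] unfolding \<rho> by blast+
  assume model: "csp_model \<alpha> p T M \<Theta> K I"
  show "\<forall>t. 0 < t \<and> t < 1 \<longrightarrow>
       (AE \<omega> in M.
        ((\<lambda>\<epsilon>. limsup (\<lambda>N. \<bar>ereal (1 / real N) *
              log_count (AN N (K N \<omega>) (\<lambda>k. \<Theta> k \<omega>) (\<lambda>k. I N k \<omega>) \<epsilon> t) -
            ereal (ln 2 + \<alpha> * (1 - t) * ln ((1 - \<rho>) / (1 - t)) + \<alpha> * t * ln (\<rho> / t))\<bar>))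
          \<longlongrightarrow> 0) (at_right 0))"
  proof (intro allI impI)
    fix t :: real assume t: "0 < t \<and> t < 1"
    have "\<theta> \<in> constraint_funs p \<and> symmetric_fun p \<theta> \<and> avg (cube p) (\<lambda>x. of_bool (\<theta> x = 0)) = \<rho>"
      if "\<theta> \<in> set_pmf T" for \<theta>
      unfolding \<rho> using * that by (intro signed_law_support[of \<phi> p \<theta> G]) auto
    then show "AE \<omega> in M.
        ((\<lambda>\<epsilon>. limsup (\<lambda>N. \<bar>ereal (1 / real N) *
              log_count (AN N (K N \<omega>) (\<lambda>k. \<Theta> k \<omega>) (\<lambda>k. I N k \<omega>) \<epsilon> t) -
            ereal (ln 2 + \<alpha> * (1 - t) * ln ((1 - \<rho>) / (1 - t)) + \<alpha> * t * ln (\<rho> / t))\<bar>))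
          \<longlongrightarrow> 0) (at_right 0)"
      using t by (intro csp_AN_limit[OF model assms(3,2,4) _ _ \<rho>0 \<rho>1]) auto
  qed
qed

end
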